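(* Let $\Omega\subseteq\mathbb{C}^n$ be a bounded domain, let $1\le p<q$ be integers, let $\mathcal{H}\in B_1^*(\Omega)$, let $\Theta\in\mathcal{M}_{\mathcal{B}(\mathbb{C}^p,\mathbb{C}^q)}(\mathcal{H})$ be a left invertible multiplier, and let $\mathcal{H}_\Theta=(\mathcal{H}\otimes\mathbb{C}^q)/M_\Theta(\mathcal{H}\otimes\mathbb{C}^p)$ be the associated generalized canonical model. Then $$\mathcal{K}_{E^*_{\mathcal{H}_\Theta}}-\mathcal{K}_{E^*_{\mathcal{H}}}=\mathcal{K}_{V^*_\Theta}.$$
   Context: All Hilbert spaces are complex and separable. A Hilbert module over $\mathbb{C}[\boldsymbol{z}]=\mathbb{C}[z_1,\dots,z_n]$ is a Hilbert space $\mathcal{H}$ with a commuting tuple $(M_1,\dots,M_n)$ of bounded operators, with action $p\cdot h=p(M_1,\dots,M_n)h$. If $\mathcal{S}$ is a submodule (closed jointly invariant subspace), the quotient module $\mathcal{H}/\mathcal{S}$ is identified with $\mathcal{S}^\perp$ with operators $P_{\mathcal{S}^\perp}M_i|_{\mathcal{S}^\perp}$. For a Hilbert space $\mathcal{E}$, $\mathcal{H}\otimes\mathcal{E}$ carries the operators $M_i\otimes I_{\mathcal{E}}$. For $m\ge1$, $B_m^*(\Omega)$ is the class of Hilbert modules $\mathcal{H}$ over $\mathbb{C}[\boldsymbol{z}]$ such that for every $\boldsymbol{w}\in\Omega$: (i) the column operator $\mathcal{H}\to\mathcal{H}\otimes\mathbb{C}^n$, $h\mapsto((M_1-w_1)^*h,\dots,(M_n-w_n)^*h)$,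 has closed range; (ii) $\dim\bigcap_{i=1}^n\ker(M_i-w_i)^*=m$; and (iii) $\bigvee_{\boldsymbol{w}\in\Omega}\bigcap_{i=1}^n\ker(M_i-w_i)^*=\mathcal{H}$. For $\mathcal{H}\in B_m^*(\Omega)$, $E_{\mathcal{H}}^*$ is the rank-$m$ hermitian anti-holomorphic vector bundle over $\Omega$ with fibers $E_{\mathcal{H}}^*(\boldsymbol{w})=\bigcap_i\ker(M_i-w_i)^*$ and the metric inherited from $\mathcal{H}$. For $\mathcal{H}\in B_1^*(\Omega)$ and Hilbert spaces $\mathcal{E},\mathcal{E}_*$, $\mathcal{M}_{\mathcal{B}(\mathcal{E},\mathcal{E}_* )}(\mathcal{H})$ consists of the holomorphic $\Theta:\Omega\to\mathcal{B}(\mathcal{E},\mathcal{E}_* )$ for which multiplication by $\Theta$ defines a bounded module map $M_\Theta:\mathcal{H}\otimes\mathcal{E}\to\mathcal{H}\otimes\mathcal{E}_*$; that is, $M_\Theta^*(k\otimes\eta)=k\otimes\Theta(\boldsymbol{w})^*\eta$ for all $\boldsymbol{w}\in\Omega$, $k\in E_{\mathcal{H}}^*(\boldsymbol{w})$, $\eta\in\mathcal{E}_*$. It is left invertible if there is $\Psi\in\mathcal{M}_{\mathcal{B}(\mathcal{E}_*,\mathcal{E})}(\mathcal{H})$ with $\Psi(\boldsymbol{w})\Theta(\boldsymbol{w})=I_{\mathcal{E}}$ for all $\boldsymbol{w}\in\Omega$. For $\Theta$ as in the claim, $\mathcal{H}_\Theta\in B_{q-p}^*(\Omega)$, and $V_\Theta^*$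 denotes the hermitian anti-holomorphic vector bundle over $\Omega$ with fibers $V_\Theta^*(\boldsymbol{w})=\ker\Theta(\boldsymbol{w})^*\subseteq\mathbb{C}^q$ (metric inherited from $\mathbb{C}^q$); one has $E^*_{\mathcal{H}_\Theta}\cong E^*_{\mathcal{H}}\otimes V_\Theta^*$. For a hermitian anti-holomorphic vector bundle $E$, $\mathcal{K}_E$ is the curvature of its Chern connection, given in a local anti-holomorphic frame with Gramian $G$ by $\bar\partial[G^{-1}\partial G]$. Under the identification $E^*_{\mathcal{H}_\Theta}\cong E^*_{\mathcal{H}}\otimes V_\Theta^*$, the displayed equality means $\mathcal{K}_{E^*_{\mathcal{H}_\Theta}}(\boldsymbol{w})-\mathcal{K}_{E^*_{\mathcal{H}}}(\boldsymbol{w})\otimes I_{V_\Theta^*(\boldsymbol{w})}=I_{E^*_{\mathcal{H}}(\boldsymbol{w})}\otimes\mathcal{K}_{V^*_\Theta}(\boldsymbol{w})$ for all $\boldsymbol{w}\in\Omega$. *)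

theory Defs
  imports "HOL-Analysis.Analysis"
begin

section \<open>Complex Hilbert spaces\<close>

text \<open>Positivity and completeness come from the real structure: the real inner product
  is the real part of the complex one. The complex inner product is linear in its first argument.\<close>

class complex_inner = real_inner +
  fixes scaleC :: "complex \<Rightarrow> 'a \<Rightarrow> 'a" (infixr "*\<^sub>C" 75)
    and cinner :: "'a \<Rightarrow> 'a \<Rightarrow> complex"
  assumes scaleC_right_distrib: "c *\<^sub>C (x + y) = c *\<^sub>C x + c *\<^sub>C y"
    and scaleC_left_distrib: "(c + d) *\<^sub>C x = c *\<^sub>C x + d *\<^sub>C x"
    and scaleC_scaleC: "c *\<^sub>C d *\<^sub>C x = (c * d) *\<^sub>C x"
    and scaleC_of_real: "complex_of_real r *\<^sub>C x = r *\<^sub>R x"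
    and cinner_add_left: "cinner (x + y) z = cinner x z + cinner y z"
    and cinner_scaleC_left: "cinner (c *\<^sub>C x) y = c * cinner x y"
    and cinner_commute: "cinner x y = cnj (cinner y x)"
    and inner_eq_Re_cinner: "x \<bullet> y = Re (cinner x y)"

class chilbert_space = complex_inner + complete_space

interpretation cvec: vector_space "scaleC :: complex \<Rightarrow> 'a::complex_inner \<Rightarrow> 'a"
proof
  show "1 *\<^sub>C x = x" for x :: 'a
    using scaleC_of_real[of 1 x] by simp
qed (simp_all add: scaleC_right_distrib scaleC_left_distrib scaleC_scaleC)

instantiation complex :: chilbert_space
begin

definition scaleC_complex :: "complex \<Rightarrow> complex \<Rightarrow> complex"
  where "scaleC_complex c x = c * x"

definition cinner_complex :: "complex \<Rightarrow> complex \<Rightarrow> complex"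
  where "cinner_complex x y = x * cnj y"

instance
  by standard
    (simp_all add: scaleC_complex_def cinner_complex_def algebra_simps scaleR_conv_of_real
      inner_complex_def)

end

instantiation vec :: (complex_inner, finite) complex_inner
begin

definition scaleC_vec :: "complex \<Rightarrow> 'a ^ 'b \<Rightarrow> 'a ^ 'b"
  where "scaleC_vec c x = (\<chi> i. c *\<^sub>C (x $ i))"

definition cinner_vec :: "'a ^ 'b \<Rightarrow> 'a ^ 'b \<Rightarrow> complex"
  where "cinner_vec x y = (\<Sum>i\<in>UNIV. cinner (x $ i) (y $ i))"

instance
proof
  fix x y :: "'a ^ 'b"
  show "cinner x y = cnj (cinner y x)"
    unfolding cinner_vec_def cnj_sum by (rule sum.cong[OF refl]) (rule cinner_commute)
  show "x \<bullet> y = Re (cinner x y)"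
    by (simp add: cinner_vec_def inner_vec_def inner_eq_Re_cinner)
qed (simp_all add: scaleC_vec_def cinner_vec_def vec_eq_iff scaleC_right_distrib
      scaleC_left_distrib scaleC_scaleC scaleC_of_real cinner_add_left cinner_scaleC_left
      sum.distrib sum_distrib_left)

end

instance vec :: (chilbert_space, finite) chilbert_space ..


section \<open>Operators on closed subspaces\<close>

text \<open>Hilbert spaces are closed subspaces of an ambient type; operators are functions whose
  values off the subspace are irrelevant.\<close>

definition hilbert_subspace :: "'h::chilbert_space set \<Rightarrow> bool"
  where "hilbert_subspace V \<longleftrightarrow> cvec.subspace V \<and> closed V \<and>
    (\<exists>D. countable D \<and> D \<subseteq> V \<and> V \<subseteq> closure D)"

definition bounded_op_on ::
    "'h::chilbert_space set \<Rightarrow> 'k::chilbert_space set \<Rightarrow> ('h \<Rightarrow> 'k) \<Rightarrow> bool"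
  where "bounded_op_on V W T \<longleftrightarrow>
    (\<forall>x\<in>V. T x \<in> W) \<and>
    (\<forall>x\<in>V. \<forall>y\<in>V. T (x + y) = T x + T y) \<and>
    (\<forall>c. \<forall>x\<in>V. T (c *\<^sub>C x) = c *\<^sub>C T x) \<and>
    (\<exists>B. \<forall>x\<in>V. norm (T x) \<le> B * norm x)"

text \<open>The adjoint of an operator with domain \<open>V\<close>.\<close>

definition adj_on :: "'h::chilbert_space set \<Rightarrow> ('h \<Rightarrow> 'k::chilbert_space) \<Rightarrow> 'k \<Rightarrow> 'h"
  where "adj_on V T y = (THE z. z \<in> V \<and> (\<forall>x\<in>V. cinner (T x) y = cinner x z))"

definition ortho_proj :: "'h::chilbert_space set \<Rightarrow> 'h \<Rightarrow> 'h"
  where "ortho_proj V x = (THE y. y \<in> V \<and> (\<forall>z\<in>V. cinner (x - y) z = 0))"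


section \<open>Hilbert modules over the polynomial ring\<close>

text \<open>A module over the polynomials in \<open>z\<^sub>i\<close>, \<open>i :: 'n\<close>, is given by the operators of
  multiplication by the coordinates.\<close>

record ('n, 'h) hmod =
  carrier :: "'h set"
  mult :: "'n \<Rightarrow> 'h \<Rightarrow> 'h"

definition hilbert_module :: "('n::finite, 'h::chilbert_space) hmod \<Rightarrow> bool"
  where "hilbert_module H \<longleftrightarrow>
    hilbert_subspace (carrier H) \<and>
    (\<forall>i. bounded_op_on (carrier H) (carrier H) (mult H i)) \<and>
    (\<forall>i j. \<forall>x\<in>carrier H. mult H i (mult H j x) = mult H j (mult H i x))"

text \<open>\<open>H \<otimes> \<complex>\<^sup>q\<close>, realised as \<open>H\<^sup>q\<close> with \<open>q = CARD('q)\<close>.\<close>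

definition tensor_mod :: "('n, 'h) hmod \<Rightarrow> ('n, 'h ^ 'q) hmod"
  where "tensor_mod H = \<lparr>carrier = {x. \<forall>a. x $ a \<in> carrier H},
    mult = (\<lambda>i x. \<chi> a. mult H i (x $ a))\<rparr>"

definition etensor :: "'h::chilbert_space \<Rightarrow> complex ^ 'q \<Rightarrow> 'h ^ 'q" (infixr "\<otimes>\<^sub>e" 70)
  where "k \<otimes>\<^sub>e \<eta> = (\<chi> a. (\<eta> $ a) *\<^sub>C k)"

definition orth_compl_in :: "'h::chilbert_space set \<Rightarrow> 'h set \<Rightarrow> 'h set"
  where "orth_compl_in V S = {x\<in>V. \<forall>s\<in>S. cinner x s = 0}"

definition quotient_mod :: "('n, 'h::chilbert_space) hmod \<Rightarrow> 'h set \<Rightarrow> ('n, 'h) hmod"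
  where "quotient_mod H S = \<lparr>carrier = orth_compl_in (carrier H) S,
    mult = (\<lambda>i x. ortho_proj (orth_compl_in (carrier H) S) (mult H i x))\<rparr>"


section \<open>The classes \<open>B\<^sub>m\<^sup>*(\<Omega>)\<close>\<close>

definition shifted_adj ::
    "('n::finite, 'h::chilbert_space) hmod \<Rightarrow> complex ^ 'n \<Rightarrow> 'n \<Rightarrow> 'h \<Rightarrow> 'h"
  where "shifted_adj H w i = adj_on (carrier H) (\<lambda>x. mult H i x - (w $ i) *\<^sub>C x)"

text \<open>The fibre \<open>E\<^sub>H\<^sup>*(w)\<close>, the joint kernel of the operators \<open>(M\<^sub>i - w\<^sub>i)\<^sup>*\<close>.\<close>

definition eigen_fiber :: "('n::finite, 'h::chilbert_space) hmod \<Rightarrow> complex ^ 'n \<Rightarrow> 'h set"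
  where "eigen_fiber H w = {h \<in> carrier H. \<forall>i. shifted_adj H w i h = 0}"

text \<open>Since \<open>dim\<close> is \<open>0\<close> on infinite-dimensional spaces, \<open>m \<ge> 1\<close> makes the dimension
  condition the intended one.\<close>

definition B_star :: "nat \<Rightarrow> (complex ^ 'n) set \<Rightarrow> ('n::finite, 'h::chilbert_space) hmod set"
  where "B_star m \<Omega> = {H. 1 \<le> m \<and> hilbert_module H \<and>
    (\<forall>w\<in>\<Omega>. closed ((\<lambda>h. \<chi> i. shifted_adj H w i h) ` carrier H)) \<and>
    (\<forall>w\<in>\<Omega>. cvec.dim (eigen_fiber H w) = m) \<and>
    closure (cvec.span (\<Union>w\<in>\<Omega>. eigen_fiber H w)) = carrier H}"


section \<open>Multipliers and generalized canonical models\<close>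

definition holomorphic_vec ::
    "('a::complex_inner \<Rightarrow> 'b::complex_inner) \<Rightarrow> 'a set \<Rightarrow> bool"
  where "holomorphic_vec f U \<longleftrightarrow>
    (\<forall>z\<in>U. \<exists>D. (f has_derivative D) (at z) \<and> (\<forall>c v. D (c *\<^sub>C v) = c *\<^sub>C D v))"

definition antiholomorphic_vec ::
    "('a::complex_inner \<Rightarrow> 'b::complex_inner) \<Rightarrow> 'a set \<Rightarrow> bool"
  where "antiholomorphic_vec f U \<longleftrightarrow>
    (\<forall>z\<in>U. \<exists>D. (f has_derivative D) (at z) \<and> (\<forall>c v. D (c *\<^sub>C v) = cnj c *\<^sub>C D v))"

definition mat_adjoint :: "complex ^ 'p ^ 'q \<Rightarrow> complex ^ 'q ^ 'p"
  where "mat_adjoint A = (\<chi> i j. cnj (A $ j $ i))"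

text \<open>\<open>T\<close> is the operator \<open>M\<^sub>\<Theta>\<close>; for \<open>H\<close> in \<open>B\<^sub>1\<^sup>*(\<Omega>)\<close> it is
  determined on its domain, since the vectors \<open>k \<otimes> \<eta>\<close> span a dense subspace.\<close>

definition is_mult_op :: "(complex ^ 'n) set \<Rightarrow> ('n::finite, 'h::chilbert_space) hmod \<Rightarrow>
    (complex ^ 'n \<Rightarrow> complex ^ 'p ^ 'q) \<Rightarrow> ('h ^ 'p \<Rightarrow> 'h ^ 'q) \<Rightarrow> bool"
  where "is_mult_op \<Omega> H \<Theta> T \<longleftrightarrow>
    bounded_op_on (carrier (tensor_mod H)) (carrier (tensor_mod H)) T \<and>
    (\<forall>i. \<forall>x\<in>carrier (tensor_mod H).
       T (mult (tensor_mod H) i x) = mult (tensor_mod H) i (T x)) \<and>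
    (\<forall>w\<in>\<Omega>. \<forall>k\<in>eigen_fiber H w. \<forall>\<eta>.
       adj_on (carrier (tensor_mod H)) T (k \<otimes>\<^sub>e \<eta>) = k \<otimes>\<^sub>e (mat_adjoint (\<Theta> w) *v \<eta>))"

definition multipliers :: "(complex ^ 'n) set \<Rightarrow> ('n::finite, 'h::chilbert_space) hmod \<Rightarrow>
    (complex ^ 'n \<Rightarrow> complex ^ 'p ^ 'q) set"
  where "multipliers \<Omega> H = {\<Theta>. holomorphic_vec \<Theta> \<Omega> \<and> (\<exists>T. is_mult_op \<Omega> H \<Theta> T)}"

definition mult_op :: "(complex ^ 'n) set \<Rightarrow> ('n::finite, 'h::chilbert_space) hmod \<Rightarrow>
    (complex ^ 'n \<Rightarrow> complex ^ 'p ^ 'q) \<Rightarrow> 'h ^ 'p \<Rightarrow> 'h ^ 'q"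
  where "mult_op \<Omega> H \<Theta> = (SOME T. is_mult_op \<Omega> H \<Theta> T)"

definition left_invertible_mult :: "(complex ^ 'n) set \<Rightarrow> ('n::finite, 'h::chilbert_space) hmod \<Rightarrow>
    (complex ^ 'n \<Rightarrow> complex ^ 'p ^ 'q) \<Rightarrow> bool"
  where "left_invertible_mult \<Omega> H \<Theta> \<longleftrightarrow>
    (\<exists>\<Psi>\<in>multipliers \<Omega> H. \<forall>w\<in>\<Omega>. \<Psi> w ** \<Theta> w = mat 1)"

definition canonical_model :: "(complex ^ 'n) set \<Rightarrow> ('n::finite, 'h::chilbert_space) hmod \<Rightarrow>
    (complex ^ 'n \<Rightarrow> complex ^ 'p ^ 'q) \<Rightarrow> ('n, 'h ^ 'q) hmod"
  where "canonical_model \<Omega> H \<Theta> =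
    quotient_mod (tensor_mod H) (mult_op \<Omega> H \<Theta> ` carrier (tensor_mod H))"

definition ker_fiber ::
    "(complex ^ 'n \<Rightarrow> complex ^ 'p ^ 'q) \<Rightarrow> complex ^ 'n \<Rightarrow> (complex ^ 'q) set"
  where "ker_fiber \<Theta> w = {\<eta>. mat_adjoint (\<Theta> w) *v \<eta> = 0}"


section \<open>Curvature of hermitian anti-holomorphic bundles\<close>

text \<open>A bundle is a family \<open>E\<close> of finite-dimensional subspaces of a Hilbert space, which
  also provides the metric; its anti-holomorphic structure is given by the frames that are
  anti-holomorphic as functions into that space.\<close>

definition antihol_frame :: "(complex ^ 'n::finite \<Rightarrow> 'h::chilbert_space set) \<Rightarrow> nat \<Rightarrow>
    (complex ^ 'n) set \<Rightarrow> (nat \<Rightarrow> complex ^ 'n \<Rightarrow> 'h) \<Rightarrow> bool"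
  where "antihol_frame E m U e \<longleftrightarrow> open U \<and>
    (\<forall>a<m. antiholomorphic_vec (e a) U) \<and>
    (\<forall>z\<in>U. inj_on (\<lambda>a. e a z) {..<m} \<and>
      \<not> cvec.dependent ((\<lambda>a. e a z) ` {..<m}) \<and>
      cvec.span ((\<lambda>a. e a z) ` {..<m}) = E z)"

definition partial_re :: "'n::finite \<Rightarrow> (complex ^ 'n \<Rightarrow> complex) \<Rightarrow> complex ^ 'n \<Rightarrow> complex"
  where "partial_re i f z = vector_derivative (\<lambda>t. f (z + t *\<^sub>R axis i 1)) (at 0)"

definition partial_im :: "'n::finite \<Rightarrow> (complex ^ 'n \<Rightarrow> complex) \<Rightarrow> complex ^ 'n \<Rightarrow> complex"
  where "partial_im i f z = vector_derivative (\<lambda>t. f (z + t *\<^sub>R axis i \<i>)) (at 0)"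

definition wirtinger :: "'n::finite \<Rightarrow> (complex ^ 'n \<Rightarrow> complex) \<Rightarrow> complex ^ 'n \<Rightarrow> complex"
  where "wirtinger i f z = (partial_re i f z - \<i> * partial_im i f z) / 2"

definition wirtinger_bar :: "'n::finite \<Rightarrow> (complex ^ 'n \<Rightarrow> complex) \<Rightarrow> complex ^ 'n \<Rightarrow> complex"
  where "wirtinger_bar i f z = (partial_re i f z + \<i> * partial_im i f z) / 2"

text \<open>\<open>m \<times> m\<close> matrices are functions of two indices below \<open>m\<close>, because the rank of a
  bundle is a number and not a type.\<close>

definition mat_inv :: "nat \<Rightarrow> (nat \<Rightarrow> nat \<Rightarrow> complex) \<Rightarrow> nat \<Rightarrow> nat \<Rightarrow> complex"
  where "mat_inv m G =
    (SOME X. \<forall>a<m. \<forall>b<m. (\<Sum>c<m. X a c * G c b) = (if a = b then 1 else 0))"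

definition gramian ::
    "(nat \<Rightarrow> complex ^ 'n \<Rightarrow> 'h::chilbert_space) \<Rightarrow> complex ^ 'n \<Rightarrow> nat \<Rightarrow> nat \<Rightarrow> complex"
  where "gramian e z a b = cinner (e a z) (e b z)"

text \<open>The \<open>(a, b)\<close> entry of the coefficient of \<open>d\<bar>z\<^sub>j \<and> dz\<^sub>i\<close> in \<open>\<partial>\<bar>[G\<^sup>-\<^sup>1 \<partial>G]\<close>.\<close>

definition curvature_matrix :: "nat \<Rightarrow> (nat \<Rightarrow> complex ^ 'n::finite \<Rightarrow> 'h::chilbert_space) \<Rightarrow>
    complex ^ 'n \<Rightarrow> 'n \<Rightarrow> 'n \<Rightarrow> nat \<Rightarrow> nat \<Rightarrow> complex"
  where "curvature_matrix m e w i j a b =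
    wirtinger_bar j
      (\<lambda>z. \<Sum>c<m. mat_inv m (gramian e z) a c * wirtinger i (\<lambda>u. gramian e u c b) z) w"

text \<open>The \<open>(i, j)\<close> coefficient of the curvature of \<open>E\<close> as an endomorphism of the fibre
  \<open>E w\<close>. If \<open>A\<close> is an anti-holomorphic change of frame, \<open>e' b = (\<Sum>a. A a b e a)\<close>, then
  \<open>G' = A\<^sup>T G cnj A\<close> and the curvature matrix \<open>K\<close> becomes \<open>(cnj A)\<^sup>-\<^sup>1 K (cnj A)\<close>. So
  \<open>K\<close> acts on coordinates in the conjugate (holomorphic) bundle, that is, on the \<open>c\<close> with
  \<open>x = (\<Sum>b. cnj (c b) e b)\<close>. The resulting map is complex linear on \<open>E w\<close> and does not
  depend on the frame.\<close>

definition curvature :: "(complex ^ 'n::finite \<Rightarrow> 'h::chilbert_space set) \<Rightarrow> complex ^ 'n \<Rightarrow>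
    'n \<Rightarrow> 'n \<Rightarrow> 'h \<Rightarrow> 'h"
  where "curvature E w i j x = (THE y. \<exists>m U e c. w \<in> U \<and> antihol_frame E m U e \<and>
    x = (\<Sum>b<m. cnj (c b) *\<^sub>C e b w) \<and>
    y = (\<Sum>a<m. cnj (\<Sum>b<m. curvature_matrix m e w i j a b * c b) *\<^sub>C e a w))"

end

theory Submission
  imports Defs "HOL-Complex_Analysis.Cauchy_Integral_Formula"
begin

text \<open>Let \<open>P\<close> be the orthogonal projection onto the fibre \<open>E w\<close> of an anti-holomorphic subbundle \<open>E\<close> of
  a trivial bundle, and let \<open>B\<^sub>i x = (1 - P) \<partial>\<bar>\<^sub>i s\<close> for any section \<open>s\<close> with \<open>s w = x\<close> (second
  fundamental form). Differentiating \<open>G X = \<partial>G\<close>, where \<open>X = G\<^sup>-\<^sup>1 \<partial>G\<close>, shows that the curvature is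
  \<open>B\<^sub>j\<^sup>* B\<^sub>i\<close>, which in particular does not depend on the frame. The fibre of the canonical model is
  \<open>E\<^sub>H\<^sup>*(w) \<otimes> ker \<Theta>(w)\<^sup>*\<close>, and for a tensor product
  \<open>B\<^sub>i (k \<otimes> \<eta>) = B\<^sub>i k \<otimes> \<eta> + k \<otimes> B\<^sub>i \<eta>\<close> with vanishing mixed inner products, so the curvatures add.
  Local frames exist: for \<open>V\<^sub>\<Theta>\<^sup>*\<close> because \<open>1 - \<Psi>\<^sup>* \<Theta>\<^sup>*\<close> is an anti-holomorphic family of projections
  onto it, and for \<open>E\<^sub>H\<^sup>*\<close> because closed range bounds the column operator of \<open>(M - w)\<^sup>*\<close>
  from below off its one-dimensional kernel.\<close>

section \<open>Orthogonal projections and adjoints\<close>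

text \<open>\<open>curvature\<close> is a \<open>THE\<close> over frames of every rank, so it says
  nothing until one value common to all frames is exhibited. The obstacle is that its matrix
  contains \<open>mat_inv\<close>, a pointwise \<open>SOME\<close> with no formula to differentiate,
  and second derivatives of the frame, while \<open>antiholomorphic_vec\<close> grants only one
  derivative at each point. The former is met by showing that a pointwise given inverse of a
  differentiable matrix is differentiable, the latter by Cauchy estimates along complex lines, where
  pairing with a vector turns an anti-holomorphic map into a holomorphic function of one variable.
  Afterwards the curvature is determined by inner products of first derivatives of sections, and the
  matrices disappear. The projection onto the kernel of the adjoint of \<Theta>(w) is oblique on
  purpose: the orthogonal one does not vary anti-holomorphically in general. For the fibres of
  \<open>H\<close>, normalisation against a fixed vector plays the same part.\<close>

instance chilbert_space \<subseteq> banach ..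

lemma cinner_zero_left [simp]: "cinner 0 y = 0"
  using cinner_add_left[of 0 0 y] by simp

lemma cinner_zero_right [simp]: "cinner y 0 = 0"
  using cinner_commute[of y 0] by simp

lemma cinner_minus_left: "cinner (- x) y = - cinner x y"
  using cinner_add_left[of x "- x" y] by (simp add: add_eq_0_iff)

lemma cinner_minus_right: "cinner x (- y) = - cinner x y"
  by (metis cinner_commute cinner_minus_left complex_cnj_minus)

lemma cinner_diff_left: "cinner (x - y) z = cinner x z - cinner y z"
  using cinner_add_left[of x "- y" z] by (simp add: cinner_minus_left)

lemma cinner_add_right: "cinner x (y + z) = cinner x y + cinner x z"
  by (metis cinner_add_left cinner_commute complex_cnj_add)

lemma cinner_diff_right: "cinner x (y - z) = cinner x y - cinner x z"
  by (metis cinner_diff_left cinner_commute complex_cnj_diff)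

lemma cinner_scaleC_right: "cinner x (c *\<^sub>C y) = cnj c * cinner x y"
  by (metis cinner_scaleC_left cinner_commute complex_cnj_mult)

lemma cinner_sum_left: "cinner (\<Sum>i\<in>I. f i) y = (\<Sum>i\<in>I. cinner (f i) y)"
  by (induction I rule: infinite_finite_induct) (auto simp: cinner_add_left)

lemma cinner_sum_right: "cinner y (\<Sum>i\<in>I. f i) = (\<Sum>i\<in>I. cinner y (f i))"
  by (induction I rule: infinite_finite_induct) (auto simp: cinner_add_right)

lemma cinner_eq_zero_commute: "cinner x y = 0 \<longleftrightarrow> cinner y x = 0"
  by (metis cinner_commute complex_cnj_zero)

lemma cinner_self: "cinner x x = of_real ((norm x)\<^sup>2)"
proof -
  have "Im (cinner x x) = 0"
    using arg_cong[OF cinner_commute[of x x], of Im] by simp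
  then show ?thesis
    by (simp add: complex_eq_iff power2_norm_eq_inner inner_eq_Re_cinner)
qed

lemma cinner_self_eq_0_iff [simp]: "cinner x x = 0 \<longleftrightarrow> x = 0"
  by (simp add: cinner_self)

lemma norm_scaleC: "norm (c *\<^sub>C x) = cmod c * norm x"
proof -
  have "cinner (c *\<^sub>C x) (c *\<^sub>C x) = (c * cnj c) * cinner x x"
    by (simp add: cinner_scaleC_left cinner_scaleC_right)
  also have "\<dots> = of_real ((cmod c * norm x)\<^sup>2)"
    by (simp only: cinner_self complex_norm_square[symmetric] of_real_mult[symmetric]
        power_mult_distrib)
  finally have "(norm (c *\<^sub>C x))\<^sup>2 = (cmod c * norm x)\<^sup>2"
    by (metis cinner_self of_real_eq_iff)
  then show ?thesis
    by (simp add: power2_eq_iff_nonneg)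
qed

text \<open>Multiplying \<open>x\<close> by the conjugate of \<open>cinner x y\<close> makes the
  inner product real and equal to its squared modulus, so the real Cauchy-Schwarz inequality
  applies.\<close>

lemma norm_cinner_le: "cmod (cinner x y) \<le> norm x * norm y"
proof (cases "cinner x y = 0")
  case False
  define z where "z = cinner x y"
  have "(cmod z)\<^sup>2 = (cnj z *\<^sub>C x) \<bullet> y"
    by (simp add: inner_eq_Re_cinner cinner_scaleC_left z_def[symmetric] cmod_power2)
      (simp add: power2_eq_square)
  also have "\<dots> \<le> norm (cnj z *\<^sub>C x) * norm y"
    by (rule norm_cauchy_schwarz)
  finally have "cmod z * cmod z \<le> cmod z * (norm x * norm y)"
    by (simp add: norm_scaleC power2_eq_square mult.assoc)
  then show ?thesis
    using False by (simp add: z_def)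
qed simp

lemma scaleC_scaleR_left: "(r *\<^sub>R c) *\<^sub>C x = r *\<^sub>R (c *\<^sub>C x)"
  by (metis scaleC_of_real scaleC_scaleC scaleR_conv_of_real)

lemma scaleC_scaleR_right: "c *\<^sub>C (r *\<^sub>R x) = r *\<^sub>R (c *\<^sub>C x)"
  by (simp only: scaleC_of_real[symmetric] scaleC_scaleC mult.commute)

lemma bounded_bilinear_scaleC: "bounded_bilinear (\<lambda>c x :: 'a::complex_inner. c *\<^sub>C x)"
  by standard
    (auto simp: scaleC_left_distrib scaleC_right_distrib scaleC_scaleR_left scaleC_scaleR_right
      norm_scaleC intro!: exI[of _ 1])

lemma bounded_bilinear_cinner:
  "bounded_bilinear (cinner :: 'a::complex_inner \<Rightarrow> 'a \<Rightarrow> complex)"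
proof
  show "\<exists>K. \<forall>a b :: 'a. cmod (cinner a b) \<le> norm a * norm b * K"
    by (intro exI[of _ 1]) (simp add: norm_cinner_le)
qed (simp_all add: cinner_add_left cinner_add_right cinner_scaleC_left cinner_scaleC_right
      scaleR_conv_of_real flip: scaleC_of_real)

lemmas has_derivative_scaleC [derivative_intros] = bounded_bilinear.FDERIV[OF bounded_bilinear_scaleC]
lemmas has_derivative_cinner [derivative_intros] = bounded_bilinear.FDERIV[OF bounded_bilinear_cinner]
lemmas tendsto_scaleC [tendsto_intros] = bounded_bilinear.tendsto[OF bounded_bilinear_scaleC]
lemmas continuous_on_cinner [continuous_intros] = bounded_bilinear.continuous_on[OF bounded_bilinear_cinner]

section \<open>Projection theorem, Riesz representation and adjoints on closed subspaces\<close>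

lemma subspace_orthogonalI:
  assumes V: "cvec.subspace V" and re: "\<And>z. z \<in> V \<Longrightarrow> Re (cinner x z) = 0" and z: "z \<in> V"
  shows "cinner x z = 0"
proof -
  \<comment> \<open>Minimising a real distance only yields vanishing real parts; testing with
    \<open>\<i> *\<^sub>C z\<close> supplies the imaginary part.\<close>
  have "Re (cinner x (\<i> *\<^sub>C z)) = 0"
    using re cvec.subspace_scale[OF V z] by blast
  then show ?thesis
    using re[OF z] by (simp add: cinner_scaleC_right complex_eq_iff)
qed

text \<open>A minimising sequence for the distance to \<open>V\<close> is Cauchy by the
  parallelogram law, and its limit lies in \<open>V\<close>; perturbing the limit along
  \<open>V\<close> gives orthogonality.\<close>

lemma orthogonal_projection_exists:
  fixes V :: "'h::chilbert_space set"
  assumes V: "cvec.subspace V" and cl: "closed V"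
  shows "\<exists>p\<in>V. \<forall>z\<in>V. cinner (x - p) z = 0"
proof -
  have ne: "V \<noteq> {}"
    using cvec.subspace_0[OF V] by auto
  define d where "d = infdist x V"
  have d_le: "d \<le> norm (x - y)" if "y \<in> V" for y
    using infdist_le[OF that, of x] by (simp add: d_def dist_norm)
  have d0: "0 \<le> d"
    by (simp add: d_def infdist_nonneg)
  have "\<exists>y\<in>V. norm (x - y) < d + inverse (real (Suc n))" for n
  proof -
    have "infdist x V < d + inverse (real (Suc n))"
      by (simp add: d_def)
    then show ?thesis
      using cInf_lessD[of "dist x ` V"] ne by (auto simp: infdist_def dist_norm)
  qed
  then obtain y where yV: "\<And>n. y n \<in> V"
    and y: "\<And>n. norm (x - y n) < d + inverse (real (Suc n))"
    by metis
  have scale: "r *\<^sub>R z \<in> V" if "z \<in> V" for r z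
    using cvec.subspace_scale[OF V that, of "of_real r"] by (simp add: scaleC_of_real)
  \<comment> \<open>The midpoint of \<open>y m\<close> and \<open>y n\<close> lies in
    \<open>V\<close>, hence at distance at least \<open>d\<close> from \<open>x\<close>. The
    parallelogram law then leaves \<open>4 * (d + e)\<^sup>2 - 4 * d\<^sup>2\<close>, which is at
    most \<open>(8 * d + 4) * e\<close> because \<open>e \<le> 1\<close>.\<close>
  have key: "(norm (y m - y n))\<^sup>2 \<le> (8 * d + 4) * inverse (real (Suc N))"
    if "N \<le> m" "N \<le> n" for m n N
  proof -
    define e where "e = inverse (real (Suc N))"
    have e: "0 < e" "e \<le> 1"
      by (auto simp: e_def field_simps)
    have "norm (x - y k) \<le> d + e" if "N \<le> k" for k
    proof -
      have "inverse (real (Suc k)) \<le> e"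
        using that by (auto simp: e_def field_simps)
      then show ?thesis
        using y[of k] by simp
    qed
    then have b: "(norm (x - y k))\<^sup>2 \<le> (d + e)\<^sup>2" if "N \<le> k" for k
      using that by (intro power_mono) auto
    have "(1/2) *\<^sub>R (y m + y n) \<in> V"
      by (intro scale cvec.subspace_add V yV)
    from d_le[OF this] have "2 * d \<le> 2 * norm (x - (1/2) *\<^sub>R (y m + y n))"
      by simp
    also have "\<dots> = norm (2 *\<^sub>R (x - (1/2) *\<^sub>R (y m + y n)))"
      by simp
    also have "2 *\<^sub>R (x - (1/2) *\<^sub>R (y m + y n)) = (x - y m) + (x - y n)"
      by (simp add: algebra_simps scaleR_2)
    finally have "(2 * d)\<^sup>2 \<le> (norm ((x - y m) + (x - y n)))\<^sup>2"
      using d0 by (intro power_mono) auto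
    moreover have "(norm ((x - y m) + (x - y n)))\<^sup>2 + (norm (y m - y n))\<^sup>2
        = 2 * (norm (x - y m))\<^sup>2 + 2 * (norm (x - y n))\<^sup>2"
      by (simp add: power2_norm_eq_inner algebra_simps inner_commute)
    ultimately have "(norm (y m - y n))\<^sup>2 \<le> 4 * (d + e)\<^sup>2 - (2 * d)\<^sup>2"
      using b[of m] b[of n] that by linarith
    also have "\<dots> = (8 * d + 4 * e) * e"
      by (simp add: power2_eq_square algebra_simps)
    also have "\<dots> \<le> (8 * d + 4) * e"
      using e by (intro mult_right_mono) auto
    finally show ?thesis
      by (simp add: e_def)
  qed
  have "Cauchy y"
  proof (rule metric_CauchyI)
    fix r :: real assume r: "0 < r"
    have "0 < r\<^sup>2 / (8 * d + 4)"
      using r d0 by (simp add: add_nonneg_pos)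
    then obtain N where N: "inverse (real (Suc N)) < r\<^sup>2 / (8 * d + 4)"
      using reals_Archimedean by blast
    have "dist (y m) (y n) < r" if "N \<le> m" "N \<le> n" for m n
    proof -
      have "(8 * d + 4) * inverse (real (Suc N)) < r\<^sup>2"
        using N d0 by (simp add: pos_less_divide_eq mult.commute)
      then have "(norm (y m - y n))\<^sup>2 < r\<^sup>2"
        using key[OF that] by linarith
      then show ?thesis
        using r by (simp add: dist_norm power_less_imp_less_base)
    qed
    then show "\<exists>M. \<forall>m\<ge>M. \<forall>n\<ge>M. dist (y m) (y n) < r"
      by blast
  qed
  then obtain p where p: "y \<longlonglongrightarrow> p"
    using Cauchy_convergent convergent_def by blast
  have pV: "p \<in> V"
    using closed_sequentially[OF cl] yV p by blast
  have le: "norm (x - p) \<le> d"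
  proof (rule LIMSEQ_le)
    show "(\<lambda>n. norm (x - y n)) \<longlonglongrightarrow> norm (x - p)"
      by (intro tendsto_intros p)
    show "(\<lambda>n. d + inverse (real (Suc n))) \<longlonglongrightarrow> d"
      using tendsto_add[OF tendsto_const LIMSEQ_inverse_real_of_nat, of d] by simp
    show "\<exists>N. \<forall>n\<ge>N. norm (x - y n) \<le> d + inverse (real (Suc n))"
      using y less_imp_le by blast
  qed
  have "(x - p) \<bullet> z = 0" if z: "z \<in> V" for z
  proof (cases "z = 0")
    case False
    \<comment> \<open>The parameter at which the norm of \<open>x - p - t *\<^sub>R z\<close> is
      least; minimality of \<open>p\<close> leaves no room for a gain.\<close>
    define t where "t = ((x - p) \<bullet> z) / (z \<bullet> z)"
    have "norm (x - p) \<le> norm (x - (p + t *\<^sub>R z))"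
      using d_le[of "p + t *\<^sub>R z"] le scale[OF z] cvec.subspace_add[OF V pV] by fastforce
    then have "(norm (x - p))\<^sup>2 \<le> (norm ((x - p) - t *\<^sub>R z))\<^sup>2"
      by (intro power_mono) (auto simp: algebra_simps)
    also have "\<dots> = (norm (x - p))\<^sup>2 - 2 * t * ((x - p) \<bullet> z) + t * t * (z \<bullet> z)"
      by (simp add: power2_norm_eq_inner algebra_simps inner_commute)
    also have "\<dots> = (norm (x - p))\<^sup>2 - ((x - p) \<bullet> z)\<^sup>2 / (z \<bullet> z)"
      using False by (simp add: t_def field_simps power2_eq_square)
    finally have "((x - p) \<bullet> z)\<^sup>2 / (z \<bullet> z) \<le> 0"
      by simp
    then show ?thesis
      using False inner_gt_zero_iff[of z]
      by (auto simp: divide_le_0_iff power2_less_eq_zero_iff simp del: inner_gt_zero_iff)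
  qed simp
  then show ?thesis
    using pV subspace_orthogonalI[OF V] inner_eq_Re_cinner by metis
qed

lemma orthogonal_projection_unique:
  assumes V: "cvec.subspace V" and "p \<in> V" "q \<in> V"
    and "\<And>z. z \<in> V \<Longrightarrow> cinner (x - p) z = 0" "\<And>z. z \<in> V \<Longrightarrow> cinner (x - q) z = 0"
  shows "p = q"
proof -
  have "p - q \<in> V"
    using assms cvec.subspace_diff by blast
  then have "cinner (x - q) (p - q) - cinner (x - p) (p - q) = 0"
    using assms by simp
  moreover have "cinner (x - q) (p - q) - cinner (x - p) (p - q) = cinner (p - q) (p - q)"
    by (simp add: cinner_diff_left)
  ultimately show ?thesis
    by simp
qed

lemma ortho_proj:
  fixes V :: "'h::chilbert_space set"
  assumes V: "cvec.subspace V" and cl: "closed V"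
  shows "ortho_proj V x \<in> V" "z \<in> V \<Longrightarrow> cinner (x - ortho_proj V x) z = 0"
proof -
  have "\<exists>!y. y \<in> V \<and> (\<forall>z\<in>V. cinner (x - y) z = 0)"
    using orthogonal_projection_exists[OF assms, of x] orthogonal_projection_unique[OF V]
    by blast
  from theI'[OF this] show "ortho_proj V x \<in> V" "z \<in> V \<Longrightarrow> cinner (x - ortho_proj V x) z = 0"
    unfolding ortho_proj_def by auto
qed

lemma subspace_orthogonal: "cvec.subspace {h. \<forall>s\<in>S. cinner h s = 0}"
  by (auto simp: cvec.subspace_def cinner_add_left cinner_scaleC_left)

lemma closed_orthogonal: "closed {h. \<forall>s\<in>S. cinner h s = 0}"
proof -
  have "closed (\<Inter>s\<in>S. {h. cinner h s = 0})"
    by (intro closed_INT ballI closed_Collect_eq continuous_intros)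
  then show ?thesis
    by (simp add: INTER_eq)
qed

text \<open>Let \<open>u\<close> be the component orthogonal to the kernel of a vector on which
  \<open>f\<close> does not vanish. Every \<open>x\<close> differs from
  \<open>(f x / f u) *\<^sub>C u\<close> by an element of the kernel, so pairing with
  \<open>u\<close> recovers \<open>f\<close>.\<close>

lemma riesz_exists:
  fixes V :: "'h::chilbert_space set" and f :: "'h \<Rightarrow> complex"
  assumes V: "cvec.subspace V" and cl: "closed V"
    and add: "\<And>x y. x \<in> V \<Longrightarrow> y \<in> V \<Longrightarrow> f (x + y) = f x + f y"
    and scale: "\<And>c x. x \<in> V \<Longrightarrow> f (c *\<^sub>C x) = c * f x"
    and bd: "\<And>x. x \<in> V \<Longrightarrow> cmod (f x) \<le> B * norm x"
  shows "\<exists>z\<in>V. \<forall>x\<in>V. f x = cinner x z"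
proof (cases "\<forall>x\<in>V. f x = 0")
  case True
  then show ?thesis
    using cvec.subspace_0[OF V] by (intro bexI[of _ 0]) auto
next
  case False
  define K where "K = {x\<in>V. f x = 0}"
  have f0: "f 0 = 0"
    using scale[of 0 0] cvec.subspace_0[OF V] by simp
  have diff: "f (x - y) = f x - f y" if "x \<in> V" "y \<in> V" for x y
    using add[of x "(-1) *\<^sub>C y"] scale[of y "-1"] that cvec.subspace_neg[OF V] by simp
  have K: "cvec.subspace K"
    using cvec.subspace_0[OF V] cvec.subspace_add[OF V] cvec.subspace_scale[OF V]
    by (auto simp: K_def cvec.subspace_def f0 add scale)
  have clK: "closed K"
    unfolding closed_sequential_limits
  proof (intro allI impI, elim conjE)
    fix x l assume x: "\<forall>n. x n \<in> K" and l: "x \<longlonglongrightarrow> l"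
    have lV: "l \<in> V"
      using closed_sequentially[OF cl _ l] x by (auto simp: K_def)
    have "(\<lambda>n. B * norm (l - x n)) \<longlonglongrightarrow> B * norm (l - l)"
      by (intro tendsto_intros l)
    moreover have "cmod (f l) \<le> B * norm (l - x n)" for n
      using bd[of "l - x n"] diff[of l "x n"] lV x cvec.subspace_diff[OF V]
      by (auto simp: K_def)
    ultimately have "cmod (f l) \<le> B * norm (l - l)"
      by (meson LIMSEQ_le_const)
    then show "l \<in> K"
      using lV by (simp add: K_def)
  qed
  obtain v where v: "v \<in> V" "f v \<noteq> 0"
    using False by blast
  obtain p where p: "p \<in> K" "\<And>z. z \<in> K \<Longrightarrow> cinner (v - p) z = 0"
    using orthogonal_projection_exists[OF K clK, of v] by blast
  define u where "u = v - p"
  have uV: "u \<in> V"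
    using v p cvec.subspace_diff[OF V] by (auto simp: u_def K_def)
  have fu: "f u = f v"
    using v p by (auto simp: u_def K_def diff)
  have u0: "u \<noteq> 0"
    using fu v f0 by auto
  \<comment> \<open>The conjugate compensates for the conjugate linearity of \<open>cinner\<close>
    in its second argument.\<close>
  define z where "z = cnj (f u / cinner u u) *\<^sub>C u"
  have "f x = cinner x z" if x: "x \<in> V" for x
  proof -
    have c: "(f x / f u) *\<^sub>C u \<in> V"
      using uV cvec.subspace_scale[OF V] by blast
    have "x - (f x / f u) *\<^sub>C u \<in> K"
      using diff[OF x c] c x cvec.subspace_diff[OF V] scale[OF uV] fu v by (auto simp: K_def)
    then have "cinner (x - (f x / f u) *\<^sub>C u) u = 0"
      using p(2) cinner_eq_zero_commute unfolding u_def by blast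
    then have "cinner x u = f x / f u * cinner u u"
      by (simp add: cinner_diff_left cinner_scaleC_left)
    then show ?thesis
      using u0 fu v by (simp add: z_def cinner_scaleC_right)
  qed
  moreover have "z \<in> V"
    using uV cvec.subspace_scale[OF V] by (simp add: z_def)
  ultimately show ?thesis
    by blast
qed

text \<open>Riesz representation of \<open>x \<mapsto> cinner (T x) y\<close> on \<open>V\<close>
  shows that the description in \<open>adj_on\<close> has exactly one solution.\<close>

lemma adj_on_properties:
  fixes V :: "'h::chilbert_space set" and T :: "'h \<Rightarrow> 'k::chilbert_space"
  assumes V: "cvec.subspace V" and cl: "closed V" and T: "bounded_op_on V W T"
  shows "adj_on V T y \<in> V" "x \<in> V \<Longrightarrow> cinner (T x) y = cinner x (adj_on V T y)"
proof -
  obtain B where B: "\<And>x. x \<in> V \<Longrightarrow> norm (T x) \<le> B * norm x"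
    using T unfolding bounded_op_on_def by metis
  have "\<exists>z\<in>V. \<forall>x\<in>V. cinner (T x) y = cinner x z"
  proof (rule riesz_exists[OF V cl])
    show "cmod (cinner (T x) y) \<le> (B * norm y) * norm x" if "x \<in> V" for x
      using norm_cinner_le[of "T x" y] mult_right_mono[OF B[OF that] norm_ge_zero[of y]]
      by (simp add: mult_ac)
  qed (use T in \<open>auto simp: bounded_op_on_def cinner_add_left cinner_scaleC_left\<close>)
  moreover have "z = z'" if z: "z \<in> V" "\<forall>x\<in>V. cinner (T x) y = cinner x z"
      "z' \<in> V" "\<forall>x\<in>V. cinner (T x) y = cinner x z'" for z z'
  proof -
    have "z - z' \<in> V"
      using z cvec.subspace_diff[OF V] by blast
    then have "cinner (z - z') (z - z') = 0"
      using z by (metis cinner_diff_right eq_iff_diff_eq_0)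
    then show ?thesis
      by simp
  qed
  ultimately have "\<exists>!z. z \<in> V \<and> (\<forall>x\<in>V. cinner (T x) y = cinner x z)"
    by blast
  from theI'[OF this] show "adj_on V T y \<in> V" "x \<in> V \<Longrightarrow> cinner (T x) y = cinner x (adj_on V T y)"
    unfolding adj_on_def by auto
qed

lemma adj_on_eqI:
  fixes V :: "'h::chilbert_space set" and T :: "'h \<Rightarrow> 'k::chilbert_space"
  assumes V: "cvec.subspace V" and cl: "closed V" and T: "bounded_op_on V W T"
    and z: "z \<in> V" "\<And>x. x \<in> V \<Longrightarrow> cinner (T x) y = cinner x z"
  shows "adj_on V T y = z"
proof -
  have "adj_on V T y - z \<in> V"
    using adj_on_properties(1)[OF assms(1-3)] z cvec.subspace_diff[OF V] by blast
  then have "cinner (adj_on V T y - z) (adj_on V T y - z) = 0"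
    using adj_on_properties(2)[OF assms(1-3)] z by (metis cinner_diff_right eq_iff_diff_eq_0)
  then show ?thesis
    by simp
qed

section \<open>Operators with closed range\<close>

text \<open>The Baire half of the open mapping theorem. The closed range is completely metrizable
  and the union of the closures of the images of balls, so one of these has an interior point
  \<open>y0\<close>. For small \<open>y\<close>, both \<open>y0\<close> and \<open>y0 + y\<close>
  are approximated by images of bounded vectors, and so is their difference
  \<open>y\<close>.\<close>

lemma approximate_preimage:
  fixes T :: "'a::banach \<Rightarrow> 'b::banach"
  assumes V: "subspace V"
    and add: "\<And>x y. x \<in> V \<Longrightarrow> y \<in> V \<Longrightarrow> T (x + y) = T x + T y"
    and scale: "\<And>r x. x \<in> V \<Longrightarrow> T (r *\<^sub>R x) = r *\<^sub>R T x"
    and range: "closed (T ` V)"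
  shows "\<exists>K\<ge>0. \<forall>y\<in>T ` V. \<exists>x\<in>V. norm x \<le> K * norm y \<and> norm (T x - y) \<le> norm y / 2"
proof -
  define R where "R = T ` V"
  have T0: "T 0 = 0"
    using scale[of 0 0] subspace_0[OF V] by simp
  have diff: "T (x - y) = T x - T y" if "x \<in> V" "y \<in> V" for x y
    using add[of x "(-1) *\<^sub>R y"] scale[of y "-1"] that subspace_neg[OF V] by simp
  define A where "A n = closure (T ` (V \<inter> cball 0 (real n)))" for n
  have AR: "A n \<subseteq> R" for n
    unfolding A_def R_def by (intro closure_minimal range) auto
  have "R \<subseteq> (\<Union>n. A n)"
  proof
    fix y assume "y \<in> R"
    then obtain x where x: "x \<in> V" "y = T x"
      by (auto simp: R_def)
    obtain n where "norm x \<le> real n"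
      using real_arch_simple by blast
    then have "y \<in> A n"
      unfolding A_def using x by (intro subsetD[OF closure_subset]) auto
    then show "y \<in> (\<Union>n. A n)"
      by blast
  qed
  then have R_eq: "\<Union>(range A) = R"
    using AR by blast
  have "\<exists>n. top_of_set R interior_of (A n) \<noteq> {}"
  proof (rule ccontr)
    assume empty: "\<not> ?thesis"
    then have "top_of_set R interior_of \<Union>(range A) = {}"
    proof (intro Baire_category_alt disjI1)
      show "completely_metrizable_space (top_of_set R)"
        using range completely_metrizable_space_closedin[OF completely_metrizable_space_euclidean]
        by (simp add: R_def)
      show "closedin (top_of_set R) B \<and> top_of_set R interior_of B = {}"
        if "B \<in> range A" for B
        using that empty AR by (auto simp: A_def intro!: closed_subset)
    qed auto
    then have "R = {}"
      using interior_of_topspace[of "top_of_set R"] by (simp add: R_eq)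
    then show False
      using subspace_0[OF V] by (auto simp: R_def)
  qed
  then obtain n y0 where y0: "y0 \<in> top_of_set R interior_of (A n)"
    by blast
  then obtain U where U: "openin (top_of_set R) U" "y0 \<in> U" "U \<subseteq> A n"
    by (auto simp: interior_of_def)
  then obtain r where r: "0 < r" "ball y0 r \<inter> R \<subseteq> U"
    using openin_contains_ball by metis
  have y0R: "y0 \<in> R"
    using U openin_imp_subset by blast
  have near: "\<exists>x\<in>V. norm x \<le> 2 * n \<and> norm (T x - y) < e" if y: "y \<in> R" "norm y < r" and e: "0 < e" for y e
  proof -
    have "y0 + y \<in> R"
    proof -
      obtain a b where "a \<in> V" "b \<in> V" "y0 = T a" "y = T b"
        using y0R y by (auto simp: R_def)
      then have "y0 + y = T (a + b)" "a + b \<in> V"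
        using add subspace_add[OF V] by auto
      then show ?thesis
        by (auto simp: R_def)
    qed
    moreover have "y0 + y \<in> ball y0 r"
      using y by (simp add: dist_norm)
    ultimately have "y0 + y \<in> A n"
      using r(2) U(3) by auto
    moreover have "y0 \<in> A n"
      using U(2,3) by auto
    moreover have approx: "\<exists>x\<in>V. norm x \<le> n \<and> dist (T x) z < e / 2" if "z \<in> A n" for z
    proof -
      have "\<exists>w\<in>T ` (V \<inter> cball 0 (real n)). dist w z < e / 2"
        using that e half_gt_zero unfolding A_def closure_approachable by blast
      then obtain x where "x \<in> V \<inter> cball 0 (real n)" "dist (T x) z < e / 2"
        by (elim bexE imageE) simp
      then show ?thesis
        by (intro bexI[of _ x]) auto
    qed
    ultimately obtain x1 x2 where x: "x1 \<in> V" "x2 \<in> V" "norm x1 \<le> n" "norm x2 \<le> n"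
      "dist (T x1) (y0 + y) < e / 2" "dist (T x2) y0 < e / 2"
      using approx by meson
    have "T (x1 - x2) - y = (T x1 - (y0 + y)) - (T x2 - y0)"
      using x by (simp add: diff)
    then have "norm (T (x1 - x2) - y) \<le> norm (T x1 - (y0 + y)) + norm (T x2 - y0)"
      using norm_triangle_ineq4 by metis
    then have "norm (T (x1 - x2) - y) < e"
      using x by (simp add: dist_norm)
    moreover have "norm (x1 - x2) \<le> 2 * n"
      using x norm_triangle_ineq4[of x1 x2] by simp
    ultimately show ?thesis
      using x subspace_diff[OF V] by blast
  qed
  show ?thesis
  \<comment> \<open>Scaling \<open>y\<close> to norm \<open>r / 2\<close> gives an approximate
    preimage of norm at most \<open>2 * n\<close>; scaling back multiplies this by
    \<open>2 * norm y / r\<close>.\<close>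
  proof (intro exI[of _ "4 * real n / r"] conjI ballI)
    show "0 \<le> 4 * real n / r"
      using r by simp
    fix y assume "y \<in> T ` V"
    then have yR: "y \<in> R"
      by (simp add: R_def)
    show "\<exists>x\<in>V. norm x \<le> 4 * real n / r * norm y \<and> norm (T x - y) \<le> norm y / 2"
    proof (cases "y = 0")
      case True
      then show ?thesis
        using T0 subspace_0[OF V] by (intro bexI[of _ 0]) auto
    next
      case False
      define s where "s = r / (2 * norm y)"
      have s: "0 < s"
        using False r by (simp add: s_def)
      have "s *\<^sub>R y \<in> R"
        using yR scale subspace_scale[OF V] unfolding R_def by (metis image_iff)
      moreover have "norm (s *\<^sub>R y) < r"
        using False r by (simp add: s_def)
      moreover have "0 < s * norm y / 2"
        using False s by simp
      ultimately obtain x where x: "x \<in> V" "norm x \<le> 2 * n" "norm (T x - s *\<^sub>R y) < s * norm y / 2"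
        using near by blast
      define x' where "x' = inverse s *\<^sub>R x"
      have "T x' - y = inverse s *\<^sub>R (T x - s *\<^sub>R y)"
        using s x by (simp add: x'_def scale algebra_simps)
      then have "norm (T x' - y) = inverse s * norm (T x - s *\<^sub>R y)"
        using s by simp
      also have "\<dots> \<le> inverse s * (s * norm y / 2)"
        using x s by (intro mult_left_mono) auto
      also have "inverse s * (s * norm y / 2) = norm y / 2"
        using s by (simp add: field_simps)
      finally have "norm (T x' - y) \<le> norm y / 2" .
      moreover have "norm x' \<le> 4 * real n / r * norm y"
        using x s False r by (simp add: x'_def s_def field_simps)
      moreover have "x' \<in> V"
        using x subspace_scale[OF V] by (simp add: x'_def)
      ultimately show ?thesis
        by blast
    qed
  qed
qed

text \<open>Solving approximately for the current residual at least halves it, so the corrections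
  form a geometrically convergent series whose sum is an exact preimage. Summing
  \<open>K * (1/2)^n\<close> accounts for the constant \<open>2 * K\<close>; the bound
  \<open>B\<close> gives the continuity of \<open>T\<close> at the sum.\<close>

lemma closed_range_bounded_preimage:
  fixes T :: "'a::banach \<Rightarrow> 'b::banach"
  assumes V: "subspace V" "closed V"
    and add: "\<And>x y. x \<in> V \<Longrightarrow> y \<in> V \<Longrightarrow> T (x + y) = T x + T y"
    and scale: "\<And>r x. x \<in> V \<Longrightarrow> T (r *\<^sub>R x) = r *\<^sub>R T x"
    and bd: "\<And>x. x \<in> V \<Longrightarrow> norm (T x) \<le> B * norm x"
    and range: "closed (T ` V)"
  shows "\<exists>C\<ge>0. \<forall>y\<in>T ` V. \<exists>x\<in>V. T x = y \<and> norm x \<le> C * norm y"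
proof -
  have T0: "T 0 = 0"
    using scale[of 0 0] subspace_0[OF V(1)] by simp
  have diff: "T (x - y) = T x - T y" if "x \<in> V" "y \<in> V" for x y
    using add[of x "(-1) *\<^sub>R y"] scale[of y "-1"] that subspace_neg[OF V(1)] by simp
  obtain K where K: "0 \<le> K" and
    "\<forall>y\<in>T ` V. \<exists>x\<in>V. norm x \<le> K * norm y \<and> norm (T x - y) \<le> norm y / 2"
    using approximate_preimage[OF V(1) add scale range] by blast
  then obtain g where g: "\<And>y. y \<in> T ` V \<Longrightarrow> g y \<in> V"
    "\<And>y. y \<in> T ` V \<Longrightarrow> norm (g y) \<le> K * norm y"
    "\<And>y. y \<in> T ` V \<Longrightarrow> norm (T (g y) - y) \<le> norm y / 2"
    by metis
  show ?thesis
  proof (intro exI[of _ "2 * K"] conjI ballI)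
    show "0 \<le> 2 * K"
      using K by simp
    fix y assume y: "y \<in> T ` V"
    \<comment> \<open>\<open>r n\<close> is the residual after \<open>n\<close> corrections; the
      partial sums \<open>S n\<close> of the corrections satisfy
      \<open>T (S n) = y - r n\<close>.\<close>
    define r where "r n = ((\<lambda>z. z - T (g z)) ^^ n) y" for n
    define x where "x n = g (r n)" for n
    have r0: "r 0 = y" and rS: "r (Suc n) = r n - T (x n)" for n
      by (simp_all add: r_def x_def)
    have rV: "r n \<in> T ` V" for n
    proof (induction n)
      case (Suc n)
      then obtain u where "u \<in> V" "r n = T u"
        by blast
      then have "r (Suc n) = T (u - x n)" "u - x n \<in> V"
        using Suc g(1) diff subspace_diff[OF V(1)] by (auto simp: rS x_def)
      then show ?case
        by blast
    qed (simp add: y r0)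
    have xV: "x n \<in> V" for n
      using g(1)[OF rV] by (simp add: x_def)
    have rn: "norm (r n) \<le> norm y * (1/2) ^ n" for n
    proof (induction n)
      case (Suc n)
      then show ?case
        using g(3)[OF rV[of n]] by (simp add: rS x_def norm_minus_commute)
    qed (simp add: r0)
    have xn: "norm (x n) \<le> K * norm y * (1/2) ^ n" for n
      using g(2)[OF rV[of n]] mult_left_mono[OF rn[of n] K] by (simp add: x_def mult.assoc)
    have geo: "summable (\<lambda>n. K * norm y * (1/2) ^ n)"
      by (intro summable_mult summable_geometric) simp
    have sumn: "summable (\<lambda>n. norm (x n))"
      by (rule summable_comparison_test'[OF geo]) (use xn in auto)
    then have sm: "summable x"
      by (rule summable_norm_cancel)
    define S where "S n = (\<Sum>k<n. x k)" for n
    have SV: "S n \<in> V" for n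
      unfolding S_def by (intro subspace_sum[OF V(1)] xV)
    have lim: "S \<longlonglongrightarrow> suminf x"
      using summable_LIMSEQ[OF sm] by (simp add: S_def[abs_def])
    have sV: "suminf x \<in> V"
      using closed_sequentially[OF V(2) SV lim] by simp
    have TS: "T (S n) = y - r n" for n
    proof (induction n)
      case (Suc n)
      then show ?case
        using add[OF SV[of n] xV[of n]] by (simp add: S_def rS)
    qed (simp add: S_def T0 r0)
    have "(\<lambda>n. norm y * (1/2) ^ n) \<longlonglongrightarrow> norm y * 0"
      by (intro tendsto_intros LIMSEQ_power_zero) simp
    then have "r \<longlonglongrightarrow> 0"
      using rn by (intro Lim_null_comparison[of r "\<lambda>n. norm y * (1/2) ^ n"]) auto
    then have "(\<lambda>n. T (S n)) \<longlonglongrightarrow> y"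
      using tendsto_diff[OF tendsto_const, of r 0 sequentially y] by (simp add: TS)
    moreover have "(\<lambda>n. T (S n)) \<longlonglongrightarrow> T (suminf x)"
    proof -
      have "(\<lambda>n. B * norm (S n - suminf x)) \<longlonglongrightarrow> B * norm (suminf x - suminf x)"
        by (intro tendsto_intros lim)
      then have null: "(\<lambda>n. B * norm (S n - suminf x)) \<longlonglongrightarrow> 0"
        by simp
      have "norm (T (S n) - T (suminf x)) \<le> B * norm (S n - suminf x)" for n
        using bd[OF subspace_diff[OF V(1) SV sV]] unfolding diff[OF SV sV] .
      then have "(\<lambda>n. T (S n) - T (suminf x)) \<longlonglongrightarrow> 0"
        by (intro Lim_null_comparison[OF _ null] always_eventually allI)
      then show ?thesis
        by (simp add: LIM_zero_iff)
    qed
    ultimately have "T (suminf x) = y"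
      using LIMSEQ_unique by blast
    moreover have "norm (suminf x) \<le> (\<Sum>n. K * norm y * (1/2) ^ n)"
      using summable_norm[OF sumn] suminf_le[OF xn sumn geo] by linarith
    moreover have "(\<Sum>n. K * norm y * (1/2::real) ^ n) = 2 * K * norm y"
      using suminf_mult[OF summable_geometric[of "1/2::real"], of "K * norm y"]
        suminf_geometric[of "1/2::real"] by simp
    ultimately show "\<exists>x\<in>V. T x = y \<and> norm x \<le> 2 * K * norm y"
      using sV by auto
  qed
qed

section \<open>Derivatives of anti-holomorphic functions\<close>

abbreviation Dfr :: "('a::real_normed_vector \<Rightarrow> 'b::real_normed_vector) \<Rightarrow> 'a \<Rightarrow> 'a \<Rightarrow> 'b"
  where "Dfr f z \<equiv> frechet_derivative f (at z)"

lemma antiholomorphic_vecD: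
  assumes "antiholomorphic_vec f U" "z \<in> U"
  shows "(f has_derivative Dfr f z) (at z)" "Dfr f z (c *\<^sub>C v) = cnj c *\<^sub>C Dfr f z v"
proof -
  obtain D where "(f has_derivative D) (at z)" "\<forall>c v. D (c *\<^sub>C v) = cnj c *\<^sub>C D v"
    using assms unfolding antiholomorphic_vec_def by blast
  moreover from this have "D = Dfr f z"
    by (metis frechet_derivative_at)
  ultimately show "(f has_derivative Dfr f z) (at z)" "Dfr f z (c *\<^sub>C v) = cnj c *\<^sub>C Dfr f z v"
    by auto
qed

lemma antiholomorphic_vec_subset:
  "antiholomorphic_vec f U \<Longrightarrow> V \<subseteq> U \<Longrightarrow> antiholomorphic_vec f V"
  by (auto simp: antiholomorphic_vec_def)

text \<open>\<open>cinner\<close> is conjugate linear in its second argument, so composing it with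
  an anti-holomorphic map along a complex line gives a holomorphic function of \<open>t\<close>.
  This is the passage to one-variable complex analysis.\<close>

lemma antiholomorphic_line_derivative:
  assumes f: "antiholomorphic_vec f U" and z: "z + t *\<^sub>C v \<in> U"
  shows "((\<lambda>t. cinner u (f (z + t *\<^sub>C v))) has_field_derivative
    cinner u (Dfr f (z + t *\<^sub>C v) v)) (at t)"
proof -
  have "((\<lambda>t. z + t *\<^sub>C v) has_derivative (\<lambda>h. h *\<^sub>C v)) (at t)"
    by (auto intro!: derivative_eq_intros)
  from has_derivative_compose[OF this antiholomorphic_vecD(1)[OF f z]]
  have "((\<lambda>t. cinner u (f (z + t *\<^sub>C v))) has_derivative
      (\<lambda>h. cinner u (Dfr f (z + t *\<^sub>C v) (h *\<^sub>C v)))) (at t)"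
    by (auto intro!: derivative_eq_intros)
  then show ?thesis
    by (simp add: has_field_derivative_def antiholomorphic_vecD(2)[OF f z] cinner_scaleC_right
        mult.commute[of _ "cinner u _"])
qed

lemma norm_le_of_square_le: "norm u * norm u \<le> norm u * c \<Longrightarrow> 0 \<le> c \<Longrightarrow> norm u \<le> c"
  by (cases "norm u = 0") auto

text \<open>Cauchy's inequality on the disc of radius \<open>r / (2 * norm v)\<close> about
  \<open>t\<close>. Since \<open>norm t * norm v \<le> r / 4\<close>, the part of the line over that
  disc stays within distance \<open>3 / 4 * r\<close> of \<open>z\<close>.\<close>

lemma antiholomorphic_line_bounds:
  fixes f :: "'a::complex_inner \<Rightarrow> 'b::complex_inner" and u :: 'b
  assumes f: "antiholomorphic_vec f U" and sub: "ball z r \<subseteq> U" and r: "0 < r" and v: "v \<noteq> 0"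
    and M: "\<And>x. x \<in> ball z r \<Longrightarrow> norm (f x) \<le> M"
    and t: "norm t * norm v \<le> r / 4"
  defines "\<phi> \<equiv> \<lambda>t. cinner u (f (z + t *\<^sub>C v))"
  shows "cmod ((deriv ^^ n) \<phi> t) \<le> fact n * (norm u * M) / (r / (2 * norm v)) ^ n"
proof -
  define \<rho> where "\<rho> = r / (2 * norm v)"
  have in_ball: "z + s *\<^sub>C v \<in> ball z r" if "s \<in> cball t \<rho>" for s
  proof -
    have "norm s \<le> norm t + \<rho>"
      using that norm_triangle_ineq2[of s t] by (simp add: dist_norm norm_minus_commute)
    then have "norm s * norm v \<le> (norm t + \<rho>) * norm v"
      by (intro mult_right_mono) auto
    also have "\<dots> \<le> 3 / 4 * r"
      using t v by (simp add: \<rho>_def distrib_right)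
    finally show ?thesis
      using r by (simp add: dist_norm norm_scaleC)
  qed
  have der: "(\<phi> has_field_derivative cinner u (Dfr f (z + s *\<^sub>C v) v)) (at s)" if "s \<in> cball t \<rho>" for s
    using antiholomorphic_line_derivative[OF f] in_ball[OF that] sub unfolding \<phi>_def by blast
  then have hol: "\<phi> holomorphic_on cball t \<rho>"
    by (meson DERIV_subset field_differentiable_def field_differentiable_at_within
        holomorphic_on_def)
  have "cmod ((deriv ^^ n) \<phi> t) \<le> fact n * (norm u * M) / \<rho> ^ n"
  proof (rule Cauchy_inequality)
    show "\<phi> holomorphic_on ball t \<rho>"
      using hol holomorphic_on_subset ball_subset_cball by blast
    show "continuous_on (cball t \<rho>) \<phi>"
      using hol holomorphic_on_imp_continuous_on by blast
    show "0 < \<rho>"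
      using r v by (simp add: \<rho>_def)
    show "cmod (\<phi> x) \<le> norm u * M" if "cmod (t - x) = \<rho>" for x
    proof -
      have "cmod (\<phi> x) \<le> norm u * norm (f (z + x *\<^sub>C v))"
        by (simp add: \<phi>_def norm_cinner_le)
      also have "\<dots> \<le> norm u * M"
        using that by (intro mult_left_mono M in_ball) (auto simp: dist_norm)
      finally show ?thesis .
    qed
  qed
  then show ?thesis
    by (simp add: \<rho>_def)
qed

text \<open>The scalar bound is tested with \<open>u = Dfr f z v\<close> itself, which turns the
  left-hand side into \<open>(norm u)\<^sup>2\<close>; one factor \<open>norm u\<close>
  cancels.\<close>

lemma antiholomorphic_derivative_bound:
  fixes f :: "'a::complex_inner \<Rightarrow> 'b::complex_inner"
  assumes f: "antiholomorphic_vec f U" and sub: "ball z r \<subseteq> U" and r: "0 < r"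
    and M: "\<And>x. x \<in> ball z r \<Longrightarrow> norm (f x) \<le> M"
  shows "norm (Dfr f z v) \<le> 2 * M / r * norm v"
proof (cases "v = 0")
  case True
  have "z \<in> U"
    using sub r by auto
  then show ?thesis
    using True antiholomorphic_vecD(2)[OF f, of z 0 0] by simp
next
  case False
  have z: "z + 0 *\<^sub>C v \<in> U"
    using sub r by auto
  define u where "u = Dfr f z v"
  have "deriv (\<lambda>t. cinner u (f (z + t *\<^sub>C v))) 0 = cinner u u"
    using DERIV_imp_deriv[OF antiholomorphic_line_derivative[OF f z]] by (simp add: u_def)
  with antiholomorphic_line_bounds[OF f sub r False M, where n=1 and u=u and t=0]
  have "norm u * norm u \<le> norm u * (2 * M / r * norm v)"
    using False r by (simp add: cinner_self field_simps norm_mult power2_eq_square)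
  moreover have "0 \<le> M"
    using order_trans[OF norm_ge_zero M[of z]] r by simp
  ultimately show ?thesis
    using r unfolding u_def by (intro norm_le_of_square_le) auto
qed

text \<open>Scalar Taylor expansion on the unit disc of the pairing with the remainder
  \<open>u\<close> itself. The second derivative is at most
  \<open>2 * norm u * M * (2 * norm v / r)\<^sup>2\<close> there, whence the \<open>8\<close>; the
  remainder estimate used divides by \<open>fact 1\<close> only.\<close>

lemma antiholomorphic_taylor:
  fixes f :: "'a::complex_inner \<Rightarrow> 'b::complex_inner"
  assumes f: "antiholomorphic_vec f U" and sub: "ball z r \<subseteq> U" and r: "0 < r"
    and M: "\<And>x. x \<in> ball z r \<Longrightarrow> norm (f x) \<le> M" and v: "norm v \<le> r / 4"
  shows "norm (f (z + v) - f z - Dfr f z v) \<le> 8 * M / r\<^sup>2 * (norm v)\<^sup>2"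
proof (cases "v = 0")
  case True
  have "z \<in> U"
    using sub r by auto
  then show ?thesis
    using True antiholomorphic_vecD(2)[OF f, of z 0 0] by simp
next
  case False
  define u where "u = f (z + v) - f z - Dfr f z v"
  define \<phi> where "\<phi> t = cinner u (f (z + t *\<^sub>C v))" for t
  have in_ball: "z + s *\<^sub>C v \<in> ball z r" if "norm s < 2" for s
  proof -
    have "norm s * norm v \<le> 2 * (r / 4)"
      using that v by (intro mult_mono) auto
    then show ?thesis
      using r by (simp add: dist_norm norm_scaleC)
  qed
  have der: "(\<phi> has_field_derivative cinner u (Dfr f (z + s *\<^sub>C v) v)) (at s)" if "norm s < 2" for s
    using antiholomorphic_line_derivative[OF f] in_ball[OF that] sub unfolding \<phi>_def by blast
  then have hol: "\<phi> holomorphic_on ball 0 2"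
    by (meson field_differentiable_def field_differentiable_at_within holomorphic_on_def
        mem_ball_0)
  have "cmod ((deriv ^^ 0) \<phi> 1 - (\<Sum>i\<le>1. (deriv ^^ i) \<phi> 0 * (1 - 0) ^ i / fact i))
      \<le> (8 * M / r\<^sup>2 * (norm v)\<^sup>2 * norm u) * cmod (1 - 0) ^ Suc 1 / fact 1"
  proof (rule complex_Taylor)
    show "convex (cball (0::complex) 1)" "1 \<in> cball (0::complex) 1" "0 \<in> cball (0::complex) 1"
      by auto
    show "((deriv ^^ i) \<phi> has_field_derivative (deriv ^^ Suc i) \<phi> x) (at x within cball 0 1)"
      if "x \<in> cball 0 1" for i x
    proof -
      have "(deriv ^^ i) \<phi> holomorphic_on ball 0 2"
        using hol by (intro holomorphic_higher_deriv) auto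
      then have "((deriv ^^ i) \<phi> has_field_derivative deriv ((deriv ^^ i) \<phi>) x) (at x)"
        using that by (intro holomorphic_derivI) auto
      then show ?thesis
        by (auto intro: has_field_derivative_at_within)
    qed
    show "cmod ((deriv ^^ Suc 1) \<phi> x) \<le> 8 * M / r\<^sup>2 * (norm v)\<^sup>2 * norm u"
      if "x \<in> cball 0 1" for x
    proof -
      have "norm x * norm v \<le> 1 * (r / 4)"
        using that v by (intro mult_mono) auto
      with antiholomorphic_line_bounds[OF f sub r False M, where n=2 and u=u and t=x]
      show ?thesis
        using r False unfolding \<phi>_def
        by (simp add: field_simps power2_eq_square numeral_2_eq_2)
    qed
  qed
  moreover have "deriv \<phi> 0 = cinner u (Dfr f z v)"
    using DERIV_imp_deriv[OF der[of 0]] by simp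
  moreover have uu: "cinner u u = \<phi> 1 - \<phi> 0 - cinner u (Dfr f z v)"
    unfolding \<phi>_def cinner_diff_right[symmetric] by (simp add: u_def)
  ultimately have "cmod (cinner u u) \<le> 8 * M / r\<^sup>2 * (norm v)\<^sup>2 * norm u"
    by (simp add: uu algebra_simps)
  then have "norm u * norm u \<le> norm u * (8 * M / r\<^sup>2 * (norm v)\<^sup>2)"
    by (simp add: cinner_self norm_mult power2_eq_square mult_ac)
  moreover have "0 \<le> M"
    using order_trans[OF norm_ge_zero M[of z]] r by simp
  ultimately show ?thesis
    using r unfolding u_def by (intro norm_le_of_square_le) auto
qed

text \<open>By the Taylor bound the directional derivative is a uniform limit of the difference
  quotients \<open>F n\<close> near each point. These are anti-holomorphic, so the Cauchy estimate
  for \<open>F m - F n\<close> makes their derivatives converge uniformly too, and the limit may be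
  differentiated. This supplies the second derivatives that the curvature of a frame
  involves.\<close>

lemma antiholomorphic_derivative_antiholomorphic:
  fixes f :: "'a::complex_inner \<Rightarrow> 'b::chilbert_space"
  assumes f: "antiholomorphic_vec f U" and U: "open U"
  shows "antiholomorphic_vec (\<lambda>z. Dfr f z v) U"
  unfolding antiholomorphic_vec_def
proof
  fix z0 assume z0: "z0 \<in> U"
  \<comment> \<open>Balls of radius \<open>4 * r\<close>, \<open>2 * r\<close> and \<open>r\<close>
    are nested: \<open>f\<close> is bounded on the largest, the quotients are controlled on the
    middle one, and their derivatives converge on the smallest.\<close>
  obtain r M where r: "0 < r" and sub: "ball z0 (4 * r) \<subseteq> U"
    and M: "\<And>x. x \<in> ball z0 (4 * r) \<Longrightarrow> norm (f x) \<le> M"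
  proof -
    have "isCont f z0"
      using antiholomorphic_vecD(1)[OF f z0] has_derivative_continuous by blast
    then obtain d where d: "0 < d" "\<And>x. dist x z0 < d \<Longrightarrow> dist (f x) (f z0) < 1"
      unfolding continuous_at_eps_delta by (metis zero_less_one)
    obtain e where e: "0 < e" "ball z0 e \<subseteq> U"
      using U z0 openE by blast
    have "norm (f x) \<le> norm (f z0) + 1" if "x \<in> ball z0 (4 * (min d e / 4))" for x
      using d(2)[of x] that norm_triangle_ineq2[of "f x" "f z0"]
      by (simp add: dist_norm norm_minus_commute)
    moreover have "ball z0 (4 * (min d e / 4)) \<subseteq> U"
      using e by auto
    ultimately show ?thesis
      using that[of "min d e / 4"] d e by auto
  qed
  have M0: "0 \<le> M"
    using order_trans[OF norm_ge_zero M[of z0]] r by simp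
  \<comment> \<open>Shifting the sequence by \<open>N\<close> keeps \<open>a n * norm v\<close> at
    most \<open>r / 2\<close>, a quarter of the radius \<open>2 * r\<close> with which the Taylor
    bound is applied.\<close>
  obtain N :: nat where N: "2 * norm v / r \<le> real N"
    using real_arch_simple by blast
  define a where "a n = 1 / real (Suc (n + N))" for n
  have a0: "0 < a n" for n
    by (simp add: a_def)
  have av: "a n * norm v \<le> r / 2" for n
  proof -
    have "2 * norm v \<le> r * real N"
      using N r by (simp add: field_simps)
    also have "\<dots> \<le> r * real (Suc (n + N))"
      using r by (intro mult_left_mono) auto
    finally have "2 * norm v \<le> r * real (Suc (n + N))" .
    then show ?thesis
      by (simp add: a_def field_simps)
  qed
  have alim: "a \<longlonglongrightarrow> 0"
    using LIMSEQ_ignore_initial_segment[OF LIMSEQ_inverse_real_of_nat, of N]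
    by (simp add: a_def[abs_def] inverse_eq_divide)
  define F where "F n z = inverse (a n) *\<^sub>R (f (z + a n *\<^sub>R v) - f z)" for n z
  define F' where "F' n z h = inverse (a n) *\<^sub>R (Dfr f (z + a n *\<^sub>R v) h - Dfr f z h)" for n z h
  define C where "C = 8 * M / (2 * r)\<^sup>2 * (norm v)\<^sup>2"
  have C0: "0 \<le> C"
    using M0 by (simp add: C_def)
  have shift: "z + a n *\<^sub>R v \<in> ball z0 (4 * r)" if "z \<in> ball z0 (2 * r)" for n z
  proof -
    have "norm (z + a n *\<^sub>R v - z0) \<le> norm (z - z0) + norm (a n *\<^sub>R v)"
      using norm_triangle_ineq[of "z - z0" "a n *\<^sub>R v"] by (simp add: algebra_simps)
    also have "\<dots> < 2 * r + r"
      using that av[of n] a0[of n] r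
      by (intro add_less_le_mono) (auto simp: dist_norm norm_minus_commute)
    finally show ?thesis
      using r by (simp add: dist_norm norm_minus_commute)
  qed
  have close: "norm (F n z - Dfr f z v) \<le> C * a n" if z: "z \<in> ball z0 (2 * r)" for n z
  proof -
    have sub2: "ball z (2 * r) \<subseteq> ball z0 (4 * r)"
      using z by (auto simp: dist_norm) (smt (verit) dist_norm dist_triangle norm_minus_commute)
    have zU: "z \<in> U"
      using z r sub by auto
    have "norm (f (z + a n *\<^sub>R v) - f z - Dfr f z (a n *\<^sub>R v)) \<le> 8 * M / (2 * r)\<^sup>2 * (norm (a n *\<^sub>R v))\<^sup>2"
      using sub sub2 M av[of n] a0[of n] r
      by (intro antiholomorphic_taylor[OF f]) auto
    also have "\<dots> = C * (a n)\<^sup>2"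
      by (simp add: C_def power_mult_distrib)
    finally have *: "norm (f (z + a n *\<^sub>R v) - f z - a n *\<^sub>R Dfr f z v) \<le> C * (a n)\<^sup>2"
      using linear_cmul[OF has_derivative_linear[OF antiholomorphic_vecD(1)[OF f zU]]] by simp
    have "F n z - Dfr f z v = inverse (a n) *\<^sub>R (f (z + a n *\<^sub>R v) - f z - a n *\<^sub>R Dfr f z v)"
      using a0[of n] by (simp add: F_def algebra_simps)
    then have "norm (F n z - Dfr f z v) \<le> inverse (a n) * (C * (a n)\<^sup>2)"
      using * a0[of n] by (simp add: mult_left_mono)
    also have "\<dots> = C * a n"
      using a0[of n] by (simp add: power2_eq_square)
    finally show ?thesis .
  qed
  have F': "(F n has_derivative F' n z) (at z)" if z: "z \<in> ball z0 (2 * r)" for n z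
  proof -
    have zU: "z \<in> U" "z + a n *\<^sub>R v \<in> U"
      using z r sub shift[OF z] by auto
    have "((\<lambda>z. z + a n *\<^sub>R v) has_derivative (\<lambda>h. h)) (at z)"
      by (auto intro!: derivative_eq_intros)
    from has_derivative_compose[OF this antiholomorphic_vecD(1)[OF f zU(2)]]
    show ?thesis
      unfolding F_def F'_def
      by (auto intro!: derivative_eq_intros antiholomorphic_vecD(1)[OF f zU(1)])
  qed
  have F'_cnj: "F' n z (c *\<^sub>C h) = cnj c *\<^sub>C F' n z h" if z: "z \<in> ball z0 (2 * r)" for n z c h
  proof -
    have zU: "z \<in> U" "z + a n *\<^sub>R v \<in> U"
      using z r sub shift[OF z] by auto
    show ?thesis
      by (simp add: F'_def antiholomorphic_vecD(2)[OF f zU(1)] antiholomorphic_vecD(2)[OF f zU(2)]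
          scaleC_scaleR_right cvec.scale_right_diff_distrib)
  qed
  have cauchy: "norm (F' m z h - F' n z h) \<le> 2 * C / r * (a m + a n) * norm h"
    if z: "z \<in> ball z0 r" for m n z h
  proof -
    have sub1: "ball z r \<subseteq> ball z0 (2 * r)"
      using z by (auto simp: dist_norm) (smt (verit) dist_norm dist_triangle norm_minus_commute)
    have zz: "z \<in> ball z0 (2 * r)"
      using z r by auto
    have der: "((\<lambda>z. F m z - F n z) has_derivative (\<lambda>h. F' m z h - F' n z h)) (at z)"
      if "z \<in> ball z0 (2 * r)" for z
      using F'[OF that] by (auto intro!: derivative_eq_intros)
    have "antiholomorphic_vec (\<lambda>z. F m z - F n z) (ball z0 (2 * r))"
      unfolding antiholomorphic_vec_def
    proof (intro ballI exI conjI allI)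
      show "((\<lambda>z. F m z - F n z) has_derivative (\<lambda>h. F' m z h - F' n z h)) (at z)"
        if "z \<in> ball z0 (2 * r)" for z
        by (rule der[OF that])
      show "F' m z (c *\<^sub>C h) - F' n z (c *\<^sub>C h) = cnj c *\<^sub>C (F' m z h - F' n z h)"
        if "z \<in> ball z0 (2 * r)" for z c h
        by (simp only: F'_cnj[OF that] cvec.scale_right_diff_distrib)
    qed
    moreover have "norm (F m x - F n x) \<le> C * (a m + a n)" if "x \<in> ball z r" for x
    proof -
      have "norm (F m x - F n x) \<le> norm (F m x - Dfr f x v) + norm (F n x - Dfr f x v)"
        using norm_triangle_ineq4[of "F m x - Dfr f x v" "F n x - Dfr f x v"] by simp
      moreover have "x \<in> ball z0 (2 * r)"
        using that sub1 by blast
      ultimately show ?thesis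
        using close[of x m] close[of x n] unfolding distrib_left by linarith
    qed
    ultimately have "norm (Dfr (\<lambda>z. F m z - F n z) z h) \<le> 2 * (C * (a m + a n)) / r * norm h"
      using sub1 r by (intro antiholomorphic_derivative_bound)
    then show ?thesis
      using frechet_derivative_at[OF der[OF zz]] by (simp add: fun_eq_iff mult_ac)
  qed
  define g' where "g' z h = lim (\<lambda>n. F' n z h)" for z h
  have g': "(\<lambda>n. F' n z h) \<longlonglongrightarrow> g' z h" if z: "z \<in> ball z0 r" for z h
  proof -
    have "Cauchy (\<lambda>n. F' n z h)"
    proof (rule metric_CauchyI)
      fix e :: real assume e: "0 < e"
      have "(\<lambda>n. 2 * C / r * (a n + a n) * norm h) \<longlonglongrightarrow> 2 * C / r * (0 + 0) * norm h"
        by (intro tendsto_intros alim)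
      then obtain K where K: "\<And>n. K \<le> n \<Longrightarrow> 2 * C / r * (a n + a n) * norm h < e"
        using e order_tendstoD(2)[of _ _ sequentially e] unfolding eventually_sequentially
        by fastforce
      have "dist (F' m z h) (F' n z h) < e" if "K \<le> m" "K \<le> n" for m n
      proof -
        have "a m \<le> a K" "a n \<le> a K"
          using that by (auto simp: a_def field_simps)
        then have "2 * C / r * (a m + a n) * norm h \<le> 2 * C / r * (a K + a K) * norm h"
          using C0 r by (intro mult_right_mono mult_left_mono add_mono) auto
        then show ?thesis
          using cauchy[OF z, of m h n] K[of K] by (simp add: dist_norm)
      qed
      then show "\<exists>K. \<forall>m\<ge>K. \<forall>n\<ge>K. dist (F' m z h) (F' n z h) < e"
        by blast
    qed
    then show ?thesis
      unfolding g'_def by (metis Cauchy_convergent convergent_LIMSEQ_iff)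
  qed
  \<comment> \<open>Let \<open>m\<close> tend to infinity in \<open>cauchy\<close>.\<close>
  have unif: "norm (F' n z h - g' z h) \<le> 2 * C / r * a n * norm h" if z: "z \<in> ball z0 r" for n z h
  proof (rule LIMSEQ_le)
    show "(\<lambda>m. norm (F' n z h - F' m z h)) \<longlonglongrightarrow> norm (F' n z h - g' z h)"
      by (intro tendsto_intros g'[OF z])
    have "(\<lambda>m. 2 * C / r * (a n + a m) * norm h) \<longlonglongrightarrow> 2 * C / r * (a n + 0) * norm h"
      by (intro tendsto_intros alim)
    then show "(\<lambda>m. 2 * C / r * (a n + a m) * norm h) \<longlonglongrightarrow> 2 * C / r * a n * norm h"
      by simp
    show "\<exists>K. \<forall>m\<ge>K. norm (F' n z h - F' m z h) \<le> 2 * C / r * (a n + a m) * norm h"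
      using cauchy[OF z] by blast
  qed
  have F_lim: "(\<lambda>n. F n z) \<longlonglongrightarrow> Dfr f z v" if z: "z \<in> ball z0 r" for z
  proof -
    have z2: "z \<in> ball z0 (2 * r)"
      using z r by auto
    have null: "(\<lambda>n. C * a n) \<longlonglongrightarrow> 0"
      using tendsto_mult_left[OF alim, of C] by simp
    have "(\<lambda>n. F n z - Dfr f z v) \<longlonglongrightarrow> 0"
      by (intro Lim_null_comparison[OF _ null] always_eventually allI close z2)
    then show ?thesis
      by (simp add: LIM_zero_iff)
  qed
  have "\<exists>g. \<forall>z\<in>ball z0 r. (\<lambda>n. F n z) \<longlonglongrightarrow> g z \<and> (g has_derivative g' z) (at z within ball z0 r)"
  proof (rule has_derivative_sequence)
    show "convex (ball z0 r)" "z0 \<in> ball z0 r"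
      using r by auto
    show "(F n has_derivative F' n z) (at z within ball z0 r)" if "z \<in> ball z0 r" for n z
      using F'[of z n] that r by (auto intro: has_derivative_at_withinI)
    show "\<forall>\<^sub>F n in sequentially. \<forall>z\<in>ball z0 r. \<forall>h. norm (F' n z h - g' z h) \<le> e * norm h"
      if e: "0 < e" for e
    proof -
      have "(\<lambda>n. 2 * C / r * a n) \<longlonglongrightarrow> 2 * C / r * 0"
        by (intro tendsto_intros alim)
      then have "\<forall>\<^sub>F n in sequentially. 2 * C / r * a n < e"
        using e by (intro order_tendstoD(2)) auto
      then show ?thesis
        by (rule eventually_mono)
          (use unif in \<open>meson less_imp_le mult_right_mono norm_ge_zero order_trans\<close>)
    qed
    show "(\<lambda>n. F n z0) \<longlonglongrightarrow> Dfr f z0 v"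
      using r by (intro F_lim) auto
  qed
  then obtain g where g: "\<And>z. z \<in> ball z0 r \<Longrightarrow> (\<lambda>n. F n z) \<longlonglongrightarrow> g z"
    "\<And>z. z \<in> ball z0 r \<Longrightarrow> (g has_derivative g' z) (at z within ball z0 r)"
    by blast
  have "g z = Dfr f z v" if z: "z \<in> ball z0 r" for z
    using LIMSEQ_unique[OF g(1)[OF z] F_lim[OF z]] .
  moreover have "(g has_derivative g' z0) (at z0)"
    using g(2)[of z0] r at_within_open[of z0 "ball z0 r"] by auto
  ultimately have "((\<lambda>z. Dfr f z v) has_derivative g' z0) (at z0)"
    using r by (elim has_derivative_transform_within_open[where s = "ball z0 r"]) auto
  moreover have "g' z0 (c *\<^sub>C h) = cnj c *\<^sub>C g' z0 h" for c h
  proof -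
    have "(\<lambda>n. F' n z0 (c *\<^sub>C h)) \<longlonglongrightarrow> cnj c *\<^sub>C g' z0 h"
      using r by (simp add: F'_cnj) (intro tendsto_intros g', simp)
    then show ?thesis
      using g'[of z0 "c *\<^sub>C h"] r LIMSEQ_unique by auto
  qed
  ultimately show "\<exists>D. ((\<lambda>z. Dfr f z v) has_derivative D) (at z0) \<and> (\<forall>c v. D (c *\<^sub>C v) = cnj c *\<^sub>C D v)"
    by blast
qed

section \<open>Gram matrices\<close>

lemma orthogonal_span:
  assumes "\<And>b. b \<in> B \<Longrightarrow> cinner x b = 0" "z \<in> cvec.span B"
  shows "cinner x z = 0"
  using assms(2)
  by (induction rule: cvec.span_induct_alt) (auto simp: cinner_add_right cinner_scaleC_right assms(1))

text \<open>Gram-Schmidt by induction on the finite set, which avoids any appeal to closedness of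
  the span.\<close>

lemma span_projection_exists:
  assumes "finite B"
  shows "\<exists>p\<in>cvec.span B. \<forall>z\<in>cvec.span B. cinner (x - p) z = 0"
proof -
  have "\<exists>p\<in>cvec.span B. \<forall>b\<in>B. cinner (x - p) b = 0" for x
    using assms
  proof (induction B arbitrary: x rule: finite_induct)
    case empty
    then show ?case
      by simp
  next
    case (insert b B)
    obtain q where q: "q \<in> cvec.span B" "\<forall>c\<in>B. cinner (b - q) c = 0"
      using insert.IH[of b] by blast
    obtain p where p: "p \<in> cvec.span B" "\<forall>c\<in>B. cinner (x - p) c = 0"
      using insert.IH[of x] by blast
    define g where "g = b - q"
    \<comment> \<open>If \<open>b\<close> already lies in the span of \<open>B\<close>, then
      \<open>g = 0\<close> and the correction term vanishes, so the definition needs no case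
      distinction.\<close>
    define p' where "p' = p + (cinner (x - p) g / cinner g g) *\<^sub>C g"
    have gq: "cinner g q = 0"
      unfolding g_def by (rule orthogonal_span[OF _ q(1)]) (rule bspec[OF q(2)])
    have xq: "cinner (x - p) q = 0"
      by (rule orthogonal_span[OF _ q(1)]) (rule bspec[OF p(2)])
    have sp: "p \<in> cvec.span (insert b B)" "q \<in> cvec.span (insert b B)"
      using p(1) q(1) cvec.span_mono[of B "insert b B"] by auto
    then have "p' \<in> cvec.span (insert b B)"
      unfolding p'_def g_def
      by (simp add: cvec.span_add cvec.span_scale cvec.span_diff cvec.span_base)
    moreover have "cinner (x - p') c = 0" if "c \<in> insert b B" for c
    proof -
      have x: "cinner (x - p') c = cinner (x - p) c - cinner (x - p) g / cinner g g * cinner g c" for c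
        by (simp add: p'_def cinner_diff_left cinner_add_left cinner_scaleC_left)
      show ?thesis
      proof (cases "c \<in> B")
        case True
        then show ?thesis
          using p q by (simp add: x g_def)
      next
        case False
        then have c: "c = g + q"
          using that by (simp add: g_def)
        show ?thesis
          by (cases "g = 0") (simp_all add: x c cinner_add_right gq xq)
      qed
    qed
    ultimately show ?case
      by blast
  qed
  then show ?thesis
    using orthogonal_span by metis
qed

lemma span_image_coordinates:
  assumes "x \<in> cvec.span (f ` {..<m::nat})"
  obtains c where "x = (\<Sum>b<m. c b *\<^sub>C f b)"
proof -
  have "\<exists>c. x = (\<Sum>b<m. c b *\<^sub>C f b)"
    using assms
  proof (induction rule: cvec.span_induct_alt)
    case base
    show ?case
      by (intro exI[of _ "\<lambda>_. 0"]) simp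
  next
    case (step k y z)
    then obtain a c where "a < m" "y = f a" "z = (\<Sum>b<m. c b *\<^sub>C f b)"
      by blast
    moreover have "(\<Sum>b<m. (if b = a then k else 0) *\<^sub>C f b) = k *\<^sub>C f a" if "a < m"
      using that by (simp add: if_distrib[of "\<lambda>t. t *\<^sub>C f _"] sum.delta cong: if_cong)
    ultimately show ?case
      by (intro exI[of _ "\<lambda>b. (if b = a then k else 0) + c b"])
        (simp add: scaleC_left_distrib sum.distrib)
  qed
  then show ?thesis
    using that by blast
qed

lemma sum_in_span: "(\<Sum>b<m. c b *\<^sub>C f b) \<in> cvec.span (f ` {..<m::nat})"
  by (intro cvec.span_sum cvec.span_scale cvec.span_base) auto

text \<open>The component of \<open>f a\<close> orthogonal to the other vectors, divided by its
  squared norm. Independence makes that component nonzero.\<close>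

lemma dual_vector_exists:
  assumes inj: "inj_on f {..<m::nat}" and ind: "\<not> cvec.dependent (f ` {..<m})" and a: "a < m"
  shows "\<exists>d\<in>cvec.span (f ` {..<m}). \<forall>b<m. cinner d (f b) = (if a = b then 1 else 0)"
proof -
  define B where "B = f ` ({..<m} - {a})"
  obtain p where p: "p \<in> cvec.span B" "\<And>z. z \<in> cvec.span B \<Longrightarrow> cinner (f a - p) z = 0"
    using span_projection_exists[of B "f a"] by (auto simp: B_def)
  define g where "g = f a - p"
  have "f ` {..<m} - {f a} = B"
    using inj a by (auto simp: B_def inj_on_def)
  then have "f a \<notin> cvec.span B"
    using ind a unfolding cvec.dependent_def by fastforce
  then have g0: "g \<noteq> 0"
    using p by (auto simp: g_def)
  have "cinner g (f a) = cinner g g + cinner g p"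
    by (simp add: g_def flip: cinner_add_right)
  then have ga: "cinner g (f a) = cinner g g"
    using p by (simp add: g_def)
  have gb: "cinner g (f b) = 0" if "b < m" "b \<noteq> a" for b
    using that p(2)[of "f b"] cvec.span_base[of "f b" B] by (auto simp: B_def g_def)
  have sub: "cvec.span B \<subseteq> cvec.span (f ` {..<m})"
    by (intro cvec.span_mono) (auto simp: B_def)
  have "g \<in> cvec.span (f ` {..<m})"
    unfolding g_def using a
    by (intro cvec.span_diff[OF cvec.span_base subsetD[OF sub p(1)]]) auto
  then show ?thesis
    using g0 ga gb
    by (intro bexI[of _ "(1 / cinner g g) *\<^sub>C g"]) (auto simp: cinner_scaleC_left cvec.span_scale)
qed

text \<open>A left inverse \<open>X\<close> of a Gram matrix is the Gram matrix of the dual basis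
  \<open>\<Sum>\<^sub>c X a c f\<^sub>c\<close>; hence it is hermitian and also a right inverse.\<close>

lemma gram_inverse:
  fixes f :: "nat \<Rightarrow> 'h::chilbert_space"
  assumes inj: "inj_on f {..<m::nat}" and ind: "\<not> cvec.dependent (f ` {..<m})"
  defines "G \<equiv> \<lambda>a b. cinner (f a) (f b)"
  shows "a < m \<Longrightarrow> b < m \<Longrightarrow> (\<Sum>c<m. mat_inv m G a c * G c b) = (if a = b then 1 else 0)"
    and "a < m \<Longrightarrow> b < m \<Longrightarrow> (\<Sum>c<m. G a c * mat_inv m G c b) = (if a = b then 1 else 0)"
proof -
  have "\<exists>x. \<forall>b<m. (\<Sum>c<m. x c * G c b) = (if a = b then 1 else 0)" if "a < m" for a
  proof -
    obtain d where d: "d \<in> cvec.span (f ` {..<m})" "\<forall>b<m. cinner d (f b) = (if a = b then 1 else 0)"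
      using dual_vector_exists[OF inj ind \<open>a < m\<close>] by blast
    obtain x where "d = (\<Sum>c<m. x c *\<^sub>C f c)"
      using span_image_coordinates[OF d(1)] by blast
    then show ?thesis
      using d(2) by (intro exI[of _ x]) (simp add: G_def cinner_sum_left cinner_scaleC_left)
  qed
  then have "\<exists>X. \<forall>a<m. \<forall>b<m. (\<Sum>c<m. X a c * G c b) = (if a = b then 1 else 0)"
    by metis
  from someI_ex[OF this] have left: "(\<Sum>c<m. mat_inv m G a c * G c b) = (if a = b then 1 else 0)"
    if "a < m" "b < m" for a b
    using that unfolding mat_inv_def by blast
  define X where "X = mat_inv m G"
  define d where "d a = (\<Sum>c<m. X a c *\<^sub>C f c)" for a
  have df: "cinner (d a) (f b) = (if a = b then 1 else 0)" if "a < m" "b < m" for a b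
    using left[OF that] by (simp add: d_def X_def G_def cinner_sum_left cinner_scaleC_left)
  have "cinner (d a) (d b) = cnj (X b a)" if "a < m" "b < m" for a b
  proof -
    have "cinner (d a) (d b) = (\<Sum>c<m. cnj (X b c) * cinner (d a) (f c))"
      by (simp add: d_def[of b] cinner_sum_right cinner_scaleC_right)
    also have "\<dots> = (\<Sum>c<m. if a = c then cnj (X b c) else 0)"
      using that by (intro sum.cong) (auto simp: df)
    finally show ?thesis
      using that by (simp add: sum.delta')
  qed
  then have herm: "cnj (X b a) = X a b" if "a < m" "b < m" for a b
    using that by (metis cinner_commute complex_cnj_cnj)
  have "(\<Sum>c<m. G a c * X c b) = cnj (\<Sum>c<m. X b c * G c a)" if "a < m" "b < m" for a b
    unfolding cnj_sum
  proof (rule sum.cong)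
    fix c assume "c \<in> {..<m}"
    then show "G a c * X c b = cnj (X b c * G c a)"
      using herm[of c b] that cinner_commute[of "f a" "f c"] by (simp add: G_def mult.commute)
  qed simp
  then show "a < m \<Longrightarrow> b < m \<Longrightarrow> (\<Sum>c<m. G a c * mat_inv m G c b) = (if a = b then 1 else 0)"
    using left[of b a] unfolding X_def by (metis complex_cnj_one complex_cnj_zero)
  show "a < m \<Longrightarrow> b < m \<Longrightarrow> (\<Sum>c<m. mat_inv m G a c * G c b) = (if a = b then 1 else 0)"
    by (rule left)
qed

text \<open>Where \<open>h\<close> vanishes, the product rule asks only for continuity of the other
  factor: the error is \<open>r y\<close> times the remainder of \<open>h\<close> plus
  \<open>(r y - r w) * h' (y - w)\<close>. It serves to pass from continuity of an inverse matrix to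
  its differentiability.\<close>

lemma has_derivative_mult_vanishing:
  fixes r h :: "'a::real_normed_vector \<Rightarrow> 'b::real_normed_algebra"
  assumes r: "isCont r w" and h: "(h has_derivative h') (at w)" and h0: "h w = 0"
  shows "((\<lambda>z. r z * h z) has_derivative (\<lambda>v. r w * h' v)) (at w)"
  unfolding has_derivative_iff_norm
proof
  have bl: "bounded_linear h'"
    using h by (rule has_derivative_bounded_linear)
  then show "bounded_linear (\<lambda>v. r w * h' v)"
    by (rule bounded_linear_const_mult)
  obtain K where K: "\<And>v. norm (h' v) \<le> norm v * K"
    using bounded_linear.bounded[OF bl] by blast
  have q: "((\<lambda>y. norm (h y - h w - h' (y - w)) / norm (y - w)) \<longlongrightarrow> 0) (at w)"
    using h unfolding has_derivative_iff_norm by blast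
  have r': "(r \<longlongrightarrow> r w) (at w)"
    using r by (simp add: isCont_def)
  have lim: "((\<lambda>y. norm (r y) * (norm (h y - h w - h' (y - w)) / norm (y - w)) + norm (r y - r w) * K)
      \<longlongrightarrow> norm (r w) * 0 + norm (r w - r w) * K) (at w)"
    by (intro tendsto_intros q r')
  show "((\<lambda>y. norm (r y * h y - r w * h w - r w * h' (y - w)) / norm (y - w)) \<longlongrightarrow> 0) (at w)"
  proof (rule Lim_null_comparison)
    show "\<forall>\<^sub>F y in at w. norm (norm (r y * h y - r w * h w - r w * h' (y - w)) / norm (y - w))
        \<le> norm (r y) * (norm (h y - h w - h' (y - w)) / norm (y - w)) + norm (r y - r w) * K"
      unfolding eventually_at_filter
    proof (intro always_eventually allI impI)
      fix y assume y: "y \<noteq> w"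
      have "r y * h y - r w * h w - r w * h' (y - w)
          = r y * (h y - h w - h' (y - w)) + (r y - r w) * h' (y - w)"
        by (simp add: h0 algebra_simps)
      then have "norm (r y * h y - r w * h w - r w * h' (y - w))
          \<le> norm (r y * (h y - h w - h' (y - w))) + norm ((r y - r w) * h' (y - w))"
        by (metis norm_triangle_ineq)
      also have "\<dots> \<le> norm (r y) * norm (h y - h w - h' (y - w)) + norm (r y - r w) * (norm (y - w) * K)"
        by (intro add_mono order_trans[OF norm_mult_ineq] mult_left_mono K) auto
      finally have "norm (r y * h y - r w * h w - r w * h' (y - w)) / norm (y - w)
          \<le> (norm (r y) * norm (h y - h w - h' (y - w)) + norm (r y - r w) * (norm (y - w) * K)) / norm (y - w)"
        by (rule divide_right_mono) simp
      also have "\<dots> = norm (r y) * (norm (h y - h w - h' (y - w)) / norm (y - w)) + norm (r y - r w) * K"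
        using y by (simp add: add_divide_distrib)
      finally show "norm (norm (r y * h y - r w * h w - r w * h' (y - w)) / norm (y - w))
        \<le> norm (r y) * (norm (h y - h w - h' (y - w)) / norm (y - w)) + norm (r y - r w) * K"
        by simp
    qed
    show "((\<lambda>y. norm (r y) * (norm (h y - h w - h' (y - w)) / norm (y - w)) + norm (r y - r w) * K)
      \<longlongrightarrow> 0) (at w)"
      using lim by simp
  qed
qed

text \<open>Everything comes from the resolvent identity
  \<open>R z = R w + R z * (G w - G z) * R w\<close>, used three times: it bounds \<open>R\<close>
  near \<open>w\<close>, then gives continuity and then differentiability at \<open>w\<close>. The
  inverse is merely given at each point, with no formula for its entries.\<close>

lemma matrix_inverse_differentiable:
  fixes G R :: "'x::real_normed_vector \<Rightarrow> nat \<Rightarrow> nat \<Rightarrow> complex"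
  assumes U: "open U" "w \<in> U"
    and left: "\<And>z a b. z \<in> U \<Longrightarrow> a < m \<Longrightarrow> b < m \<Longrightarrow> (\<Sum>c<m. R z a c * G z c b) = (if a = b then 1 else 0)"
    and right: "\<And>a b. a < m \<Longrightarrow> b < m \<Longrightarrow> (\<Sum>c<m. G w a c * R w c b) = (if a = b then 1 else 0)"
    and G: "\<And>a b. a < m \<Longrightarrow> b < m \<Longrightarrow> (\<lambda>z. G z a b) differentiable (at w)"
    and ab: "a < m" "b < m"
  shows "(\<lambda>z. R z a b) differentiable (at w)"
proof -
  have eq: "R z a b = R w a b + (\<Sum>c<m. \<Sum>d<m. R z a c * ((G w c d - G z c d) * R w d b))"
    if z: "z \<in> U" and ab: "a < m" "b < m" for z a b
  proof -
    have "(\<Sum>c<m. \<Sum>d<m. R z a c * (G w c d * R w d b)) = (\<Sum>c<m. R z a c * (\<Sum>d<m. G w c d * R w d b))"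
      by (simp add: sum_distrib_left)
    also have "\<dots> = (\<Sum>c<m. if c = b then R z a c else 0)"
      using ab by (intro sum.cong) (auto simp: right)
    finally have 1: "(\<Sum>c<m. \<Sum>d<m. R z a c * (G w c d * R w d b)) = R z a b"
      using ab by (simp add: sum.delta)
    have "(\<Sum>c<m. \<Sum>d<m. R z a c * (G z c d * R w d b)) = (\<Sum>d<m. (\<Sum>c<m. R z a c * G z c d) * R w d b)"
      by (subst sum.swap) (simp add: sum_distrib_right mult.assoc)
    also have "\<dots> = (\<Sum>d<m. if a = d then R w d b else 0)"
      using ab by (intro sum.cong) (auto simp: left[OF z])
    finally have 2: "(\<Sum>c<m. \<Sum>d<m. R z a c * (G z c d * R w d b)) = R w a b"
      using ab by (simp add: sum.delta')
    show ?thesis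
      by (simp add: left_diff_distrib right_diff_distrib sum_subtractf 1 2)
  qed
  define S where "S z = (\<Sum>a<m. \<Sum>b<m. cmod (R z a b))" for z
  have S0: "0 \<le> S z" for z
    by (simp add: S_def sum_nonneg)
  have le_S: "cmod (R z a b) \<le> S z" if "a < m" "b < m" for z a b
  proof -
    have "cmod (R z a b) \<le> (\<Sum>b<m. cmod (R z a b))"
      using that by (intro member_le_sum) auto
    also have "\<dots> \<le> S z"
      unfolding S_def using that
      by (intro member_le_sum[of a _ "\<lambda>a. \<Sum>b<m. cmod (R z a b)"]) (auto intro: sum_nonneg)
    finally show ?thesis .
  qed
  have Gcont: "((\<lambda>z. G z c d) \<longlongrightarrow> G w c d) (at w)" if "c < m" "d < m" for c d
    using differentiable_imp_continuous_within[OF G[OF that]] by (simp add: continuous_within)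
  \<comment> \<open>With \<open>\<delta> * S w \<le> 1 / 2\<close> the identity yields
    \<open>S z \<le> S w + S z / 2\<close>, so the unknown \<open>S z\<close> is absorbed on the
    left.\<close>
  define \<delta> where "\<delta> = 1 / (2 * (S w + 1))"
  have \<delta>: "0 < \<delta>" "\<delta> * S w \<le> 1 / 2"
    using S0[of w] by (auto simp: \<delta>_def field_simps)
  have "\<forall>\<^sub>F z in at w. \<forall>c\<in>{..<m}. \<forall>d\<in>{..<m}. cmod (G w c d - G z c d) < \<delta>"
    unfolding eventually_ball_finite_distrib[OF finite_lessThan]
  proof (intro ballI)
    fix c d assume "c \<in> {..<m}" "d \<in> {..<m}"
    then show "\<forall>\<^sub>F z in at w. cmod (G w c d - G z c d) < \<delta>"
      using tendstoD[OF Gcont \<delta>(1), of c d] by (simp add: dist_norm norm_minus_commute)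
  qed
  moreover have evU: "\<forall>\<^sub>F z in at w. z \<in> U"
    using U by (auto intro: eventually_at_in_open')
  ultimately have bound: "\<forall>\<^sub>F z in at w. S z \<le> 2 * S w"
  proof eventually_elim
    case (elim z)
    have "S z \<le> (\<Sum>a<m. \<Sum>b<m. cmod (R w a b) + (\<Sum>c<m. \<Sum>d<m. cmod (R z a c) * (\<delta> * cmod (R w d b))))"
      unfolding S_def
    proof (intro sum_mono)
      fix a b assume ab: "a \<in> {..<m}" "b \<in> {..<m}"
      have "cmod (R z a b) \<le> cmod (R w a b) + cmod (\<Sum>c<m. \<Sum>d<m. R z a c * ((G w c d - G z c d) * R w d b))"
        using ab by (subst eq[OF elim(2)]) (auto intro: norm_triangle_ineq)
      also have "cmod (\<Sum>c<m. \<Sum>d<m. R z a c * ((G w c d - G z c d) * R w d b))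
          \<le> (\<Sum>c<m. \<Sum>d<m. cmod (R z a c) * (\<delta> * cmod (R w d b)))"
      proof (intro sum_norm_le)
        fix c d assume "c \<in> {..<m}" "d \<in> {..<m}"
        then have "cmod (G w c d - G z c d) \<le> \<delta>"
          using elim(1) by (meson less_imp_le)
        then show "cmod (R z a c * ((G w c d - G z c d) * R w d b)) \<le> cmod (R z a c) * (\<delta> * cmod (R w d b))"
          by (simp add: norm_mult mult_left_mono mult_right_mono)
      qed
      finally show "cmod (R z a b) \<le> cmod (R w a b) + (\<Sum>c<m. \<Sum>d<m. cmod (R z a c) * (\<delta> * cmod (R w d b)))"
        by simp
    qed
    also have "\<dots> = S w + (\<Sum>a<m. \<Sum>b<m. \<Sum>c<m. \<Sum>d<m. cmod (R z a c) * (\<delta> * cmod (R w d b)))"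
      by (simp add: sum.distrib S_def)
    also have "(\<Sum>a<m. \<Sum>b<m. \<Sum>c<m. \<Sum>d<m. cmod (R z a c) * (\<delta> * cmod (R w d b))) = \<delta> * S w * S z"
    proof -
      have "(\<Sum>b<m. \<Sum>c<m. \<Sum>d<m. cmod (R z a c) * (\<delta> * cmod (R w d b)))
          = (\<Sum>c<m. cmod (R z a c)) * (\<delta> * S w)" for a
      proof -
        have "(\<Sum>b<m. \<Sum>c<m. \<Sum>d<m. cmod (R z a c) * (\<delta> * cmod (R w d b)))
            = (\<Sum>b<m. (\<Sum>c<m. cmod (R z a c)) * (\<delta> * (\<Sum>d<m. cmod (R w d b))))"
          by (simp only: sum_product sum_distrib_left[where r = \<delta>])
        also have "\<dots> = (\<Sum>c<m. cmod (R z a c)) * (\<delta> * (\<Sum>b<m. \<Sum>d<m. cmod (R w d b)))"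
          by (simp add: sum_distrib_left)
        also have "(\<Sum>b<m. \<Sum>d<m. cmod (R w d b)) = S w"
          unfolding S_def by (rule sum.swap)
        finally show ?thesis .
      qed
      then show ?thesis
        by (simp add: S_def[of z] mult.commute flip: sum_distrib_left)
    qed
    also have "\<delta> * S w * S z \<le> 1 / 2 * S z"
      by (intro mult_right_mono \<delta> S0)
    finally show ?case
      by simp
  qed
  have cont: "((\<lambda>z. R z a b) \<longlongrightarrow> R w a b) (at w)" if ab: "a < m" "b < m" for a b
  proof -
    \<comment> \<open>\<open>R z a c\<close> is only known to be bounded here; the convergence comes
      from \<open>G w c d - G z c d\<close>.\<close>
    have "((\<lambda>z. R z a c * ((G w c d - G z c d) * R w d b)) \<longlongrightarrow> 0) (at w)" if "c < m" "d < m" for c d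
    proof (rule Lim_null_comparison)
      show "\<forall>\<^sub>F z in at w. norm (R z a c * ((G w c d - G z c d) * R w d b))
          \<le> (2 * S w) * cmod ((G w c d - G z c d) * R w d b)"
        using bound
      proof eventually_elim
        case (elim z)
        then show ?case
          using le_S[of a c z] ab that by (simp add: norm_mult[of "R z a c"] mult_right_mono del: norm_mult)
      qed
      have "((\<lambda>z. (2 * S w) * cmod ((G w c d - G z c d) * R w d b))
          \<longlongrightarrow> (2 * S w) * cmod ((G w c d - G w c d) * R w d b)) (at w)"
        by (intro tendsto_intros Gcont that)
      then show "((\<lambda>z. (2 * S w) * cmod ((G w c d - G z c d) * R w d b)) \<longlongrightarrow> 0) (at w)"
        by simp
    qed
    then have "((\<lambda>z. R w a b + (\<Sum>c<m. \<Sum>d<m. R z a c * ((G w c d - G z c d) * R w d b)))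
        \<longlongrightarrow> R w a b + (\<Sum>c<m. \<Sum>d<m. 0)) (at w)"
      by (intro tendsto_intros) auto
    then have "((\<lambda>z. R w a b + (\<Sum>c<m. \<Sum>d<m. R z a c * ((G w c d - G z c d) * R w d b)))
        \<longlongrightarrow> R w a b) (at w)"
      by simp
    then show ?thesis
      by (rule Lim_transform_eventually)
        (use evU in \<open>eventually_elim, simp add: eq[OF _ ab, symmetric]\<close>)
  qed
  obtain G' where G': "\<And>c d. c < m \<Longrightarrow> d < m \<Longrightarrow> ((\<lambda>z. G z c d) has_derivative G' c d) (at w)"
    using G unfolding differentiable_def by metis
  \<comment> \<open>In each summand the factor \<open>G w c d - G z c d\<close> vanishes at
    \<open>w\<close>, so continuity of \<open>R\<close> is enough to differentiate the
    product.\<close>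
  have "((\<lambda>z. R z a c * ((G w c d - G z c d) * R w d b)) has_derivative
      (\<lambda>v. R w a c * (- G' c d v * R w d b))) (at w)" if "c < m" "d < m" for c d
  proof (rule has_derivative_mult_vanishing)
    show "isCont (\<lambda>z. R z a c) w"
      using cont[of a c] that ab by (simp add: isCont_def)
    show "((\<lambda>z. (G w c d - G z c d) * R w d b) has_derivative (\<lambda>v. - G' c d v * R w d b)) (at w)"
      by (auto intro!: derivative_eq_intros G' that)
  qed simp
  then have "((\<lambda>z. R w a b + (\<Sum>c<m. \<Sum>d<m. R z a c * ((G w c d - G z c d) * R w d b))) has_derivative
      (\<lambda>v. 0 + (\<Sum>c<m. \<Sum>d<m. R w a c * (- G' c d v * R w d b)))) (at w)"
    by (intro derivative_intros) auto
  then have "((\<lambda>z. R z a b) has_derivative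
      (\<lambda>v. 0 + (\<Sum>c<m. \<Sum>d<m. R w a c * (- G' c d v * R w d b)))) (at w)"
    by (rule has_derivative_transform_within_open[OF _ U]) (use eq ab in auto)
  then show ?thesis
    by (auto simp: differentiable_def)
qed

section \<open>Curvature and the second fundamental form\<close>

lemma antihol_frame_open: "antihol_frame E m U e \<Longrightarrow> open U"
  by (simp add: antihol_frame_def)

lemma antihol_frame_antiholomorphic: "antihol_frame E m U e \<Longrightarrow> a < m \<Longrightarrow> antiholomorphic_vec (e a) U"
  by (simp add: antihol_frame_def)

lemma antihol_frame_inj: "antihol_frame E m U e \<Longrightarrow> z \<in> U \<Longrightarrow> inj_on (\<lambda>a. e a z) {..<m}"
  by (simp add: antihol_frame_def)

lemma antihol_frame_independent:
  "antihol_frame E m U e \<Longrightarrow> z \<in> U \<Longrightarrow> \<not> cvec.dependent ((\<lambda>a. e a z) ` {..<m})"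
  by (simp add: antihol_frame_def)

lemma antihol_frame_span: "antihol_frame E m U e \<Longrightarrow> z \<in> U \<Longrightarrow> cvec.span ((\<lambda>a. e a z) ` {..<m}) = E z"
  by (simp add: antihol_frame_def)

lemma antihol_frame_sum_in:
  assumes "antihol_frame E m U e" "z \<in> U"
  shows "(\<Sum>a<m. c a *\<^sub>C e a z) \<in> E z"
  unfolding antihol_frame_span[OF assms, symmetric] by (rule sum_in_span[of c "\<lambda>a. e a z"])

lemma antihol_frame_in:
  assumes "antihol_frame E m U e" "z \<in> U" "a < m"
  shows "e a z \<in> E z"
  unfolding antihol_frame_span[OF assms(1,2), symmetric]
  using assms(3) by (intro cvec.span_base) auto

lemma antihol_frame_subspace:
  assumes "antihol_frame E m U e" "z \<in> U"
  shows "cvec.subspace (E z)"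
  unfolding antihol_frame_span[OF assms, symmetric] by (rule cvec.subspace_span)

lemma antihol_frame_coordinates:
  assumes "antihol_frame E m U e" "z \<in> U" "x \<in> E z"
  obtains c where "x = (\<Sum>a<m. c a *\<^sub>C e a z)"
  by (rule span_image_coordinates[of x "\<lambda>a. e a z" m])
    (simp_all add: antihol_frame_span[OF assms(1,2)] assms(3))

lemma antihol_frame_orthogonal:
  assumes "antihol_frame E m U e" "z \<in> U" "\<And>a. a < m \<Longrightarrow> cinner x (e a z) = 0" "y \<in> E z"
  shows "cinner x y = 0"
  by (rule orthogonal_span[of "(\<lambda>a. e a z) ` {..<m}"])
    (auto simp: antihol_frame_span[OF assms(1,2)] assms(3,4))

lemma gramian_inverse_left:
  assumes "antihol_frame E m U e" "z \<in> U" "a < m" "b < m"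
  shows "(\<Sum>c<m. mat_inv m (gramian e z) a c * gramian e z c b) = (if a = b then 1 else 0)"
  using gram_inverse(1)[OF antihol_frame_inj[OF assms(1,2)] antihol_frame_independent[OF assms(1,2)] assms(3,4)]
  by (simp add: gramian_def[abs_def])

lemma gramian_inverse_right:
  assumes "antihol_frame E m U e" "z \<in> U" "a < m" "b < m"
  shows "(\<Sum>c<m. gramian e z a c * mat_inv m (gramian e z) c b) = (if a = b then 1 else 0)"
  using gram_inverse(2)[OF antihol_frame_inj[OF assms(1,2)] antihol_frame_independent[OF assms(1,2)] assms(3,4)]
  by (simp add: gramian_def[abs_def])

lemma gramian_has_derivative:
  assumes "antihol_frame E m U e" "z \<in> U" "a < m" "b < m"
  shows "((\<lambda>z. gramian e z a b) has_derivative
    (\<lambda>v. cinner (e a z) (Dfr (e b) z v) + cinner (Dfr (e a) z v) (e b z))) (at z)"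
  unfolding gramian_def
  using antiholomorphic_vecD(1)[OF antihol_frame_antiholomorphic[OF assms(1,3)] assms(2)]
    antiholomorphic_vecD(1)[OF antihol_frame_antiholomorphic[OF assms(1,4)] assms(2)]
  by (rule has_derivative_cinner)

lemma gramian_inverse_differentiable:
  assumes e: "antihol_frame E m U e" and w: "w \<in> U" and ab: "a < m" "b < m"
  shows "(\<lambda>z. mat_inv m (gramian e z) a b) differentiable (at w)"
  by (rule matrix_inverse_differentiable[where G = "\<lambda>z. gramian e z" and R = "\<lambda>z. mat_inv m (gramian e z)",
        OF antihol_frame_open[OF e] w gramian_inverse_left[OF e] gramian_inverse_right[OF e w] _ ab])
    (use gramian_has_derivative[OF e w] in \<open>auto simp: differentiable_def\<close>)

text \<open>If \<open>x\<close> has coordinates \<open>c\<close>, its pairings with the frame form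
  the row vector \<open>c G\<close>, hence the inverse on the right. The formula is wanted because
  it makes the coordinates of a differentiable section differentiable.\<close>

lemma section_expansion:
  assumes e: "antihol_frame E m U e" and z: "z \<in> U" and x: "x \<in> E z"
  shows "x = (\<Sum>a<m. (\<Sum>b<m. cinner x (e b z) * mat_inv m (gramian e z) b a) *\<^sub>C e a z)"
proof -
  obtain c where c: "x = (\<Sum>a<m. c a *\<^sub>C e a z)"
    using antihol_frame_coordinates[OF e z x] .
  have "(\<Sum>b<m. cinner x (e b z) * mat_inv m (gramian e z) b a) = c a" if "a < m" for a
  proof -
    have "(\<Sum>b<m. cinner x (e b z) * mat_inv m (gramian e z) b a)
        = (\<Sum>b<m. \<Sum>d<m. c d * (gramian e z d b * mat_inv m (gramian e z) b a))"
      by (simp add: c cinner_sum_left cinner_scaleC_left gramian_def sum_distrib_right mult.assoc)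
    also have "\<dots> = (\<Sum>d<m. c d * (\<Sum>b<m. gramian e z d b * mat_inv m (gramian e z) b a))"
      by (subst sum.swap) (simp add: sum_distrib_left)
    also have "\<dots> = (\<Sum>d<m. if d = a then c d else 0)"
      using that by (intro sum.cong) (auto simp: gramian_inverse_right[OF e z])
    finally show ?thesis
      using that by simp
  qed
  then show ?thesis
    using c by simp
qed

text \<open>All coordinates \<open>k a\<close> vanish at \<open>w\<close>, so the product rule
  leaves only the terms in which the \<open>k a\<close> are differentiated, and these lie in the
  fibre.\<close>

lemma vanishing_section_derivative:
  fixes t :: "complex ^ 'n::finite \<Rightarrow> 'h::chilbert_space"
  assumes e: "antihol_frame E m U e" and w: "w \<in> U"
    and V: "open V" "w \<in> V" "\<And>z. z \<in> V \<Longrightarrow> t z \<in> E z"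
    and t: "(t has_derivative T) (at w)" "t w = 0"
  shows "T v \<in> E w"
proof -
  define k where "k a z = (\<Sum>b<m. cinner (t z) (e b z) * mat_inv m (gramian e z) b a)" for a z
  have "k a differentiable (at w)" if "a < m" for a
  proof -
    have "(\<lambda>z. cinner (t z) (e b z)) differentiable (at w)" if "b < m" for b
      using has_derivative_cinner[OF t(1) antiholomorphic_vecD(1)[OF antihol_frame_antiholomorphic[OF e that] w]]
      by (auto simp: differentiable_def)
    then show ?thesis
      unfolding k_def using gramian_inverse_differentiable[OF e w] that
      by (intro differentiable_sum ballI) auto
  qed
  then obtain k' where k': "\<And>a. a < m \<Longrightarrow> (k a has_derivative k' a) (at w)"
    unfolding differentiable_def by metis
  have k0: "k a w = 0" for a
    by (simp add: k_def t(2))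
  have "((\<lambda>z. k a z *\<^sub>C e a z) has_derivative (\<lambda>v. k' a v *\<^sub>C e a w)) (at w)" if "a < m" for a
    using has_derivative_scaleC[OF k'[OF that] antiholomorphic_vecD(1)[OF antihol_frame_antiholomorphic[OF e that] w]]
    by (simp add: k0)
  then have "((\<lambda>z. \<Sum>a<m. k a z *\<^sub>C e a z) has_derivative (\<lambda>v. \<Sum>a<m. k' a v *\<^sub>C e a w)) (at w)"
    by (intro has_derivative_sum) auto
  then have "(t has_derivative (\<lambda>v. \<Sum>a<m. k' a v *\<^sub>C e a w)) (at w)"
  proof (rule has_derivative_transform_within_open)
    show "open (U \<inter> V)" "w \<in> U \<inter> V"
      using antihol_frame_open[OF e] V w by auto
    show "(\<Sum>a<m. k a z *\<^sub>C e a z) = t z" if "z \<in> U \<inter> V" for z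
      using that unfolding k_def by (intro section_expansion[OF e, symmetric] V(3)) auto
  qed
  then have "T v = (\<Sum>a<m. k' a v *\<^sub>C e a w)"
    by (rule fun_cong[OF has_derivative_unique[OF t(1)]])
  then show ?thesis
    using antihol_frame_sum_in[OF e w] by simp
qed

lemma axis_scaleC: "axis i \<i> = \<i> *\<^sub>C (axis i 1 :: complex ^ 'n)"
  by (simp add: vec_eq_iff axis_def scaleC_vec_def scaleC_complex_def)

lemma vector_derivative_line:
  fixes f :: "'a::real_normed_vector \<Rightarrow> 'b::real_normed_vector"
  assumes "(f has_derivative F) (at z)"
  shows "vector_derivative (\<lambda>t. f (z + t *\<^sub>R v)) (at 0) = F v"
proof -
  have "((\<lambda>t. z + t *\<^sub>R v) has_derivative (\<lambda>t. t *\<^sub>R v)) (at 0)"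
    by (auto intro!: derivative_eq_intros)
  then have "((\<lambda>t. f (z + t *\<^sub>R v)) has_derivative (\<lambda>t. F (t *\<^sub>R v))) (at 0)"
    by (rule has_derivative_compose) (use assms in simp)
  then have "((\<lambda>t. f (z + t *\<^sub>R v)) has_vector_derivative F v) (at 0)"
    using linear_cmul[OF has_derivative_linear[OF assms]] by (simp add: has_vector_derivative_def)
  then show ?thesis
    by (rule vector_derivative_at)
qed

lemma wirtinger_eq:
  assumes "(f has_derivative F) (at z)"
  shows "wirtinger i f z = (F (axis i 1) - \<i> * F (\<i> *\<^sub>C axis i 1)) / 2"
    and "wirtinger_bar i f z = (F (axis i 1) + \<i> * F (\<i> *\<^sub>C axis i 1)) / 2"
  by (simp_all add: wirtinger_def wirtinger_bar_def partial_re_def partial_im_def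
      vector_derivative_line[OF assms] axis_scaleC)

text \<open>In \<open>gramian e u a b\<close> the first entry is anti-holomorphic and the second
  becomes holomorphic through the conjugate linearity of \<open>cinner\<close>; so
  \<open>wirtinger i\<close> sees only \<open>e b\<close>.\<close>

lemma wirtinger_gramian:
  assumes e: "antihol_frame E m U e" and z: "z \<in> U" and ab: "a < m" "b < m"
  shows "wirtinger i (\<lambda>u. gramian e u a b) z = cinner (e a z) (Dfr (e b) z (axis i 1))"
  using antiholomorphic_vecD(2)[OF antihol_frame_antiholomorphic[OF e ab(1)] z]
    antiholomorphic_vecD(2)[OF antihol_frame_antiholomorphic[OF e ab(2)] z]
  by (simp add: wirtinger_eq(1)[OF gramian_has_derivative[OF e z ab]] cinner_scaleC_left
      cinner_scaleC_right cinner_minus_left cinner_minus_right algebra_simps)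

text \<open>With \<open>X = G\<^sup>-\<^sup>1 \<partial>G\<close>, this is \<open>\<partial>\<bar>\<close> of the identity \<open>G X = \<partial>G\<close>.\<close>

lemma curvature_matrix_identity:
  fixes e :: "nat \<Rightarrow> complex ^ 'n::finite \<Rightarrow> 'h::chilbert_space"
    and i j :: 'n
  assumes e: "antihol_frame E m U e" and w: "w \<in> U"
  defines "X \<equiv> \<lambda>a b. \<Sum>c<m. mat_inv m (gramian e w) a c * cinner (e c w) (Dfr (e b) w (axis i 1))"
  assumes db: "d < m" "b < m"
  shows "(\<Sum>a<m. cinner (e d w) (e a w) * X a b) = cinner (e d w) (Dfr (e b) w (axis i 1))"
    and "(\<Sum>a<m. cinner (e d w) (e a w) * curvature_matrix m e w i j a b)
      = cinner (Dfr (e d) w (axis j 1)) (Dfr (e b) w (axis i 1))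
        - (\<Sum>a<m. cinner (Dfr (e d) w (axis j 1)) (e a w) * X a b)"
proof -
  define vi vj :: "complex ^ 'n" where "vi = axis i 1" and "vj = axis j 1"
  define Y where "Y z c = cinner (e c z) (Dfr (e b) z vi)" for z c
  define Z where "Z z a = (\<Sum>c<m. mat_inv m (gramian e z) a c * Y z c)" for z a
  have GZ: "(\<Sum>a<m. gramian e z d a * Z z a) = Y z d" if z: "z \<in> U" for z
  proof -
    have "(\<Sum>a<m. gramian e z d a * Z z a)
        = (\<Sum>c<m. (\<Sum>a<m. gramian e z d a * mat_inv m (gramian e z) a c) * Y z c)"
      unfolding Z_def sum_distrib_left sum_distrib_right
      by (subst sum.swap) (simp add: mult.assoc)
    also have "\<dots> = (\<Sum>c<m. if d = c then Y z c else 0)"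
      using db by (intro sum.cong) (auto simp: gramian_inverse_right[OF e z])
    finally show ?thesis
      using db by (simp add: sum.delta')
  qed
  have ZX: "Z w a = X a b" for a
    by (simp add: Z_def X_def Y_def vi_def)
  show "(\<Sum>a<m. cinner (e d w) (e a w) * X a b) = cinner (e d w) (Dfr (e b) w (axis i 1))"
    using GZ[OF w] by (simp add: ZX gramian_def Y_def vi_def)
  note ea = antiholomorphic_vecD[OF antihol_frame_antiholomorphic[OF e] w]
  have "antiholomorphic_vec (\<lambda>z. Dfr (e b) z vi) U"
    by (intro antiholomorphic_derivative_antiholomorphic antihol_frame_antiholomorphic[OF e]
        antihol_frame_open[OF e] db)
  from antiholomorphic_vecD[OF this w] obtain W
    where W: "((\<lambda>z. Dfr (e b) z vi) has_derivative W) (at w)" "\<And>c v. W (c *\<^sub>C v) = cnj c *\<^sub>C W v"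
    by blast
  have Y': "((\<lambda>z. Y z c) has_derivative
      (\<lambda>v. cinner (e c w) (W v) + cinner (Dfr (e c) w v) (Dfr (e b) w vi))) (at w)" if "c < m" for c
    unfolding Y_def by (rule has_derivative_cinner[OF ea(1)[OF that] W(1)])
  have "(\<lambda>z. Z z a) differentiable (at w)" if "a < m" for a
    unfolding Z_def using that
    by (intro differentiable_sum ballI differentiable_mult gramian_inverse_differentiable[OF e w])
      (auto simp: differentiable_def intro: Y')
  then obtain Z' where Z': "\<And>a. a < m \<Longrightarrow> ((\<lambda>z. Z z a) has_derivative Z' a) (at w)"
    unfolding differentiable_def by metis
  have K: "curvature_matrix m e w i j a b = (Z' a vj + \<i> * Z' a (\<i> *\<^sub>C vj)) / 2" if a: "a < m" for a
  proof -
    have "((\<lambda>z. \<Sum>c<m. mat_inv m (gramian e z) a c * wirtinger i (\<lambda>u. gramian e u c b) z)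
        has_derivative Z' a) (at w)"
      using Z'[OF a]
    proof (rule has_derivative_transform_within_open)
      show "open U" "w \<in> U"
        using antihol_frame_open[OF e] w by auto
    qed (use db in \<open>simp add: Z_def Y_def vi_def wirtinger_gramian[OF e]\<close>)
    then show ?thesis
      unfolding curvature_matrix_def vj_def by (rule wirtinger_eq(2))
  qed
  have "((\<lambda>z. \<Sum>a<m. gramian e z d a * Z z a) has_derivative
      (\<lambda>v. \<Sum>a<m. gramian e w d a * Z' a v
        + (cinner (e d w) (Dfr (e a) w v) + cinner (Dfr (e d) w v) (e a w)) * Z w a)) (at w)"
    by (intro has_derivative_sum has_derivative_mult gramian_has_derivative[OF e w] Z' db) auto
  then have "((\<lambda>z. Y z d) has_derivative
      (\<lambda>v. \<Sum>a<m. gramian e w d a * Z' a v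
        + (cinner (e d w) (Dfr (e a) w v) + cinner (Dfr (e d) w v) (e a w)) * Z w a)) (at w)"
    by (rule has_derivative_transform_within_open[OF _ antihol_frame_open[OF e] w]) (rule GZ)
  from fun_cong[OF has_derivative_unique[OF this Y'[OF db(1)]]]
  have eq: "(\<Sum>a<m. gramian e w d a * Z' a v
        + (cinner (e d w) (Dfr (e a) w v) + cinner (Dfr (e d) w v) (e a w)) * Z w a)
      = cinner (e d w) (W v) + cinner (Dfr (e d) w v) (Dfr (e b) w vi)" for v .
  \<comment> \<open>The combination \<open>(F v + \<i> * F (\<i> *\<^sub>C v)) / 2\<close> is
    applied to both sides of \<open>eq\<close>. It keeps the conjugate linear terms and annihilates
    the complex linear ones, among them those with the second derivative \<open>W\<close>.\<close>
  have "(\<Sum>a<m. gramian e w d a * curvature_matrix m e w i j a b + cinner (Dfr (e d) w vj) (e a w) * Z w a)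
      = (\<Sum>a<m. ((gramian e w d a * Z' a vj
        + (cinner (e d w) (Dfr (e a) w vj) + cinner (Dfr (e d) w vj) (e a w)) * Z w a)
        + \<i> * (gramian e w d a * Z' a (\<i> *\<^sub>C vj)
        + (cinner (e d w) (Dfr (e a) w (\<i> *\<^sub>C vj)) + cinner (Dfr (e d) w (\<i> *\<^sub>C vj)) (e a w)) * Z w a)) / 2)"
    by (intro sum.cong refl)
      (simp add: K ea(2) db cinner_scaleC_left cinner_scaleC_right
        cinner_minus_left cinner_minus_right field_simps)
  also have "\<dots> = ((cinner (e d w) (W vj) + cinner (Dfr (e d) w vj) (Dfr (e b) w vi))
      + \<i> * (cinner (e d w) (W (\<i> *\<^sub>C vj)) + cinner (Dfr (e d) w (\<i> *\<^sub>C vj)) (Dfr (e b) w vi))) / 2"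
    by (simp only: sum_divide_distrib[symmetric] sum.distrib[of "\<lambda>a. _ a" "\<lambda>a. \<i> * _ a"]
        sum_distrib_left[symmetric] eq)
  also have "\<dots> = cinner (Dfr (e d) w vj) (Dfr (e b) w vi)"
    by (simp add: W(2) ea(2) db cinner_scaleC_left cinner_scaleC_right
        cinner_minus_left cinner_minus_right field_simps)
  finally show "(\<Sum>a<m. cinner (e d w) (e a w) * curvature_matrix m e w i j a b)
      = cinner (Dfr (e d) w (axis j 1)) (Dfr (e b) w (axis i 1))
        - (\<Sum>a<m. cinner (Dfr (e d) w (axis j 1)) (e a w) * X a b)"
    by (simp add: sum.distrib gramian_def ZX vi_def vj_def algebra_simps)
qed

text \<open>By the first matrix identity the vector \<open>q\<close>, whose coefficients come from
  \<open>X\<close>, is the orthogonal projection of \<open>S\<close> onto the fibre and hence equals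
  \<open>p\<close>. The second identity then reads as an inner product with
  \<open>S - p\<close>.\<close>

lemma curvature_frame:
  fixes e :: "nat \<Rightarrow> complex ^ 'n::finite \<Rightarrow> 'h::chilbert_space" and i j :: 'n and c :: "nat \<Rightarrow> complex"
  assumes e: "antihol_frame E m U e" and w: "w \<in> U" and d: "d < m"
  defines "S \<equiv> \<Sum>b<m. cnj (c b) *\<^sub>C Dfr (e b) w (axis i 1)"
  assumes p: "p \<in> E w" "\<And>x. x \<in> E w \<Longrightarrow> cinner (S - p) x = 0"
  shows "cinner (e d w) (\<Sum>a<m. cnj (\<Sum>b<m. curvature_matrix m e w i j a b * c b) *\<^sub>C e a w)
    = cinner (Dfr (e d) w (axis j 1)) (S - p)"
proof -
  define X where "X a b = (\<Sum>c<m. mat_inv m (gramian e w) a c * cinner (e c w) (Dfr (e b) w (axis i 1)))" for a b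
  define q where "q = (\<Sum>a<m. cnj (\<Sum>b<m. X a b * c b) *\<^sub>C e a w)"
  have sum_eq: "cinner v (\<Sum>a<m. cnj (\<Sum>b<m. L a b * c b) *\<^sub>C e a w)
      = (\<Sum>b<m. c b * (\<Sum>a<m. cinner v (e a w) * L a b))" for v L
  proof -
    have "cinner v (\<Sum>a<m. cnj (\<Sum>b<m. L a b * c b) *\<^sub>C e a w)
        = (\<Sum>a<m. \<Sum>b<m. c b * (cinner v (e a w) * L a b))"
      by (simp add: cinner_sum_right cinner_scaleC_right sum_distrib_left sum_distrib_right
          mult_ac)
    then show ?thesis
      by (subst (asm) sum.swap) (simp add: sum_distrib_left)
  qed
  have S_eq: "cinner v S = (\<Sum>b<m. c b * cinner v (Dfr (e b) w (axis i 1)))" for v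
    by (simp add: S_def cinner_sum_right cinner_scaleC_right)
  have "cinner (e a w) (S - q) = 0" if "a < m" for a
    unfolding q_def cinner_diff_right sum_eq S_eq
    using curvature_matrix_identity(1)[OF e w that] by (simp add: X_def)
  then have "cinner (S - q) x = 0" if "x \<in> E w" for x
    using antihol_frame_orthogonal[OF e w _ that] cinner_eq_zero_commute by blast
  then have pq: "p = q"
    using orthogonal_projection_unique[OF antihol_frame_subspace[OF e w] p(1) _ p(2)]
      antihol_frame_sum_in[OF e w] by (simp add: q_def)
  have "(\<Sum>b<m. c b * (\<Sum>a<m. cinner (e d w) (e a w) * curvature_matrix m e w i j a b))
      = (\<Sum>b<m. c b * cinner (Dfr (e d) w (axis j 1)) (Dfr (e b) w (axis i 1))
        - c b * (\<Sum>a<m. cinner (Dfr (e d) w (axis j 1)) (e a w) * X a b))"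
    by (intro sum.cong refl)
      (simp add: curvature_matrix_identity(2)[OF e w d] X_def right_diff_distrib)
  then show ?thesis
    unfolding pq q_def cinner_diff_right sum_eq S_eq by (simp only: sum_subtractf)
qed

section \<open>Local sections and independence of the frame\<close>

definition local_section where
  "local_section E w s S \<longleftrightarrow> (s has_derivative S) (at w) \<and> (\<exists>V. open V \<and> w \<in> V \<and> (\<forall>z\<in>V. s z \<in> E z))"

lemma local_section_frame:
  assumes e: "antihol_frame E m U e" and w: "w \<in> U"
  shows "local_section E w (\<lambda>z. \<Sum>b<m. c b *\<^sub>C e b z) (\<lambda>v. \<Sum>b<m. c b *\<^sub>C Dfr (e b) w v)"
  unfolding local_section_def
proof (intro conjI exI[of _ U] ballI)
  have "((\<lambda>z. c b *\<^sub>C e b z) has_derivative (\<lambda>v. c b *\<^sub>C Dfr (e b) w v)) (at w)" if "b < m" for b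
    using has_derivative_scaleC[OF has_derivative_const
        antiholomorphic_vecD(1)[OF antihol_frame_antiholomorphic[OF e that] w], of "c b"]
    by simp
  then show "((\<lambda>z. \<Sum>b<m. c b *\<^sub>C e b z) has_derivative (\<lambda>v. \<Sum>b<m. c b *\<^sub>C Dfr (e b) w v)) (at w)"
    by (intro has_derivative_sum) auto
qed (use antihol_frame_open[OF e] w antihol_frame_sum_in[OF e] in auto)

lemma local_section_frame_vector:
  assumes e: "antihol_frame E m U e" and w: "w \<in> U" and d: "d < m"
  shows "local_section E w (e d) (Dfr (e d) w)"
  unfolding local_section_def
  using antiholomorphic_vecD(1)[OF antihol_frame_antiholomorphic[OF e d] w]
    antihol_frame_open[OF e] w antihol_frame_in[OF e _ d] by blast

text \<open>The difference of the sections vanishes at \<open>w\<close>, so its derivative stays in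
  the fibre. Hence the component of the derivative orthogonal to the fibre depends only on the value
  of the section at \<open>w\<close>.\<close>

lemma local_section_derivative_diff:
  fixes s t :: "complex ^ 'n::finite \<Rightarrow> 'h::chilbert_space"
  assumes e: "antihol_frame E m U e" and w: "w \<in> U"
    and s: "local_section E w s S" and t: "local_section E w t T" and eq: "s w = t w"
  shows "S v - T v \<in> E w"
proof -
  obtain V1 V2 where V: "open V1" "w \<in> V1" "\<And>z. z \<in> V1 \<Longrightarrow> s z \<in> E z"
    "open V2" "w \<in> V2" "\<And>z. z \<in> V2 \<Longrightarrow> t z \<in> E z"
    using s t unfolding local_section_def by blast
  show ?thesis
  proof (rule vanishing_section_derivative[OF e w, of "U \<inter> V1 \<inter> V2" "\<lambda>z. s z - t z" "\<lambda>v. S v - T v"])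
    show "s z - t z \<in> E z" if "z \<in> U \<inter> V1 \<inter> V2" for z
      using that V(3,6)[of z] antihol_frame_subspace[OF e, of z] cvec.subspace_diff by blast
    show "((\<lambda>z. s z - t z) has_derivative (\<lambda>v. S v - T v)) (at w)"
      using s t by (intro has_derivative_diff) (auto simp: local_section_def)
  qed (use V antihol_frame_open[OF e] w eq in auto)
qed

text \<open>Here \<open>\<partial>\<bar>\<^sub>i f\<close> is \<open>Dfr f w (axis i 1)\<close> for anti-holomorphic \<open>f\<close>, and \<open>p = P \<partial>\<bar>\<^sub>i s\<close>; so the right-hand
  side is the inner product of two values of the second fundamental form.\<close>

lemma curvature_section:
  fixes e :: "nat \<Rightarrow> complex ^ 'n::finite \<Rightarrow> 'h::chilbert_space"
  assumes e: "antihol_frame E m U e" and w: "w \<in> U"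
    and s: "local_section E w s S" "s w = (\<Sum>b<m. cnj (c b) *\<^sub>C e b w)"
    and p: "p \<in> E w" "\<And>x. x \<in> E w \<Longrightarrow> cinner (S (axis i 1) - p) x = 0"
    and u: "local_section E w u T"
  shows "cinner (u w) (\<Sum>a<m. cnj (\<Sum>b<m. curvature_matrix m e w i j a b * c b) *\<^sub>C e a w)
    = cinner (T (axis j 1)) (S (axis i 1) - p)"
proof -
  note sub = antihol_frame_subspace[OF e w]
  define y where "y = (\<Sum>a<m. cnj (\<Sum>b<m. curvature_matrix m e w i j a b * c b) *\<^sub>C e a w)"
  define S0 where "S0 = (\<Sum>b<m. cnj (c b) *\<^sub>C Dfr (e b) w (axis i 1))"
  have diff: "S (axis i 1) - S0 \<in> E w"
    unfolding S0_def using local_section_derivative_diff[OF e w s(1) local_section_frame[OF e w] s(2)] .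
  \<comment> \<open>Shifting \<open>p\<close> by the difference of the two derivatives, an element
    of the fibre, turns it into the projection of \<open>S0\<close> and leaves the orthogonal
    component unchanged.\<close>
  define p0 where "p0 = p - (S (axis i 1) - S0)"
  have p0: "p0 \<in> E w" "S0 - p0 = S (axis i 1) - p"
    using cvec.subspace_diff[OF sub p(1) diff] by (auto simp: p0_def)
  have ed: "cinner (e d w) y = cinner (Dfr (e d) w (axis j 1)) (S (axis i 1) - p)" if "d < m" for d
    unfolding y_def p0(2)[symmetric] unfolding S0_def
    by (rule curvature_frame[OF e w that p0(1)]) (use p(2) p0(2) in \<open>simp add: S0_def\<close>)
  have uw: "u w \<in> E w"
    using u by (auto simp: local_section_def)
  obtain h where h: "u w = (\<Sum>d<m. h d *\<^sub>C e d w)"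
    using antihol_frame_coordinates[OF e w uw] .
  have "T (axis j 1) - (\<Sum>d<m. h d *\<^sub>C Dfr (e d) w (axis j 1)) \<in> E w"
    using local_section_derivative_diff[OF e w u local_section_frame[OF e w] h] .
  \<comment> \<open>\<open>S (axis i 1) - p\<close> is orthogonal to the fibre, so \<open>u\<close>
    may be replaced by the section with constant coefficients \<open>h\<close>.\<close>
  then have "cinner (T (axis j 1) - (\<Sum>d<m. h d *\<^sub>C Dfr (e d) w (axis j 1))) (S (axis i 1) - p) = 0"
    using p(2) cinner_eq_zero_commute by blast
  then have "cinner (T (axis j 1)) (S (axis i 1) - p)
      = (\<Sum>d<m. h d * cinner (Dfr (e d) w (axis j 1)) (S (axis i 1) - p))"
    by (simp add: cinner_diff_left[of "T _"] cinner_sum_left cinner_scaleC_left)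
  also have "\<dots> = cinner (u w) y"
    by (simp add: h cinner_sum_left cinner_scaleC_left ed)
  finally show ?thesis
    by (simp add: y_def)
qed

lemma curvature_eqI:
  fixes e :: "nat \<Rightarrow> complex ^ 'n::finite \<Rightarrow> 'h::chilbert_space"
  assumes e: "antihol_frame E m U e" and w: "w \<in> U"
    and s: "local_section E w s S"
    and p: "p \<in> E w" "\<And>x. x \<in> E w \<Longrightarrow> cinner (S (axis i 1) - p) x = 0"
    and y: "y \<in> E w"
      "\<And>d. d < m \<Longrightarrow> cinner (e d w) y = cinner (Dfr (e d) w (axis j 1)) (S (axis i 1) - p)"
  shows "curvature E w i j (s w) = y"
proof -
  have unique: "y' = y" if e': "antihol_frame E m' U' e'" "w \<in> U'"
    and c: "s w = (\<Sum>b<m'. cnj (c b) *\<^sub>C e' b w)"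
    and y': "y' = (\<Sum>a<m'. cnj (\<Sum>b<m'. curvature_matrix m' e' w i j a b * c b) *\<^sub>C e' a w)"
    for m' U' e' c y'
  proof -
    have "cinner (e d w) (y' - y) = 0" if "d < m" for d
      using curvature_section[OF e' s c p local_section_frame_vector[OF e w that]] y(2)[OF that]
      by (simp add: y' cinner_diff_right)
    then have "cinner (y' - y) (e d w) = 0" if "d < m" for d
      using that cinner_eq_zero_commute by blast
    moreover have "y' - y \<in> E w"
      unfolding y'
      by (intro cvec.subspace_diff[OF antihol_frame_subspace[OF e w]] antihol_frame_sum_in[OF e'] y(1))
    ultimately have "cinner (y' - y) (y' - y) = 0"
      by (rule antihol_frame_orthogonal[OF e w])
    then show ?thesis
      by simp
  qed
  have sw: "s w \<in> E w"
    using s by (auto simp: local_section_def)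
  obtain c where c: "s w = (\<Sum>b<m. c b *\<^sub>C e b w)"
    using antihol_frame_coordinates[OF e w sw] .
  define c' where "c' b = cnj (c b)" for b
  have c': "s w = (\<Sum>b<m. cnj (c' b) *\<^sub>C e b w)"
    by (simp add: c c'_def)
  show ?thesis
    unfolding curvature_def
  proof (rule the_equality)
    show "\<exists>m U e c. w \<in> U \<and> antihol_frame E m U e \<and> s w = (\<Sum>b<m. cnj (c b) *\<^sub>C e b w) \<and>
        y = (\<Sum>a<m. cnj (\<Sum>b<m. curvature_matrix m e w i j a b * c b) *\<^sub>C e a w)"
      by (rule exI[of _ m], rule exI[of _ U], rule exI[of _ e], rule exI[of _ c'], intro conjI w e c')
        (rule unique[OF e w c' refl, symmetric])
  qed (elim exE conjE, rule unique)
qed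

text \<open>The equations by which \<open>curvature_eqI\<close> recognises a value hold for the
  curvature itself, so it can be evaluated on the two factors of a tensor product.\<close>

lemma curvature_characterization:
  fixes e :: "nat \<Rightarrow> complex ^ 'n::finite \<Rightarrow> 'h::chilbert_space"
  assumes e: "antihol_frame E m U e" and w: "w \<in> U"
    and s: "local_section E w s S"
    and p: "p \<in> E w" "\<And>x. x \<in> E w \<Longrightarrow> cinner (S (axis i 1) - p) x = 0"
  shows "curvature E w i j (s w) \<in> E w"
    and "d < m \<Longrightarrow> cinner (e d w) (curvature E w i j (s w))
      = cinner (Dfr (e d) w (axis j 1)) (S (axis i 1) - p)"
proof -
  have sw: "s w \<in> E w"
    using s by (auto simp: local_section_def)
  obtain c where c: "s w = (\<Sum>b<m. c b *\<^sub>C e b w)"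
    using antihol_frame_coordinates[OF e w sw] .
  define c' where "c' b = cnj (c b)" for b
  have c': "s w = (\<Sum>b<m. cnj (c' b) *\<^sub>C e b w)"
    by (simp add: c c'_def)
  define y where "y = (\<Sum>a<m. cnj (\<Sum>b<m. curvature_matrix m e w i j a b * c' b) *\<^sub>C e a w)"
  have y: "y \<in> E w"
    unfolding y_def by (rule antihol_frame_sum_in[OF e w])
  have ey: "cinner (e d w) y = cinner (Dfr (e d) w (axis j 1)) (S (axis i 1) - p)" if "d < m" for d
    unfolding y_def by (rule curvature_section[OF e w s c' p local_section_frame_vector[OF e w that]])
  have "curvature E w i j (s w) = y"
    by (rule curvature_eqI[OF e w s p y ey])
  then show "curvature E w i j (s w) \<in> E w"
    "d < m \<Longrightarrow> cinner (e d w) (curvature E w i j (s w)) = cinner (Dfr (e d) w (axis j 1)) (S (axis i 1) - p)"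
    using y ey by simp_all
qed

lemma fiber_projection_exists:
  assumes e: "antihol_frame E m U e" and w: "w \<in> U"
  obtains p where "p \<in> E w" "\<And>x. x \<in> E w \<Longrightarrow> cinner (v - p) x = 0"
proof -
  obtain p where p: "p \<in> cvec.span ((\<lambda>a. e a w) ` {..<m})"
    "\<forall>z\<in>cvec.span ((\<lambda>a. e a w) ` {..<m}). cinner (v - p) z = 0"
    using span_projection_exists[OF finite_imageI[OF finite_lessThan]] by blast
  note p' = p[unfolded antihol_frame_span[OF e w]]
  show ?thesis
    by (rule that[OF p'(1)]) (rule bspec[OF p'(2)])
qed

section \<open>Tensor products with a line bundle\<close>

lemma etensor_nth [simp]: "(k \<otimes>\<^sub>e \<eta>) $ a = (\<eta> $ a) *\<^sub>C k"
  by (simp add: etensor_def)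

lemma scaleC_vec_nth [simp]: "(c *\<^sub>C x) $ a = c *\<^sub>C (x $ a)"
  by (simp add: scaleC_vec_def)

lemma scaleC_complex [simp]: "c *\<^sub>C (x :: complex) = c * x"
  by (simp add: scaleC_complex_def)

lemma etensor_add_left: "(k + l) \<otimes>\<^sub>e \<eta> = k \<otimes>\<^sub>e \<eta> + l \<otimes>\<^sub>e \<eta>"
  by (simp add: vec_eq_iff scaleC_right_distrib)

lemma etensor_add_right: "k \<otimes>\<^sub>e (\<eta> + \<theta>) = k \<otimes>\<^sub>e \<eta> + k \<otimes>\<^sub>e \<theta>"
  by (simp add: vec_eq_iff scaleC_left_distrib)

lemma etensor_diff_left: "(k - l) \<otimes>\<^sub>e \<eta> = k \<otimes>\<^sub>e \<eta> - l \<otimes>\<^sub>e \<eta>"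
  by (simp add: vec_eq_iff cvec.scale_right_diff_distrib)

lemma etensor_diff_right: "k \<otimes>\<^sub>e (\<eta> - \<theta>) = k \<otimes>\<^sub>e \<eta> - k \<otimes>\<^sub>e \<theta>"
  by (simp add: vec_eq_iff cvec.scale_left_diff_distrib)

lemma etensor_scaleC_left: "(c *\<^sub>C k) \<otimes>\<^sub>e \<eta> = c *\<^sub>C (k \<otimes>\<^sub>e \<eta>)"
  by (simp add: vec_eq_iff scaleC_scaleC mult.commute)

lemma etensor_scaleC_right: "k \<otimes>\<^sub>e (c *\<^sub>C \<eta>) = c *\<^sub>C (k \<otimes>\<^sub>e \<eta>)"
  by (simp add: vec_eq_iff scaleC_scaleC)

lemma etensor_zero_left [simp]: "0 \<otimes>\<^sub>e \<eta> = 0"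
  by (simp add: vec_eq_iff)

lemma etensor_zero_right [simp]: "k \<otimes>\<^sub>e 0 = 0"
  by (simp add: vec_eq_iff)

lemma etensor_sum_right: "k \<otimes>\<^sub>e (\<Sum>i\<in>I. f i) = (\<Sum>i\<in>I. k \<otimes>\<^sub>e f i)"
  by (induction I rule: infinite_finite_induct) (auto simp: etensor_add_right)

lemma cinner_etensor:
  fixes \<eta> \<theta> :: "complex ^ 'q::finite"
  shows "cinner (k \<otimes>\<^sub>e \<eta>) (l \<otimes>\<^sub>e \<theta>) = cinner k l * cinner \<eta> \<theta>"
  by (simp add: cinner_vec_def cinner_complex_def cinner_scaleC_left cinner_scaleC_right
      sum_distrib_left mult_ac)

lemma norm_etensor: "norm (k \<otimes>\<^sub>e (\<eta> :: complex ^ 'q::finite)) = norm k * norm \<eta>"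
proof -
  have "complex_of_real ((norm (k \<otimes>\<^sub>e \<eta>))\<^sup>2) = of_real ((norm k * norm \<eta>)\<^sup>2)"
    using cinner_etensor[of k \<eta> k \<eta>]
    by (simp only: cinner_self power_mult_distrib of_real_mult)
  then have "(norm (k \<otimes>\<^sub>e \<eta>))\<^sup>2 = (norm k * norm \<eta>)\<^sup>2"
    by (simp only: of_real_eq_iff)
  then show ?thesis
    by (simp add: power2_eq_iff_nonneg)
qed

lemma etensor_eq_0_iff: "k \<otimes>\<^sub>e (\<eta> :: complex ^ 'q::finite) = 0 \<longleftrightarrow> k = 0 \<or> \<eta> = 0"
  using norm_etensor[of k \<eta>] by (metis mult_eq_0_iff norm_eq_zero)

lemma bounded_bilinear_etensor:
  "bounded_bilinear (\<lambda>k (\<eta> :: complex ^ 'q::finite). k \<otimes>\<^sub>e \<eta>)"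
proof
  show "\<exists>K. \<forall>a (b :: complex ^ 'q). norm (a \<otimes>\<^sub>e b) \<le> norm a * norm b * K"
    by (intro exI[of _ 1]) (simp add: norm_etensor)
qed (simp_all add: etensor_add_left etensor_add_right etensor_scaleC_left etensor_scaleC_right
      flip: scaleC_of_real)

lemma antiholomorphic_vec_etensor:
  fixes g :: "'a::complex_inner \<Rightarrow> 'h::chilbert_space" and h :: "'a \<Rightarrow> complex ^ 'q::finite"
  assumes g: "antiholomorphic_vec g U" and h: "antiholomorphic_vec h U"
  shows "antiholomorphic_vec (\<lambda>z. g z \<otimes>\<^sub>e h z) U"
  unfolding antiholomorphic_vec_def
proof
  fix z assume z: "z \<in> U"
  show "\<exists>D. ((\<lambda>z. g z \<otimes>\<^sub>e h z) has_derivative D) (at z) \<and> (\<forall>c v. D (c *\<^sub>C v) = cnj c *\<^sub>C D v)"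
    by (rule exI, rule conjI, rule bounded_bilinear.FDERIV[OF bounded_bilinear_etensor
          antiholomorphic_vecD(1)[OF g z] antiholomorphic_vecD(1)[OF h z]])
      (simp add: antiholomorphic_vecD(2)[OF g z] antiholomorphic_vecD(2)[OF h z]
        etensor_scaleC_left etensor_scaleC_right scaleC_right_distrib)
qed

text \<open>Injectivity belongs to the left-hand side because a repeated vector would be invisible
  in the image set. The coefficient form is the one that passes through tensor products and
  projections.\<close>

lemma independent_family_iff:
  "inj_on f {..<m::nat} \<and> \<not> cvec.dependent (f ` {..<m}) \<longleftrightarrow>
    (\<forall>c. (\<Sum>b<m. c b *\<^sub>C f b) = 0 \<longrightarrow> (\<forall>b<m. c b = 0))"
proof (intro iffI conjI allI impI)
  fix c b
  assume ind: "inj_on f {..<m} \<and> \<not> cvec.dependent (f ` {..<m})"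
    and c: "(\<Sum>b<m. c b *\<^sub>C f b) = 0" and b: "b < m"
  define u where "u v = c (the_inv_into {..<m} f v)" for v
  have u: "u (f a) = c a" if "a < m" for a
    using ind that by (simp add: u_def the_inv_into_f_f)
  have "(\<Sum>v\<in>f ` {..<m}. u v *\<^sub>C v) = 0"
    using ind c by (simp add: sum.reindex u)
  then have "u (f b) = 0"
    using ind b cvec.dependent_finite[of "f ` {..<m}"] by blast
  then show "c b = 0"
    using u b by simp
next
  assume *: "\<forall>c. (\<Sum>b<m. c b *\<^sub>C f b) = 0 \<longrightarrow> (\<forall>b<m. c b = 0)"
  show inj: "inj_on f {..<m}"
  proof (rule inj_onI, rule ccontr)
    fix a b assume ab: "a \<in> {..<m}" "b \<in> {..<m}" "f a = f b" "a \<noteq> b"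
    have "(\<Sum>i<m. ((if i = a then 1 else 0) - (if i = b then 1 else 0)) *\<^sub>C f i)
        = (\<Sum>i<m. if i = a then f i else 0) - (\<Sum>i<m. if i = b then f i else 0)"
      unfolding sum_subtractf[symmetric] by (intro sum.cong) auto
    also have "\<dots> = 0"
      using ab by simp
    finally show False
      using *[rule_format, of "\<lambda>i. (if i = a then 1 else 0) - (if i = b then 1 else 0)" a] ab
      by auto
  qed
  show "\<not> cvec.dependent (f ` {..<m})"
  proof
    assume "cvec.dependent (f ` {..<m})"
    then obtain u where u: "\<exists>v\<in>f ` {..<m}. u v \<noteq> 0" "(\<Sum>v\<in>f ` {..<m}. u v *\<^sub>C v) = 0"
      using cvec.dependent_finite[of "f ` {..<m}"] by auto
    then have "(\<Sum>b<m. u (f b) *\<^sub>C f b) = 0"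
      using inj by (simp add: sum.reindex)
    then have "\<forall>b<m. u (f b) = 0"
      using *[rule_format, of "\<lambda>b. u (f b)"] by blast
    then show False
      using u by auto
  qed
qed

lemma antihol_frame_iff:
  "antihol_frame E m U e \<longleftrightarrow> open U \<and> (\<forall>a<m. antiholomorphic_vec (e a) U) \<and>
    (\<forall>z\<in>U. (\<forall>c. (\<Sum>b<m. c b *\<^sub>C e b z) = 0 \<longrightarrow> (\<forall>b<m. c b = 0)) \<and>
      cvec.span ((\<lambda>a. e a z) ` {..<m}) = E z)"
  unfolding antihol_frame_def independent_family_iff[symmetric] by blast

text \<open>The first bundle is a line bundle, so every elementary tensor equals
  \<open>\<gamma> z\<close> tensored with some vector of the second fibre, and the rank stays
  \<open>m\<close>.\<close>

lemma antihol_frame_etensor: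
  fixes \<gamma> :: "complex ^ 'n::finite \<Rightarrow> 'h::chilbert_space" and e :: "nat \<Rightarrow> complex ^ 'n \<Rightarrow> complex ^ 'q::finite"
  assumes g: "antihol_frame E1 1 U1 (\<lambda>_. \<gamma>)" and e: "antihol_frame E2 m U2 e"
    and E: "\<And>z. z \<in> U1 \<inter> U2 \<Longrightarrow> E z = cvec.span {k \<otimes>\<^sub>e \<eta> | k \<eta>. k \<in> E1 z \<and> \<eta> \<in> E2 z}"
  shows "antihol_frame E m (U1 \<inter> U2) (\<lambda>a z. \<gamma> z \<otimes>\<^sub>e e a z)"
  unfolding antihol_frame_iff
proof (intro conjI ballI allI impI)
  show "open (U1 \<inter> U2)"
    using antihol_frame_open[OF g] antihol_frame_open[OF e] by auto
  show "antiholomorphic_vec (\<lambda>z. \<gamma> z \<otimes>\<^sub>e e a z) (U1 \<inter> U2)" if "a < m" for a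
    using antihol_frame_antiholomorphic[OF g, of 0] antihol_frame_antiholomorphic[OF e that]
    by (intro antiholomorphic_vec_etensor) (auto intro: antiholomorphic_vec_subset)
next
  fix z assume z: "z \<in> U1 \<inter> U2"
  have g_iff: "c *\<^sub>C \<gamma> z = 0 \<longrightarrow> c = 0" for c
    using g z unfolding antihol_frame_iff by (auto dest!: bspec spec[of _ "\<lambda>_. c"])
  then have g0: "\<gamma> z \<noteq> 0"
    using g_iff[of 1] by auto
  have sum_eq: "(\<Sum>b<m. c b *\<^sub>C (\<gamma> z \<otimes>\<^sub>e e b z)) = \<gamma> z \<otimes>\<^sub>e (\<Sum>b<m. c b *\<^sub>C e b z)" for c
    by (simp add: etensor_sum_right etensor_scaleC_right)
  show "c b = 0" if "(\<Sum>b<m. c b *\<^sub>C (\<gamma> z \<otimes>\<^sub>e e b z)) = 0" "b < m" for c b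
  proof -
    have "(\<Sum>b<m. c b *\<^sub>C e b z) = 0"
      using that g0 by (simp add: sum_eq etensor_eq_0_iff)
    then show ?thesis
      using e z that(2) unfolding antihol_frame_iff by blast
  qed
  have gz: "z \<in> U1" "z \<in> U2"
    using z by auto
  show "cvec.span ((\<lambda>a. \<gamma> z \<otimes>\<^sub>e e a z) ` {..<m}) = E z"
    unfolding E[OF z]
  proof (intro equalityI cvec.span_minimal cvec.subspace_span subsetI)
    fix x assume "x \<in> (\<lambda>a. \<gamma> z \<otimes>\<^sub>e e a z) ` {..<m}"
    then show "x \<in> cvec.span {k \<otimes>\<^sub>e \<eta> | k \<eta>. k \<in> E1 z \<and> \<eta> \<in> E2 z}"
      using antihol_frame_in[OF g gz(1), of 0] antihol_frame_in[OF e gz(2)]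
      by (intro cvec.span_base) auto
  next
    fix x assume "x \<in> {k \<otimes>\<^sub>e \<eta> | k \<eta>. k \<in> E1 z \<and> \<eta> \<in> E2 z}"
    then obtain k \<eta> where x: "x = k \<otimes>\<^sub>e \<eta>" "k \<in> E1 z" "\<eta> \<in> E2 z"
      by blast
    obtain c where "k = (\<Sum>a<1::nat. c a *\<^sub>C \<gamma> z)"
      using antihol_frame_coordinates[OF g gz(1) x(2)] .
    moreover obtain h where "\<eta> = (\<Sum>a<m. h a *\<^sub>C e a z)"
      using antihol_frame_coordinates[OF e gz(2) x(3)] .
    ultimately have x': "x = c 0 *\<^sub>C (\<Sum>b<m. h b *\<^sub>C (\<gamma> z \<otimes>\<^sub>e e b z))"
      by (simp add: x(1) etensor_scaleC_left sum_eq)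
    show "x \<in> cvec.span ((\<lambda>a. \<gamma> z \<otimes>\<^sub>e e a z) ` {..<m})"
      unfolding x' by (intro cvec.span_scale sum_in_span[of h "\<lambda>a. \<gamma> z \<otimes>\<^sub>e e a z"])
  qed
qed

lemma curvature_etensor:
  fixes \<gamma> :: "complex ^ 'n::finite \<Rightarrow> 'h::chilbert_space" and e :: "nat \<Rightarrow> complex ^ 'n \<Rightarrow> complex ^ 'q::finite"
  assumes g: "antihol_frame E1 1 U1 (\<lambda>_. \<gamma>)" and e: "antihol_frame E2 m U2 e"
    and w: "w \<in> U1 \<inter> U2"
    and E: "\<And>z. z \<in> U1 \<inter> U2 \<Longrightarrow> E z = cvec.span {k \<otimes>\<^sub>e \<eta> | k \<eta>. k \<in> E1 z \<and> \<eta> \<in> E2 z}"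
    and k: "k \<in> E1 w" and \<eta>: "\<eta> \<in> E2 w"
  shows "curvature E w i j (k \<otimes>\<^sub>e \<eta>)
    = curvature E1 w i j k \<otimes>\<^sub>e \<eta> + k \<otimes>\<^sub>e curvature E2 w i j \<eta>"
proof -
  have w1: "w \<in> U1" and w2: "w \<in> U2"
    using w by auto
  note fr = antihol_frame_etensor[OF g e E]
  have in_E: "a \<otimes>\<^sub>e b \<in> E z" if "z \<in> U1 \<inter> U2" "a \<in> E1 z" "b \<in> E2 z" for a b z
    using that by (subst E) (auto intro!: cvec.span_base)
  obtain c where c: "k = (\<Sum>a<1::nat. c a *\<^sub>C \<gamma> w)"
    using antihol_frame_coordinates[OF g w1 k] .
  obtain h where h: "\<eta> = (\<Sum>a<m. h a *\<^sub>C e a w)"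
    using antihol_frame_coordinates[OF e w2 \<eta>] .
  define s S where "s z = (\<Sum>a<1::nat. c a *\<^sub>C \<gamma> z)" and "S v = (\<Sum>a<1::nat. c a *\<^sub>C Dfr \<gamma> w v)" for z v
  define t T where "t z = (\<Sum>a<m. h a *\<^sub>C e a z)" and "T v = (\<Sum>a<m. h a *\<^sub>C Dfr (e a) w v)" for z v
  have s: "local_section E1 w s S" and t: "local_section E2 w t T"
    unfolding s_def S_def t_def T_def
    by (rule local_section_frame[OF g w1] local_section_frame[OF e w2])+
  have sw: "s w = k" and tw: "t w = \<eta>"
    using c h by (simp_all add: s_def t_def)
  define R where "R v = k \<otimes>\<^sub>e T v + S v \<otimes>\<^sub>e \<eta>" for v
  have st: "local_section E w (\<lambda>z. s z \<otimes>\<^sub>e t z) R"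
    unfolding local_section_def
  proof (intro conjI exI[of _ "U1 \<inter> U2"] ballI)
    show "((\<lambda>z. s z \<otimes>\<^sub>e t z) has_derivative R) (at w)"
      using bounded_bilinear.FDERIV[OF bounded_bilinear_etensor, of s S w UNIV t T] s t
      unfolding local_section_def R_def[abs_def] sw tw by blast
    show "s z \<otimes>\<^sub>e t z \<in> E z" if "z \<in> U1 \<inter> U2" for z
      using that antihol_frame_sum_in[OF g, of z c] antihol_frame_sum_in[OF e, of z h]
      by (intro in_E) (auto simp: s_def t_def)
  qed (use w antihol_frame_open[OF fr] in auto)
  obtain p1 where p1: "p1 \<in> E1 w" "\<And>x. x \<in> E1 w \<Longrightarrow> cinner (S (axis i 1) - p1) x = 0"
    using fiber_projection_exists[OF g w1, of "S (axis i 1)"] by metis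
  obtain p2 where p2: "p2 \<in> E2 w" "\<And>x. x \<in> E2 w \<Longrightarrow> cinner (T (axis i 1) - p2) x = 0"
    using fiber_projection_exists[OF e w2, of "T (axis i 1)"] by metis
  \<comment> \<open>The projection of \<open>R (axis i 1)\<close>: by \<open>p_eq\<close> the
    difference is a sum of two tensors, each with one factor orthogonal to the corresponding
    fibre.\<close>
  define p where "p = p1 \<otimes>\<^sub>e \<eta> + k \<otimes>\<^sub>e p2"
  have p_eq: "R (axis i 1) - p = (S (axis i 1) - p1) \<otimes>\<^sub>e \<eta> + k \<otimes>\<^sub>e (T (axis i 1) - p2)"
    by (simp add: R_def p_def etensor_diff_left etensor_diff_right)
  have y1: "curvature E1 w i j k \<in> E1 w"
    "cinner (\<gamma> w) (curvature E1 w i j k) = cinner (Dfr \<gamma> w (axis j 1)) (S (axis i 1) - p1)"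
    unfolding sw[symmetric]
    using curvature_characterization(1)[OF g w1 s p1(1) p1(2)]
      curvature_characterization(2)[OF g w1 s p1(1) p1(2), where d = 0] by simp_all
  have y2: "curvature E2 w i j \<eta> \<in> E2 w"
    "\<And>d. d < m \<Longrightarrow> cinner (e d w) (curvature E2 w i j \<eta>)
      = cinner (Dfr (e d) w (axis j 1)) (T (axis i 1) - p2)"
    unfolding tw[symmetric]
    using curvature_characterization[OF e w2 t p2(1) p2(2)] by simp_all
  have gw: "\<gamma> w \<in> E1 w"
    using antihol_frame_in[OF g w1, of 0] by simp
  have ew: "e d w \<in> E2 w" if "d < m" for d
    using antihol_frame_in[OF e w2 that] .
  have sub: "cvec.subspace (E w)"
    using antihol_frame_subspace[OF fr w] .
  have orth: "cinner (R (axis i 1) - p) x = 0" if "x \<in> E w" for x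
  proof (rule orthogonal_span)
    show "x \<in> cvec.span {a \<otimes>\<^sub>e b | a b. a \<in> E1 w \<and> b \<in> E2 w}"
      using that E[OF w] by simp
    fix y assume "y \<in> {a \<otimes>\<^sub>e b | a b. a \<in> E1 w \<and> b \<in> E2 w}"
    then obtain a b where "y = a \<otimes>\<^sub>e b" "a \<in> E1 w" "b \<in> E2 w"
      by blast
    then show "cinner (R (axis i 1) - p) y = 0"
      by (simp add: p_eq cinner_add_left cinner_etensor p1(2) p2(2))
  qed
  have "curvature E w i j (s w \<otimes>\<^sub>e t w)
      = curvature E1 w i j k \<otimes>\<^sub>e \<eta> + k \<otimes>\<^sub>e curvature E2 w i j \<eta>"
  proof (rule curvature_eqI[OF fr w st _ orth])
    show "p \<in> E w"
      unfolding p_def using p1(1) p2(1) k \<eta> w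
      by (intro cvec.subspace_add[OF sub] in_E) auto
    show "curvature E1 w i j k \<otimes>\<^sub>e \<eta> + k \<otimes>\<^sub>e curvature E2 w i j \<eta> \<in> E w"
      using y1(1) y2(1) k \<eta> w by (intro cvec.subspace_add[OF sub] in_E) auto
    fix d assume d: "d < m"
    define D where "D = Dfr (\<lambda>z. \<gamma> z \<otimes>\<^sub>e e d z) w"
    have "((\<lambda>z. \<gamma> z \<otimes>\<^sub>e e d z) has_derivative (\<lambda>v. \<gamma> w \<otimes>\<^sub>e Dfr (e d) w v + Dfr \<gamma> w v \<otimes>\<^sub>e e d w)) (at w)"
      using antiholomorphic_vecD(1)[OF antihol_frame_antiholomorphic[OF g, of 0] w1]
        antiholomorphic_vecD(1)[OF antihol_frame_antiholomorphic[OF e d] w2]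
      by (intro bounded_bilinear.FDERIV[OF bounded_bilinear_etensor]) auto
    then have D: "D v = \<gamma> w \<otimes>\<^sub>e Dfr (e d) w v + Dfr \<gamma> w v \<otimes>\<^sub>e e d w" for v
      unfolding D_def by (rule fun_cong[OF frechet_derivative_at, symmetric])
    \<comment> \<open>These two orthogonality relations remove the mixed terms when the product of
      the two sums is expanded.\<close>
    have z1: "cinner (\<gamma> w) (S (axis i 1) - p1) = 0"
      using p1(2)[OF gw] cinner_eq_zero_commute by blast
    have z2: "cinner (e d w) (T (axis i 1) - p2) = 0"
      using p2(2)[OF ew[OF d]] cinner_eq_zero_commute by blast
    have "cinner (D (axis j 1)) (R (axis i 1) - p)
        = cinner (Dfr \<gamma> w (axis j 1)) (S (axis i 1) - p1) * cinner (e d w) \<eta>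
        + cinner (\<gamma> w) k * cinner (Dfr (e d) w (axis j 1)) (T (axis i 1) - p2)"
      by (simp add: D p_eq cinner_add_left cinner_add_right cinner_etensor z1 z2)
    also have "\<dots> = cinner (\<gamma> w \<otimes>\<^sub>e e d w) (curvature E1 w i j k \<otimes>\<^sub>e \<eta> + k \<otimes>\<^sub>e curvature E2 w i j \<eta>)"
      using y1(2) y2(2)[OF d] by (simp add: cinner_add_right cinner_etensor)
    finally show "cinner (\<gamma> w \<otimes>\<^sub>e e d w) (curvature E1 w i j k \<otimes>\<^sub>e \<eta> + k \<otimes>\<^sub>e curvature E2 w i j \<eta>)
        = cinner (Dfr (\<lambda>z. \<gamma> z \<otimes>\<^sub>e e d z) w (axis j 1)) (R (axis i 1) - p)"
      by (simp add: D_def)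
  qed
  then show ?thesis
    by (simp add: sw tw)
qed

section \<open>Fibres of the canonical model\<close>

lemma real_subspace: "cvec.subspace V \<Longrightarrow> subspace V"
  unfolding cvec.subspace_def subspace_def by (metis scaleC_of_real)

lemma bounded_op_onD:
  assumes "bounded_op_on V W T"
  shows "x \<in> V \<Longrightarrow> T x \<in> W" "x \<in> V \<Longrightarrow> y \<in> V \<Longrightarrow> T (x + y) = T x + T y"
    "x \<in> V \<Longrightarrow> T (c *\<^sub>C x) = c *\<^sub>C T x"
  using assms by (auto simp: bounded_op_on_def)

lemma bounded_op_on_bound:
  assumes "bounded_op_on V W T"
  shows "\<exists>B\<ge>0. \<forall>x\<in>V. norm (T x) \<le> B * norm x"
proof -
  obtain B where B: "\<forall>x\<in>V. norm (T x) \<le> B * norm x"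
    using assms unfolding bounded_op_on_def by blast
  have "norm (T x) \<le> \<bar>B\<bar> * norm x" if "x \<in> V" for x
    using bspec[OF B that] mult_right_mono[OF abs_ge_self[of B] norm_ge_zero[of x]] by linarith
  then show ?thesis
    by (intro exI[of _ "\<bar>B\<bar>"]) simp
qed

lemma bounded_op_on_shift:
  assumes V: "cvec.subspace V" and T: "bounded_op_on V V T"
  shows "bounded_op_on V V (\<lambda>x. T x - c *\<^sub>C x)"
proof -
  obtain B where B: "0 \<le> B" "\<And>x. x \<in> V \<Longrightarrow> norm (T x) \<le> B * norm x"
    using bounded_op_on_bound[OF T] by blast
  have "norm (T x - c *\<^sub>C x) \<le> (B + cmod c) * norm x" if "x \<in> V" for x
    using norm_triangle_ineq4[of "T x" "c *\<^sub>C x"] B(2)[OF that] by (simp add: norm_scaleC distrib_right)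
  then have "\<exists>B. \<forall>x\<in>V. norm (T x - c *\<^sub>C x) \<le> B * norm x"
    by blast
  moreover have "T x - c *\<^sub>C x \<in> V" if "x \<in> V" for x
    using bounded_op_onD(1)[OF T that] that by (intro cvec.subspace_diff[OF V] cvec.subspace_scale[OF V])
  ultimately show ?thesis
    unfolding bounded_op_on_def using bounded_op_onD(2,3)[OF T]
    by (auto simp: scaleC_right_distrib cvec.scale_right_diff_distrib scaleC_scaleC mult.commute)
qed

lemma norm_vec_le_sum: "norm x \<le> (\<Sum>i\<in>UNIV. norm (x $ i))"
  unfolding norm_vec_def by (rule L2_set_le_sum) simp

lemma cinner_axis_left: "cinner (axis a h) x = cinner h (x $ a)"
proof -
  have "cinner (axis a h) x = (\<Sum>i\<in>UNIV. if i = a then cinner h (x $ a) else 0)"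
    unfolding cinner_vec_def by (intro sum.cong) (auto simp: axis_def)
  then show ?thesis
    by simp
qed

lemma shifted_adj_properties:
  fixes w :: "complex ^ 'n::finite"
  assumes H: "cvec.subspace (carrier H)" "closed (carrier H)"
    "bounded_op_on (carrier H) (carrier H) (mult H i)"
  shows "shifted_adj H w i y \<in> carrier H"
    and "x \<in> carrier H \<Longrightarrow> cinner (mult H i x - (w $ i) *\<^sub>C x) y = cinner x (shifted_adj H w i y)"
  unfolding shifted_adj_def
  using adj_on_properties[OF H(1,2) bounded_op_on_shift[OF H(1,3)]] by auto

lemma shifted_adj_eqI:
  fixes w :: "complex ^ 'n::finite"
  assumes H: "cvec.subspace (carrier H)" "closed (carrier H)"
    "bounded_op_on (carrier H) (carrier H) (mult H i)"
    and "z \<in> carrier H" "\<And>x. x \<in> carrier H \<Longrightarrow> cinner (mult H i x - (w $ i) *\<^sub>C x) y = cinner x z"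
  shows "shifted_adj H w i y = z"
  unfolding shifted_adj_def
  using adj_on_eqI[OF H(1,2) bounded_op_on_shift[OF H(1,3)] assms(4,5)] .

text \<open>The kernel of an adjoint is the orthogonal complement of the range. In this form the
  fibres of a module, its tensor power and its quotients can be compared without computing
  adjoints.\<close>

lemma eigen_fiber_iff:
  fixes w :: "complex ^ 'n::finite"
  assumes H: "cvec.subspace (carrier H)" "closed (carrier H)"
    "\<And>i. bounded_op_on (carrier H) (carrier H) (mult H i)"
  shows "h \<in> eigen_fiber H w \<longleftrightarrow>
    h \<in> carrier H \<and> (\<forall>i. \<forall>x\<in>carrier H. cinner (mult H i x - (w $ i) *\<^sub>C x) h = 0)"
proof -
  have "shifted_adj H w i h = 0 \<longleftrightarrow> (\<forall>x\<in>carrier H. cinner (mult H i x - (w $ i) *\<^sub>C x) h = 0)" for i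
  proof
    assume "shifted_adj H w i h = 0"
    then show "\<forall>x\<in>carrier H. cinner (mult H i x - (w $ i) *\<^sub>C x) h = 0"
      using shifted_adj_properties(2)[OF H] by simp
  next
    assume "\<forall>x\<in>carrier H. cinner (mult H i x - (w $ i) *\<^sub>C x) h = 0"
    then show "shifted_adj H w i h = 0"
      by (intro shifted_adj_eqI[OF H]) (simp_all add: cvec.subspace_0[OF H(1)])
  qed
  then show ?thesis
    by (simp add: eigen_fiber_def)
qed

lemma subspace_eigen_fiber:
  assumes H: "cvec.subspace (carrier H)" "closed (carrier H)"
    "\<And>i. bounded_op_on (carrier H) (carrier H) (mult H i)"
  shows "cvec.subspace (eigen_fiber H w)"
  unfolding cvec.subspace_def
  using cvec.subspace_0[OF H(1)] cvec.subspace_add[OF H(1)] cvec.subspace_scale[OF H(1)]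
  by (auto simp: eigen_fiber_iff[OF H] cinner_add_right cinner_scaleC_right)

lemma hilbert_moduleD:
  assumes "hilbert_module H"
  shows "cvec.subspace (carrier H)" "closed (carrier H)"
    "bounded_op_on (carrier H) (carrier H) (mult H i)"
  using assms by (auto simp: hilbert_module_def hilbert_subspace_def)

lemma tensor_mod_simps:
  "x \<in> carrier (tensor_mod H) \<longleftrightarrow> (\<forall>a. x $ a \<in> carrier H)"
  "mult (tensor_mod H) i x $ a = mult H i (x $ a)"
  by (simp_all add: tensor_mod_def)

lemma tensor_mod_module:
  fixes H :: "('n::finite, 'h::chilbert_space) hmod"
  assumes H: "cvec.subspace (carrier H)" "closed (carrier H)"
    "\<And>i. bounded_op_on (carrier H) (carrier H) (mult H i)"
  defines "HT \<equiv> tensor_mod H :: ('n, 'h ^ 'q::finite) hmod"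
  shows "cvec.subspace (carrier HT)" "closed (carrier HT)"
    "bounded_op_on (carrier HT) (carrier HT) (mult HT i)"
proof -
  show sub: "cvec.subspace (carrier HT)"
    unfolding cvec.subspace_def HT_def
    using cvec.subspace_0[OF H(1)] cvec.subspace_add[OF H(1)] cvec.subspace_scale[OF H(1)]
    by (simp add: tensor_mod_simps)
  have "carrier HT = (\<Inter>a. (\<lambda>x. x $ a) -` carrier H)"
    by (auto simp: HT_def tensor_mod_simps)
  moreover have "closed ((\<lambda>x :: 'h ^ 'q. x $ a) -` carrier H)" for a
    by (intro closed_vimage H continuous_intros)
  ultimately show "closed (carrier HT)"
    by auto
  obtain B where B: "0 \<le> B" "\<And>x. x \<in> carrier H \<Longrightarrow> norm (mult H i x) \<le> B * norm x"
    using bounded_op_on_bound[OF H(3)[of i]] by blast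
  have "norm (mult HT i x) \<le> (of_nat CARD('q) * B) * norm x" if x: "x \<in> carrier HT" for x
  proof -
    have "norm (mult HT i x) \<le> (\<Sum>a\<in>UNIV. norm (mult HT i x $ a))"
      by (rule norm_vec_le_sum)
    also have "\<dots> \<le> (\<Sum>a\<in>(UNIV :: 'q set). B * norm x)"
    proof (rule sum_mono)
      fix a
      have "norm (mult HT i x $ a) \<le> B * norm (x $ a)"
        using B(2) x by (simp add: HT_def tensor_mod_simps)
      also have "\<dots> \<le> B * norm x"
        by (intro mult_left_mono B Finite_Cartesian_Product.norm_nth_le)
      finally show "norm (mult HT i x $ a) \<le> B * norm x" .
    qed
    finally show ?thesis
      by simp
  qed
  then have "\<exists>B. \<forall>x\<in>carrier HT. norm (mult HT i x) \<le> B * norm x"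
    by blast
  then show "bounded_op_on (carrier HT) (carrier HT) (mult HT i)"
    unfolding bounded_op_on_def using bounded_op_onD[OF H(3)[of i]]
    by (auto simp: HT_def tensor_mod_simps vec_eq_iff)
qed

lemma ortho_proj_eqI:
  fixes V :: "'h::chilbert_space set"
  assumes "cvec.subspace V" "closed V" "p \<in> V" "\<And>z. z \<in> V \<Longrightarrow> cinner (x - p) z = 0"
  shows "ortho_proj V x = p"
  using orthogonal_projection_unique[OF assms(1) ortho_proj(1)[OF assms(1,2)] assms(3)
      ortho_proj(2)[OF assms(1,2)] assms(4)] .

lemma norm_ortho_proj_le:
  fixes V :: "'h::chilbert_space set"
  assumes "cvec.subspace V" "closed V"
  shows "norm (ortho_proj V x) \<le> norm x"
proof -
  define p where "p = ortho_proj V x"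
  have "cinner (x - p) p = 0"
    unfolding p_def using ortho_proj[OF assms] by blast
  then have "cinner p p = cinner x p"
    by (simp add: cinner_diff_left)
  then have "norm p * norm p = cmod (cinner x p)"
    using arg_cong[OF cinner_self[of p], of cmod] by (simp add: norm_mult power2_eq_square)
  also have "\<dots> \<le> norm p * norm x"
    using norm_cinner_le[of x p] by (simp add: mult.commute)
  finally show ?thesis
    unfolding p_def by (intro norm_le_of_square_le) auto
qed

lemma quotient_mod_module:
  fixes H :: "('n::finite, 'h::chilbert_space) hmod" and S :: "'h set"
  assumes H: "cvec.subspace (carrier H)" "closed (carrier H)"
    "\<And>i. bounded_op_on (carrier H) (carrier H) (mult H i)"
  defines "Q \<equiv> quotient_mod H S"
  shows "cvec.subspace (carrier Q)" "closed (carrier Q)"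
    "bounded_op_on (carrier Q) (carrier Q) (mult Q i)"
proof -
  have carr: "carrier Q = carrier H \<inter> {h. \<forall>s\<in>S. cinner h s = 0}"
    by (auto simp: Q_def quotient_mod_def orth_compl_in_def)
  show sub: "cvec.subspace (carrier Q)"
    unfolding carr by (intro cvec.subspace_inter[OF H(1)] subspace_orthogonal)
  show cl: "closed (carrier Q)"
    unfolding carr by (intro closed_Int H(2) closed_orthogonal)
  have m: "mult Q i x = ortho_proj (carrier Q) (mult H i x)" for x
    by (simp add: Q_def quotient_mod_def)
  note P = ortho_proj[OF sub cl]
  obtain B where B: "0 \<le> B" "\<And>x. x \<in> carrier H \<Longrightarrow> norm (mult H i x) \<le> B * norm x"
    using bounded_op_on_bound[OF H(3)[of i]] by blast
  have in_H: "x \<in> carrier H" if "x \<in> carrier Q" for x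
    using that by (simp add: carr)
  show "bounded_op_on (carrier Q) (carrier Q) (mult Q i)"
    unfolding bounded_op_on_def m
  proof (intro conjI ballI allI exI[of _ B])
    fix x y c assume x: "x \<in> carrier Q"
    show "ortho_proj (carrier Q) (mult H i x) \<in> carrier Q"
      by (rule P)
    show "norm (ortho_proj (carrier Q) (mult H i x)) \<le> B * norm x"
      using norm_ortho_proj_le[OF sub cl, of "mult H i x"] B(2)[OF in_H[OF x]] by linarith
    show "ortho_proj (carrier Q) (mult H i (c *\<^sub>C x)) = c *\<^sub>C ortho_proj (carrier Q) (mult H i x)"
    proof (rule ortho_proj_eqI[OF sub cl])
      show "cinner (mult H i (c *\<^sub>C x) - c *\<^sub>C ortho_proj (carrier Q) (mult H i x)) z = 0"
        if "z \<in> carrier Q" for z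
        using P(2)[OF that, of "mult H i x"]
        by (simp add: bounded_op_onD(3)[OF H(3) in_H[OF x]] cinner_scaleC_left
            flip: cvec.scale_right_diff_distrib)
    qed (intro cvec.subspace_scale[OF sub] P)
    assume y: "y \<in> carrier Q"
    show "ortho_proj (carrier Q) (mult H i (x + y))
        = ortho_proj (carrier Q) (mult H i x) + ortho_proj (carrier Q) (mult H i y)"
    proof (rule ortho_proj_eqI[OF sub cl])
      show "cinner (mult H i (x + y)
          - (ortho_proj (carrier Q) (mult H i x) + ortho_proj (carrier Q) (mult H i y))) z = 0"
        if "z \<in> carrier Q" for z
        using P(2)[OF that, of "mult H i x"] P(2)[OF that, of "mult H i y"]
        by (simp add: bounded_op_onD(2)[OF H(3) in_H[OF x] in_H[OF y]] cinner_diff_left cinner_add_left)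
    qed (intro cvec.subspace_add[OF sub] P)
  qed
qed

text \<open>Testing orthogonality to the range on vectors \<open>axis a y\<close>, supported in one
  coordinate, isolates the coordinate \<open>x $ a\<close>.\<close>

lemma eigen_fiber_tensor_mod:
  fixes H :: "('n::finite, 'h::chilbert_space) hmod" and x :: "'h ^ 'q::finite"
  assumes H: "cvec.subspace (carrier H)" "closed (carrier H)"
    "\<And>i. bounded_op_on (carrier H) (carrier H) (mult H i)"
  shows "x \<in> eigen_fiber (tensor_mod H) w \<longleftrightarrow> (\<forall>a. x $ a \<in> eigen_fiber H w)"
proof
  assume x: "x \<in> eigen_fiber (tensor_mod H) w"
  then have xc: "x $ a \<in> carrier H" for a
    by (auto simp: eigen_fiber_def tensor_mod_simps)
  have "cinner (mult H i y - (w $ i) *\<^sub>C y) (x $ a) = 0" if y: "y \<in> carrier H" for i a y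
  proof -
    have y0: "mult H i 0 = 0"
      using bounded_op_onD(3)[OF H(3)[of i] y, of 0] by simp
    have "axis a y \<in> carrier (tensor_mod H)"
      using y cvec.subspace_0[OF H(1)] by (simp add: tensor_mod_simps axis_def)
    then have "cinner (mult (tensor_mod H) i (axis a y) - (w $ i) *\<^sub>C axis a y) x = 0"
      using x eigen_fiber_iff[OF tensor_mod_module[OF H]] by blast
    moreover have "mult (tensor_mod H) i (axis a y) - (w $ i) *\<^sub>C axis a y
        = axis a (mult H i y - (w $ i) *\<^sub>C y)"
      by (simp add: vec_eq_iff tensor_mod_simps axis_def y0)
    ultimately show ?thesis
      by (simp add: cinner_axis_left)
  qed
  then show "\<forall>a. x $ a \<in> eigen_fiber H w"
    using xc by (simp add: eigen_fiber_iff[OF H])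
next
  assume "\<forall>a. x $ a \<in> eigen_fiber H w"
  then show "x \<in> eigen_fiber (tensor_mod H) w"
    by (simp add: eigen_fiber_iff[OF H] eigen_fiber_iff[OF tensor_mod_module[OF H]]
        tensor_mod_simps cinner_vec_def)
qed

text \<open>For \<open>x\<close> in the fibre of the quotient, the adjoint vector \<open>(M\<^sub>i - w\<^sub>i)\<^sup>* x\<close> is orthogonal to
  the submodule \<open>S\<close>; hence it suffices to test \<open>x\<close> on \<open>S\<^sup>\<bottom>\<close>.\<close>

lemma eigen_fiber_quotient_mod:
  fixes H :: "('n::finite, 'h::chilbert_space) hmod"
  assumes H: "cvec.subspace (carrier H)" "closed (carrier H)"
    "\<And>i. bounded_op_on (carrier H) (carrier H) (mult H i)"
    and S: "S \<subseteq> carrier H" "\<And>i c s. s \<in> S \<Longrightarrow> mult H i s - c *\<^sub>C s \<in> S"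
  shows "x \<in> eigen_fiber (quotient_mod H S) w \<longleftrightarrow>
    x \<in> eigen_fiber H w \<and> (\<forall>s\<in>S. cinner x s = 0)"
proof -
  define W where "W = orth_compl_in (carrier H) S"
  have Wc: "carrier (quotient_mod H S) = W"
    and Wm: "mult (quotient_mod H S) i y = ortho_proj W (mult H i y)" for i y
    by (simp_all add: quotient_mod_def W_def)
  have W_iff: "y \<in> W \<longleftrightarrow> y \<in> carrier H \<and> (\<forall>s\<in>S. cinner y s = 0)" for y
    by (simp add: W_def orth_compl_in_def)
  note Q = quotient_mod_module[OF H, of S, unfolded Wc]
  note P = ortho_proj[OF Q(1,2)]
  have "x \<in> eigen_fiber (quotient_mod H S) w \<longleftrightarrow>
      x \<in> W \<and> (\<forall>i. \<forall>y\<in>W. cinner (ortho_proj W (mult H i y) - (w $ i) *\<^sub>C y) x = 0)"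
    using eigen_fiber_iff[OF quotient_mod_module[OF H], of x S w] by (simp add: Wc Wm)
  also have "\<dots> \<longleftrightarrow> x \<in> W \<and> (\<forall>i. \<forall>y\<in>W. cinner (mult H i y - (w $ i) *\<^sub>C y) x = 0)"
  proof -
    have "cinner (ortho_proj W (mult H i y)) x = cinner (mult H i y) x" if "x \<in> W" for i y
      using P(2)[OF that, of "mult H i y"] by (simp add: cinner_diff_left)
    then show ?thesis
      by (auto simp: cinner_diff_left)
  qed
  also have "\<dots> \<longleftrightarrow> x \<in> W \<and> (\<forall>i. \<forall>y\<in>carrier H. cinner (mult H i y - (w $ i) *\<^sub>C y) x = 0)"
  proof (intro conj_cong refl iff_allI iffI ballI)
    fix i y assume x: "x \<in> W" and y: "y \<in> carrier H"
      and orth: "\<forall>y\<in>W. cinner (mult H i y - (w $ i) *\<^sub>C y) x = 0"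
    define a where "a = shifted_adj H w i x"
    have a: "a \<in> carrier H" "\<And>y. y \<in> carrier H \<Longrightarrow> cinner (mult H i y - (w $ i) *\<^sub>C y) x = cinner y a"
      using shifted_adj_properties[OF H] by (auto simp: a_def)
    have "cinner a s = 0" if s: "s \<in> S" for s
    proof -
      have "cinner (mult H i s - (w $ i) *\<^sub>C s) x = 0"
        using x S(2)[OF s] cinner_eq_zero_commute unfolding W_iff by blast
      then show ?thesis
        using a(2)[of s] S(1) s cinner_eq_zero_commute by auto
    qed
    then have aW: "a \<in> W"
      using a(1) by (simp add: W_iff)
    have "cinner y a = cinner (ortho_proj W y) a"
      using P(2)[OF aW, of y] by (simp add: cinner_diff_left)
    also have "\<dots> = 0"
      using a(2)[of "ortho_proj W y"] orth P(1)[of y] by (simp add: W_iff)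
    finally show "cinner (mult H i y - (w $ i) *\<^sub>C y) x = 0"
      using a(2)[OF y] by simp
  qed (auto simp: W_iff)
  finally show ?thesis
    using eigen_fiber_iff[OF H, of x w] by (auto simp: W_iff)
qed

section \<open>Elementary tensors as fibres of the canonical model\<close>

lemma one_dimensional_line:
  assumes V: "cvec.subspace V" "cvec.dim V = 1"
  obtains k where "k \<in> V" "k \<noteq> 0"
    and "\<And>g x. g \<in> V \<Longrightarrow> g \<noteq> 0 \<Longrightarrow> x \<in> V \<Longrightarrow> \<exists>c. x = c *\<^sub>C g"
proof -
  obtain B where B: "B \<subseteq> V" "\<not> cvec.dependent B" "V \<subseteq> cvec.span B" "card B = cvec.dim V"
    using cvec.basis_exists by blast
  then obtain k where k: "B = {k}"
    using V(2) by (metis card_1_singletonE)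
  have k0: "k \<noteq> 0"
    using B(2) cvec.dependent_zero[of B] by (auto simp: k)
  have line: "\<exists>c. x = c *\<^sub>C k" if "x \<in> V" for x
    using B(3) that by (auto simp: k cvec.span_singleton)
  show ?thesis
  proof
    show "k \<in> V" "k \<noteq> 0"
      using B(1) k0 by (auto simp: k)
    fix g x assume g: "g \<in> V" "g \<noteq> 0" and x: "x \<in> V"
    obtain a b where ab: "g = a *\<^sub>C k" "x = b *\<^sub>C k"
      using line g(1) x by metis
    have "a \<noteq> 0"
      using g(2) ab(1) by auto
    then have "x = (b / a) *\<^sub>C g"
      by (simp add: ab scaleC_scaleC)
    then show "\<exists>c. x = c *\<^sub>C g" ..
  qed
qed

lemma B_starD:
  assumes "H \<in> B_star m \<Omega>"
  shows "hilbert_module H" "w \<in> \<Omega> \<Longrightarrow> closed ((\<lambda>h. \<chi> i. shifted_adj H w i h) ` carrier H)"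
    "w \<in> \<Omega> \<Longrightarrow> cvec.dim (eigen_fiber H w) = m"
  using assms by (auto simp: B_star_def)

text \<open>The fibre of \<open>H\<close> is a line through some \<open>k\<close>, so a vector with
  all coordinates in it has the form \<open>k \<otimes>\<^sub>e \<eta>\<close>. It is orthogonal to
  the range of \<open>T\<close> exactly when the adjoint of \<open>T\<close> kills it, and that
  adjoint sends it to \<open>k\<close> tensored with the adjoint matrix applied to
  \<open>\<eta>\<close>.\<close>

lemma eigen_fiber_canonical_model:
  fixes H :: "('n::finite, 'h::chilbert_space) hmod"
    and \<Theta> :: "complex ^ 'n \<Rightarrow> complex ^ 'p::finite ^ 'q::finite"
  assumes H: "H \<in> B_star 1 \<Omega>" and \<Theta>: "\<Theta> \<in> multipliers \<Omega> H" and w: "w \<in> \<Omega>"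
  shows "eigen_fiber (canonical_model \<Omega> H \<Theta>) w
    = cvec.span {k \<otimes>\<^sub>e \<eta> | k \<eta>. k \<in> eigen_fiber H w \<and> \<eta> \<in> ker_fiber \<Theta> w}"
proof -
  note mod = hilbert_moduleD[OF B_starD(1)[OF H]]
  define T where "T = mult_op \<Omega> H \<Theta>"
  have "\<exists>T. is_mult_op \<Omega> H \<Theta> T"
    using \<Theta> by (simp add: multipliers_def)
  from someI_ex[OF this] have "is_mult_op \<Omega> H \<Theta> T"
    by (simp add: T_def mult_op_def)
  note TT = this[unfolded is_mult_op_def]
  have T: "bounded_op_on (carrier (tensor_mod H)) (carrier (tensor_mod H)) T"
    using TT by (rule conjunct1)
  have T_mult: "T (mult (tensor_mod H) i x) = mult (tensor_mod H) i (T x)"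
    if "x \<in> carrier (tensor_mod H)" for i x
    using TT that by blast
  have T_adj: "adj_on (carrier (tensor_mod H)) T (k \<otimes>\<^sub>e \<eta>) = k \<otimes>\<^sub>e (mat_adjoint (\<Theta> w) *v \<eta>)"
    if "k \<in> eigen_fiber H w" for k \<eta>
    using TT w that by blast
  note modp = tensor_mod_module[OF mod, where 'q='p] and modq = tensor_mod_module[OF mod, where 'q='q]
  define S where "S = T ` carrier (tensor_mod H)"
  define E where "E = {k \<otimes>\<^sub>e \<eta> | k \<eta>. k \<in> eigen_fiber H w \<and> \<eta> \<in> ker_fiber \<Theta> w}"
  \<comment> \<open>The range of \<open>T\<close> is invariant because \<open>T\<close> commutes
    with the coordinate multiplications; the description of the fibre of a quotient relies on
    this.\<close>
  have S_mult: "mult (tensor_mod H) i s - c *\<^sub>C s \<in> S" if s: "s \<in> S" for i c s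
  proof -
    obtain v where v: "v \<in> carrier (tensor_mod H)" "s = T v"
      using s by (auto simp: S_def)
    define u where "u = mult (tensor_mod H) i v"
    have u: "u \<in> carrier (tensor_mod H)" "T u = mult (tensor_mod H) i s"
      using bounded_op_onD(1)[OF modp(3) v(1)] T_mult[OF v(1)] by (simp_all add: u_def v(2))
    have cv: "(- c) *\<^sub>C v \<in> carrier (tensor_mod H)"
      using cvec.subspace_scale[OF modp(1) v(1)] .
    have "T (u + (- c) *\<^sub>C v) = T u + (- c) *\<^sub>C T v"
      using bounded_op_onD(2)[OF T u(1) cv] bounded_op_onD(3)[OF T v(1), of "- c"] by simp
    then have "mult (tensor_mod H) i s - c *\<^sub>C s = T (u + (- c) *\<^sub>C v)"
      by (simp add: u(2) v(2))
    then show ?thesis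
      unfolding S_def using cvec.subspace_add[OF modp(1) u(1) cv] by blast
  qed
  have S_sub: "S \<subseteq> carrier (tensor_mod H)"
    using bounded_op_onD(1)[OF T] by (auto simp: S_def)
  have fib: "x \<in> eigen_fiber (canonical_model \<Omega> H \<Theta>) w \<longleftrightarrow>
      (\<forall>a. x $ a \<in> eigen_fiber H w) \<and> (\<forall>s\<in>S. cinner x s = 0)" for x
    using eigen_fiber_quotient_mod[OF modq S_sub S_mult, of x w] eigen_fiber_tensor_mod[OF mod, of x w]
    unfolding canonical_model_def T_def[symmetric] S_def[symmetric] by simp
  have ker: "(\<forall>s\<in>S. cinner (k \<otimes>\<^sub>e \<eta>) s = 0) \<longleftrightarrow> \<eta> \<in> ker_fiber \<Theta> w"
    if k: "k \<in> eigen_fiber H w" "k \<noteq> 0" for k \<eta>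
  proof -
    define \<theta> where "\<theta> = mat_adjoint (\<Theta> w) *v \<eta>"
    have adj: "cinner (T v) (k \<otimes>\<^sub>e \<eta>) = cinner v (k \<otimes>\<^sub>e \<theta>)" if "v \<in> carrier (tensor_mod H)" for v
      using adj_on_properties(2)[OF modp(1,2) T that, of "k \<otimes>\<^sub>e \<eta>"] T_adj[OF k(1)]
      by (simp add: \<theta>_def)
    have "k \<otimes>\<^sub>e \<theta> \<in> carrier (tensor_mod H)"
      using k(1) cvec.subspace_scale[OF mod(1)] by (simp add: eigen_fiber_def tensor_mod_simps)
    \<comment> \<open>Test with \<open>v = k \<otimes>\<^sub>e \<theta>\<close> itself.\<close>
    then have "(\<forall>v\<in>carrier (tensor_mod H). cinner v (k \<otimes>\<^sub>e \<theta>) = 0) \<longleftrightarrow> k \<otimes>\<^sub>e \<theta> = 0"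
      by (metis cinner_self_eq_0_iff cinner_zero_right)
    moreover have "(\<forall>s\<in>S. cinner (k \<otimes>\<^sub>e \<eta>) s = 0) \<longleftrightarrow>
        (\<forall>v\<in>carrier (tensor_mod H). cinner v (k \<otimes>\<^sub>e \<theta>) = 0)"
      by (simp add: S_def cinner_eq_zero_commute[of "k \<otimes>\<^sub>e \<eta>"] adj)
    ultimately show ?thesis
      using k(2) by (simp add: etensor_eq_0_iff ker_fiber_def \<theta>_def)
  qed
  have "cvec.subspace (eigen_fiber H w)"
    by (rule subspace_eigen_fiber[OF mod])
  then obtain k where k: "k \<in> eigen_fiber H w" "k \<noteq> 0"
    and line: "\<And>g x. g \<in> eigen_fiber H w \<Longrightarrow> g \<noteq> 0 \<Longrightarrow> x \<in> eigen_fiber H w \<Longrightarrow> \<exists>c. x = c *\<^sub>C g"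
    using one_dimensional_line[OF _ B_starD(3)[OF H w]] by blast
  have "eigen_fiber (canonical_model \<Omega> H \<Theta>) w \<subseteq> E"
  proof
    fix x assume x: "x \<in> eigen_fiber (canonical_model \<Omega> H \<Theta>) w"
    then have "\<forall>a. \<exists>c. x $ a = c *\<^sub>C k"
      using line[OF k] unfolding fib by blast
    then obtain c where c: "\<And>a. x $ a = c a *\<^sub>C k"
      by metis
    define \<eta> where "\<eta> = (\<chi> a. c a)"
    have "x = k \<otimes>\<^sub>e \<eta>"
      by (simp add: vec_eq_iff c \<eta>_def)
    moreover from this have "\<eta> \<in> ker_fiber \<Theta> w"
      using x ker[OF k] unfolding fib by simp
    ultimately show "x \<in> E"
      using k by (auto simp: E_def)
  qed
  moreover have "E \<subseteq> eigen_fiber (canonical_model \<Omega> H \<Theta>) w"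
  proof
    fix x assume "x \<in> E"
    then obtain l \<eta> where x: "x = l \<otimes>\<^sub>e \<eta>" "l \<in> eigen_fiber H w" "\<eta> \<in> ker_fiber \<Theta> w"
      by (auto simp: E_def)
    have "\<forall>s\<in>S. cinner x s = 0"
      using ker[OF x(2)] x(1,3) by (cases "l = 0") auto
    moreover have "x $ a \<in> eigen_fiber H w" for a
      using cvec.subspace_scale[OF subspace_eigen_fiber[OF mod] x(2)] by (simp add: x(1))
    ultimately show "x \<in> eigen_fiber (canonical_model \<Omega> H \<Theta>) w"
      by (simp add: fib)
  qed
  moreover have "cvec.subspace (eigen_fiber (canonical_model \<Omega> H \<Theta>) w)"
    unfolding canonical_model_def by (rule subspace_eigen_fiber) (rule quotient_mod_module[OF modq])+
  ultimately have "E \<subseteq> eigen_fiber (canonical_model \<Omega> H \<Theta>) w"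
    "eigen_fiber (canonical_model \<Omega> H \<Theta>) w \<subseteq> cvec.span E"
    "cvec.span E \<subseteq> eigen_fiber (canonical_model \<Omega> H \<Theta>) w"
    using cvec.span_superset[of E] cvec.span_minimal by blast+
  then show ?thesis
    by (simp add: E_def)
qed

section \<open>Frames of \<open>V\<^sub>\<Theta>\<^sup>*\<close> and \<open>E\<^sub>H\<^sup>*\<close>\<close>

lemma antiholomorphic_vecI:
  assumes "\<And>z. z \<in> U \<Longrightarrow> (f has_derivative D z) (at z)"
    and "\<And>z c v. z \<in> U \<Longrightarrow> D z (c *\<^sub>C v) = cnj c *\<^sub>C D z v"
  shows "antiholomorphic_vec f U"
  unfolding antiholomorphic_vec_def using assms by blast

lemma antiholomorphic_vec_const: "antiholomorphic_vec (\<lambda>_. c) U"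
  by (rule antiholomorphic_vecI[where D = "\<lambda>_ _. 0"]) simp_all

lemma antiholomorphic_vec_diff:
  assumes f: "antiholomorphic_vec f U" and g: "antiholomorphic_vec g U"
  shows "antiholomorphic_vec (\<lambda>z. f z - g z) U"
proof (rule antiholomorphic_vecI[where D = "\<lambda>z v. Dfr f z v - Dfr g z v"])
  fix z assume z: "z \<in> U"
  note df = antiholomorphic_vecD[OF f z] and dg = antiholomorphic_vecD[OF g z]
  show "((\<lambda>z. f z - g z) has_derivative (\<lambda>v. Dfr f z v - Dfr g z v)) (at z)"
    by (rule has_derivative_diff[OF df(1) dg(1)])
  show "Dfr f z (c *\<^sub>C v) - Dfr g z (c *\<^sub>C v) = cnj c *\<^sub>C (Dfr f z v - Dfr g z v)" for c v
    by (simp add: df(2) dg(2) cvec.scale_right_diff_distrib)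
qed

lemma antiholomorphic_vec_sum:
  assumes f: "\<And>i. i \<in> I \<Longrightarrow> antiholomorphic_vec (f i) U"
  shows "antiholomorphic_vec (\<lambda>z. \<Sum>i\<in>I. f i z) U"
proof (rule antiholomorphic_vecI[where D = "\<lambda>z v. \<Sum>i\<in>I. Dfr (f i) z v"])
  show "((\<lambda>z. \<Sum>i\<in>I. f i z) has_derivative (\<lambda>v. \<Sum>i\<in>I. Dfr (f i) z v)) (at z)" if "z \<in> U" for z
    by (intro has_derivative_sum antiholomorphic_vecD(1)[OF f that])
  show "(\<Sum>i\<in>I. Dfr (f i) z (c *\<^sub>C v)) = cnj c *\<^sub>C (\<Sum>i\<in>I. Dfr (f i) z v)" if "z \<in> U" for z c v
    unfolding cvec.scale_sum_right
    by (intro sum.cong refl antiholomorphic_vecD(2)[OF f that])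
qed

lemma antiholomorphic_vec_scaleC:
  assumes f: "antiholomorphic_vec f U" and g: "antiholomorphic_vec g U"
  shows "antiholomorphic_vec (\<lambda>z. f z *\<^sub>C g z) U"
proof (rule antiholomorphic_vecI[where D = "\<lambda>z v. f z *\<^sub>C Dfr g z v + Dfr f z v *\<^sub>C g z"])
  fix z assume z: "z \<in> U"
  note df = antiholomorphic_vecD[OF f z] and dg = antiholomorphic_vecD[OF g z]
  show "((\<lambda>z. f z *\<^sub>C g z) has_derivative (\<lambda>v. f z *\<^sub>C Dfr g z v + Dfr f z v *\<^sub>C g z)) (at z)"
    by (rule has_derivative_scaleC[OF df(1) dg(1)])
  show "f z *\<^sub>C Dfr g z (c *\<^sub>C v) + Dfr f z (c *\<^sub>C v) *\<^sub>C g z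
      = cnj c *\<^sub>C (f z *\<^sub>C Dfr g z v + Dfr f z v *\<^sub>C g z)" for c v
    by (simp add: df(2) dg(2) scaleC_right_distrib scaleC_scaleC mult_ac)
qed

lemma antiholomorphic_cnj_entry:
  fixes A :: "'a::complex_inner \<Rightarrow> complex ^ 'p::finite ^ 'q::finite"
  assumes "holomorphic_vec A U"
  shows "antiholomorphic_vec (\<lambda>z. cnj (A z $ a $ b)) U"
  unfolding antiholomorphic_vec_def
proof
  fix z assume "z \<in> U"
  then obtain D where D: "(A has_derivative D) (at z)" "\<And>c v. D (c *\<^sub>C v) = c *\<^sub>C D v"
    using assms unfolding holomorphic_vec_def by blast
  have "((\<lambda>z. cnj (A z $ a $ b)) has_derivative (\<lambda>v. cnj (D v $ a $ b))) (at z)"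
    by (intro bounded_linear.has_derivative[OF bounded_linear_cnj]
        bounded_linear.has_derivative[OF bounded_linear_vec_nth] D(1))
  moreover have "cnj (D (c *\<^sub>C v) $ a $ b) = cnj c *\<^sub>C cnj (D v $ a $ b)" for c v
    by (simp add: D(2))
  ultimately show "\<exists>D. ((\<lambda>z. cnj (A z $ a $ b)) has_derivative D) (at z) \<and> (\<forall>c v. D (c *\<^sub>C v) = cnj c *\<^sub>C D v)"
    by blast
qed

lemma antiholomorphic_vec_lambda:
  fixes f :: "'q::finite \<Rightarrow> 'a::complex_inner \<Rightarrow> complex"
  assumes "\<And>a. antiholomorphic_vec (f a) U"
  shows "antiholomorphic_vec (\<lambda>z. \<chi> a. f a z) U"
proof -
  have "(\<chi> a. f a z) = (\<Sum>a\<in>UNIV. f a z *\<^sub>C axis a 1)" for z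
    by (simp add: vec_eq_iff axis_def if_distrib[of "\<lambda>t. f _ z * t"] cong: if_cong)
  then show ?thesis
    by (simp only:) (intro antiholomorphic_vec_sum antiholomorphic_vec_scaleC antiholomorphic_vec_const assms)
qed

lemma antiholomorphic_mat_adjoint_mult:
  assumes A: "holomorphic_vec A U" and h: "antiholomorphic_vec h U"
  shows "antiholomorphic_vec (\<lambda>z. mat_adjoint (A z) *v h z) U"
proof -
  have h': "antiholomorphic_vec (\<lambda>z. h z $ b) U" for b
  proof (rule antiholomorphic_vecI[where D = "\<lambda>z v. Dfr h z v $ b"])
    show "((\<lambda>z. h z $ b) has_derivative (\<lambda>v. Dfr h z v $ b)) (at z)" if "z \<in> U" for z
      by (intro bounded_linear.has_derivative[OF bounded_linear_vec_nth] antiholomorphic_vecD(1)[OF h that])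
  qed (simp add: antiholomorphic_vecD(2)[OF h])
  have "mat_adjoint (A z) *v h z = (\<chi> a. \<Sum>b\<in>UNIV. cnj (A z $ b $ a) *\<^sub>C (h z $ b))" for z
    by (simp add: vec_eq_iff mat_adjoint_def matrix_vector_mult_def)
  then show ?thesis
    by (simp only:)
      (intro antiholomorphic_vec_lambda antiholomorphic_vec_sum antiholomorphic_vec_scaleC
        antiholomorphic_cnj_entry[OF A] h')
qed

section \<open>Frames from families of oblique projections\<close>

lemma mat_adjoint_mult: "mat_adjoint (A ** B) = mat_adjoint B ** mat_adjoint A"
  by (simp add: mat_adjoint_def matrix_matrix_mult_def vec_eq_iff mult.commute)

lemma mat_adjoint_one: "mat_adjoint (mat 1) = mat 1"
  by (simp add: mat_adjoint_def mat_def vec_eq_iff)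

lemma scaleC_vec_eq: "c *\<^sub>C (x :: complex ^ 'q) = c *s x"
  by (simp add: vec_eq_iff)

text \<open>The frame is \<open>P z (f b)\<close> for a fixed basis \<open>f\<close> of the range of
  \<open>P w\<close>. A linear map close to the identity near \<open>w\<close> carries one range to
  the other: its injectivity keeps these vectors independent, its surjectivity makes them span the
  range of \<open>P z\<close>.\<close>

lemma antiholomorphic_projection_frame:
  fixes P :: "complex ^ 'n::finite \<Rightarrow> complex ^ 'q::finite \<Rightarrow> complex ^ 'q"
  assumes U: "open \<Omega>" "w \<in> \<Omega>"
    and hol: "\<And>x. antiholomorphic_vec (\<lambda>z. P z x) \<Omega>"
    and lin: "\<And>z. Vector_Spaces.linear (*\<^sub>C) (*\<^sub>C) (P z)"
    and idem: "\<And>z x. z \<in> \<Omega> \<Longrightarrow> P z (P z x) = P z x"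
  shows "\<exists>m V e. w \<in> V \<and> V \<subseteq> \<Omega> \<and> antihol_frame (\<lambda>z. range (P z)) m V e"
proof -
  interpret P: Vector_Spaces.linear "(*\<^sub>C)" "(*\<^sub>C)" "P z" for z
    by (rule lin)
  text \<open>Kato's transformation function: \<open>F w\<close> is the identity and \<open>F z\<close> maps the range of \<open>P w\<close> to
    that of \<open>P z\<close>.\<close>
  define F where "F z x = P z (P w x) + (x - P w x) - P z (x - P w x)" for z x
  \<comment> \<open>Anti-holomorphy is assumed for each fixed vector, so the distance between
    \<open>P z\<close> and \<open>P w\<close> is measured on the finitely many unit vectors; this
    sum dominates the operator norm.\<close>
  define \<epsilon> where "\<epsilon> z = (\<Sum>a\<in>UNIV. norm (P z (axis a 1) - P w (axis a 1)))" for z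
  have expand: "(x :: complex ^ 'q) = (\<Sum>a\<in>UNIV. (x $ a) *\<^sub>C axis a 1)" for x
    by (simp add: vec_eq_iff axis_def if_distrib[of "\<lambda>t. _ * t"] cong: if_cong)
  have P_expand: "P z x = (\<Sum>a\<in>UNIV. (x $ a) *\<^sub>C P z (axis a 1))" for z x
    by (subst expand[of x]) (simp add: P.sum P.scale)
  have diff_le: "norm (P z x - P w x) \<le> \<epsilon> z * norm x" for z x
  proof -
    have "P z x - P w x = (\<Sum>a\<in>UNIV. (x $ a) *\<^sub>C (P z (axis a 1) - P w (axis a 1)))"
      by (simp add: P_expand[of _ x] cvec.scale_right_diff_distrib sum_subtractf)
    also have "norm \<dots> \<le> (\<Sum>a\<in>UNIV. norm x * norm (P z (axis a 1) - P w (axis a 1)))"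
      by (intro sum_norm_le) (simp add: norm_scaleC mult_right_mono Finite_Cartesian_Product.norm_nth_le)
    finally show ?thesis
      by (simp add: \<epsilon>_def sum_distrib_left mult.commute)
  qed
  define K where "K = (\<Sum>a\<in>UNIV. norm (P w (axis a 1)))"
  have K: "norm (P w x) \<le> K * norm x" for x
  proof -
    have "norm (P w x) \<le> (\<Sum>a\<in>UNIV. norm x * norm (P w (axis a 1)))"
      by (subst P_expand, intro sum_norm_le)
        (simp add: norm_scaleC mult_right_mono Finite_Cartesian_Product.norm_nth_le)
    then show ?thesis
      by (simp add: K_def sum_distrib_left mult.commute)
  qed
  have K0: "0 \<le> K"
    by (simp add: K_def sum_nonneg)
  have "isCont \<epsilon> w"
    unfolding \<epsilon>_def using has_derivative_continuous[OF antiholomorphic_vecD(1)[OF hol U(2)]]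
    by (intro continuous_intros) auto
  then have "(\<epsilon> \<longlongrightarrow> 0) (at w)"
    unfolding isCont_def by (simp add: \<epsilon>_def)
  \<comment> \<open>\<open>2 * K + 1\<close> bounds the norm of \<open>2 P w - 1\<close>; the
    threshold makes \<open>F z\<close> differ from the identity by a map of norm less than
    one.\<close>
  then have "\<forall>\<^sub>F z in at w. \<epsilon> z < 1 / (2 * K + 1)"
    using K0 by (intro order_tendstoD(2)) auto
  then obtain V where V: "open V" "w \<in> V" "\<And>z. z \<in> V \<Longrightarrow> z \<noteq> w \<Longrightarrow> \<epsilon> z < 1 / (2 * K + 1)"
    unfolding eventually_at_topological by blast
  define V' where "V' = V \<inter> \<Omega>"
  have small: "\<epsilon> z * (2 * K + 1) < 1" if "z \<in> V'" for z
  proof (cases "z = w")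
    case False
    then show ?thesis
      using V(3)[of z] that K0 by (simp add: V'_def pos_less_divide_eq)
  qed (simp add: \<epsilon>_def)
  have F_inj: "x = 0" if z: "z \<in> V'" and F: "F z x = 0" for z x
  proof (rule ccontr)
    assume "x \<noteq> 0"
    \<comment> \<open>\<open>y\<close> is \<open>(2 P w - 1) x\<close>, and \<open>F z - 1\<close>
      factors as \<open>(P z - P w) (2 P w - 1)\<close>.\<close>
    define y where "y = P w x - (x - P w x)"
    have "P z y = P z (P w x) - (P z x - P z (P w x))" "P w y = P w x"
      by (simp_all only: y_def P.diff idem[OF U(2)]) simp
    moreover have "F z x - x = (P z (P w x) - (P z x - P z (P w x))) - P w x"
      by (simp add: F_def P.diff algebra_simps)
    ultimately have "P z y - P w y = - x"
      using F by simp
    then have "norm x \<le> \<epsilon> z * norm y"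
      using diff_le[of z y] by simp
    also have "norm y \<le> norm (P w x) + (norm x + norm (P w x))"
      unfolding y_def by (meson add_left_mono norm_triangle_ineq4 order_trans)
    then have "norm y \<le> (2 * K + 1) * norm x"
      using K[of x] by (simp add: distrib_right)
    then have "\<epsilon> z * norm y \<le> \<epsilon> z * ((2 * K + 1) * norm x)"
      by (intro mult_left_mono) (auto simp: \<epsilon>_def sum_nonneg)
    finally have "1 * norm x \<le> (\<epsilon> z * (2 * K + 1)) * norm x"
      by (simp add: mult.assoc)
    then show False
      using small[OF z] \<open>x \<noteq> 0\<close> by simp
  qed
  have F_surj: "\<exists>x. y = F z x" if z: "z \<in> V'" for z y
  proof -
    have lin_F: "linear (F z)"
    proof
      show "F z (x + y) = F z x + F z y" for x y
        by (simp add: F_def P.add P.diff)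
      show "F z (r *\<^sub>R x) = r *\<^sub>R F z x" for r x
        unfolding scaleC_of_real[symmetric]
        by (simp only: F_def P.scale P.diff scaleC_right_distrib cvec.scale_right_diff_distrib)
    qed
    then have "inj (F z)"
      using F_inj[OF z] by (simp add: linear_injective_0)
    then have "surj (F z)"
      using linear_injective_imp_surjective[OF lin_F] by simp
    then show ?thesis
      by (auto simp: surj_def)
  qed
  have sub: "cvec.subspace (range (P z))" for z
    by (rule P.subspace_image[OF cvec.subspace_UNIV])
  obtain B where B: "B \<subseteq> range (P w)" "\<not> cvec.dependent B" "range (P w) \<subseteq> cvec.span B"
    by (rule cvec.basis_exists[of "range (P w)"]) (rule that)
  have "finite B"
  proof -
    \<comment> \<open>Both scalar multiplications coincide on \<open>complex ^ 'q\<close>, so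
      finiteness of independent sets carries over from \<open>vec\<close>.\<close>
    have dep: "cvec.dependent = (vec.dependent :: (complex ^ 'q) set \<Rightarrow> bool)"
      unfolding cvec.dependent_explicit vec.dependent_explicit scaleC_vec_eq ..
    show ?thesis
      using B(2) unfolding dep by (rule vec.finiteI_independent)
  qed
  then obtain f where f: "bij_betw f {..<card B} B"
    using ex_bij_betw_nat_finite by (metis atLeast0LessThan)
  define m where "m = card B"
  have fB: "f ` {..<m} = B" "inj_on f {..<m}"
    using f by (auto simp: m_def bij_betw_def)
  have fix_w: "P w (f b) = f b" if "b < m" for b
  proof -
    have "f b \<in> range (P w)"
      using that fB(1) B(1) by blast
    then show ?thesis
      using idem[OF U(2)] by auto
  qed
  define e where "e b z = P z (f b)" for b z
  have sum_e: "(\<Sum>b<m. c b *\<^sub>C e b z) = P z (\<Sum>b<m. c b *\<^sub>C f b)" for c z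
    by (simp add: e_def P.sum P.scale)
  have "antihol_frame (\<lambda>z. range (P z)) m V' e"
    unfolding antihol_frame_iff
  proof (intro conjI allI impI ballI)
    show "open V'"
      using V U by (auto simp: V'_def)
    show "antiholomorphic_vec (e b) V'" for b
      unfolding e_def[abs_def] using hol by (rule antiholomorphic_vec_subset) (auto simp: V'_def)
  next
    fix z c b assume z: "z \<in> V'" and c: "(\<Sum>b<m. c b *\<^sub>C e b z) = 0" and b: "b < m"
    define x where "x = (\<Sum>b<m. c b *\<^sub>C f b)"
    \<comment> \<open>On the range of \<open>P w\<close> the map \<open>F z\<close> agrees with
      \<open>P z\<close>, so its injectivity applies.\<close>
    have "P w x = x"
      unfolding x_def P.sum P.scale by (intro sum.cong refl) (simp add: fix_w)
    then have "F z x = 0"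
      using c by (simp add: F_def sum_e x_def)
    then have "x = 0"
      by (rule F_inj[OF z])
    then show "c b = 0"
      using independent_family_iff[of f m] fB B(2) b unfolding x_def by metis
  next
    fix z assume z: "z \<in> V'"
    then have z\<Omega>: "z \<in> \<Omega>"
      by (simp add: V'_def)
    show "cvec.span ((\<lambda>a. e a z) ` {..<m}) = range (P z)"
    proof
      show "cvec.span ((\<lambda>a. e a z) ` {..<m}) \<subseteq> range (P z)"
        by (intro cvec.span_minimal sub) (auto simp: e_def)
      show "range (P z) \<subseteq> cvec.span ((\<lambda>a. e a z) ` {..<m})"
      proof
        fix y assume "y \<in> range (P z)"
        then have y: "P z y = y"
          using idem[OF z\<Omega>] by auto
        obtain x where x: "y = F z x"
          using F_surj[OF z] by blast
        \<comment> \<open>\<open>F z\<close> intertwines the projections, hence a preimage of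
          \<open>y\<close> under it may be replaced by its component in the range of
          \<open>P w\<close>.\<close>
        have "P z (F z x) = P z (P w x)"
          by (simp only: F_def P.add P.diff idem[OF z\<Omega>]) simp
        then have "y = P z (P w x)"
          using x y by simp
        moreover have "P w x \<in> cvec.span (f ` {..<m})"
          using B(3) fB(1) by blast
        then obtain c where "P w x = (\<Sum>b<m. c b *\<^sub>C f b)"
          by (rule span_image_coordinates)
        ultimately have "y = (\<Sum>b<m. c b *\<^sub>C e b z)"
          by (simp add: sum_e)
        then show "y \<in> cvec.span ((\<lambda>a. e a z) ` {..<m})"
          using sum_in_span[of c "\<lambda>a. e a z" m] by simp
      qed
    qed
  qed
  then show ?thesis
    using V(2) U(2) by (intro exI[of _ m] exI[of _ V'] exI[of _ e]) (auto simp: V'_def)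
qed

lemma antihol_frame_cong:
  assumes "antihol_frame E m U e" "\<And>z. z \<in> U \<Longrightarrow> E z = E' z"
  shows "antihol_frame E' m U e"
  using assms by (simp add: antihol_frame_def)

text \<open>Taking adjoints in \<open>\<Psi> z ** \<Theta> z = mat 1\<close> makes the adjoint of
  \<open>\<Psi> z\<close> a right inverse of the adjoint of \<open>\<Theta> z\<close>. Hence their
  product in the other order is idempotent with the same kernel as the adjoint of
  \<open>\<Theta> z\<close>, and \<open>P z\<close> is the complementary projection.\<close>

lemma ker_fiber_frame:
  fixes \<Theta> :: "complex ^ 'n::finite \<Rightarrow> complex ^ 'p::finite ^ 'q::finite"
  assumes U: "open \<Omega>" "w \<in> \<Omega>" and \<Theta>: "holomorphic_vec \<Theta> \<Omega>" and \<Psi>: "holomorphic_vec \<Psi> \<Omega>"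
    and inv: "\<And>z. z \<in> \<Omega> \<Longrightarrow> \<Psi> z ** \<Theta> z = mat 1"
  shows "\<exists>m V e. w \<in> V \<and> V \<subseteq> \<Omega> \<and> antihol_frame (ker_fiber \<Theta>) m V e"
proof -
  define P where "P z x = x - mat_adjoint (\<Psi> z) *v (mat_adjoint (\<Theta> z) *v x)" for z x
  have inv': "mat_adjoint (\<Theta> z) *v (mat_adjoint (\<Psi> z) *v x) = x" if "z \<in> \<Omega>" for z x
    unfolding matrix_vector_mul_assoc mat_adjoint_mult[symmetric] inv[OF that] mat_adjoint_one
    by (rule matrix_vector_mul_lid)
  have P_ker: "mat_adjoint (\<Theta> z) *v P z x = 0" if "z \<in> \<Omega>" for z x
    by (simp add: P_def matrix_vector_mult_diff_distrib inv'[OF that])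
  have P_fix: "P z x = x" if "x \<in> ker_fiber \<Theta> z" for z x
    using that by (simp add: P_def ker_fiber_def)
  have "\<exists>m V e. w \<in> V \<and> V \<subseteq> \<Omega> \<and> antihol_frame (\<lambda>z. range (P z)) m V e"
  proof (rule antiholomorphic_projection_frame[OF U])
    show "antiholomorphic_vec (\<lambda>z. P z x) \<Omega>" for x
      unfolding P_def
      by (intro antiholomorphic_vec_diff antiholomorphic_mat_adjoint_mult[OF \<Psi>]
          antiholomorphic_mat_adjoint_mult[OF \<Theta>] antiholomorphic_vec_const)
    show "Vector_Spaces.linear (*\<^sub>C) (*\<^sub>C) (P z)" for z
      by unfold_locales
        (simp_all add: P_def scaleC_vec_eq matrix_vector_right_distrib vec.scale_right_diff_distrib
          vector_scalar_commute)
    show "P z (P z x) = P z x" if "z \<in> \<Omega>" for z x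
      using P_fix[of "P z x" z] P_ker[OF that] by (simp add: ker_fiber_def)
  qed
  then obtain m V e where V: "w \<in> V" "V \<subseteq> \<Omega>" and e: "antihol_frame (\<lambda>z. range (P z)) m V e"
    by blast
  have "range (P z) = ker_fiber \<Theta> z" if "z \<in> V" for z
  proof
    show "range (P z) \<subseteq> ker_fiber \<Theta> z"
      using P_ker V that by (auto simp: ker_fiber_def)
    show "ker_fiber \<Theta> z \<subseteq> range (P z)"
      using P_fix by (metis rangeI subsetI)
  qed
  then have "antihol_frame (ker_fiber \<Theta>) m V e"
    using antihol_frame_cong[OF e] by blast
  then show ?thesis
    using V by blast
qed

section \<open>Frames of the eigenvector bundle\<close>

lemma shifted_adj_eigenvector:
  fixes w z :: "complex ^ 'n::finite"
  assumes H: "cvec.subspace (carrier H)" "closed (carrier H)"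
    "\<And>i. bounded_op_on (carrier H) (carrier H) (mult H i)"
    and h: "h \<in> eigen_fiber H z"
  shows "shifted_adj H w i h = cnj (z $ i - w $ i) *\<^sub>C h"
proof (rule shifted_adj_eqI[OF H])
  have hc: "h \<in> carrier H" and orth: "\<And>x. x \<in> carrier H \<Longrightarrow> cinner (mult H i x - (z $ i) *\<^sub>C x) h = 0"
    using h eigen_fiber_iff[OF H] by blast+
  show "cnj (z $ i - w $ i) *\<^sub>C h \<in> carrier H"
    using cvec.subspace_scale[OF H(1) hc] .
  show "cinner (mult H i x - (w $ i) *\<^sub>C x) h = cinner x (cnj (z $ i - w $ i) *\<^sub>C h)"
    if "x \<in> carrier H" for x
    using orth[OF that]
    by (simp add: cinner_diff_left cinner_scaleC_left cinner_scaleC_right left_diff_distrib)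
qed

lemma shifted_adj_linear:
  fixes w :: "complex ^ 'n::finite"
  assumes H: "cvec.subspace (carrier H)" "closed (carrier H)"
    "\<And>i. bounded_op_on (carrier H) (carrier H) (mult H i)"
    and xy: "x \<in> carrier H" "y \<in> carrier H"
  shows "shifted_adj H w i (x + y) = shifted_adj H w i x + shifted_adj H w i y"
    and "shifted_adj H w i (c *\<^sub>C x) = c *\<^sub>C shifted_adj H w i x"
  using shifted_adj_properties[OF H, where w = w and i = i]
  by (auto intro!: shifted_adj_eqI[OF H] cvec.subspace_add[OF H(1)] cvec.subspace_scale[OF H(1)]
      simp: cinner_add_right cinner_scaleC_right)

text \<open>A bound for an operator passes to its adjoint by testing with the adjoint vector
  itself.\<close>

lemma shifted_adj_bound:
  fixes w :: "complex ^ 'n::finite"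
  assumes H: "cvec.subspace (carrier H)" "closed (carrier H)"
    "\<And>i. bounded_op_on (carrier H) (carrier H) (mult H i)"
  shows "\<exists>B\<ge>0. \<forall>y. norm (shifted_adj H w i y) \<le> B * norm y"
proof -
  obtain B where B: "0 \<le> B"
    "\<And>x. x \<in> carrier H \<Longrightarrow> norm (mult H i x - (w $ i) *\<^sub>C x) \<le> B * norm x"
    using bounded_op_on_bound[OF bounded_op_on_shift[OF H(1,3)]] by blast
  have "norm (shifted_adj H w i y) \<le> B * norm y" for y
  proof -
    define z where "z = shifted_adj H w i y"
    have z: "z \<in> carrier H"
      unfolding z_def by (rule shifted_adj_properties[OF H])
    have "norm z * norm z = cmod (cinner z z)"
      by (simp add: cinner_self norm_mult power2_eq_square)
    also have "cinner z z = cinner (mult H i z - (w $ i) *\<^sub>C z) y"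
      using shifted_adj_properties(2)[OF H z, where w = w and y = y] by (simp add: z_def)
    also have "cmod \<dots> \<le> norm (mult H i z - (w $ i) *\<^sub>C z) * norm y"
      by (rule norm_cinner_le)
    also have "\<dots> \<le> (B * norm z) * norm y"
      by (intro mult_right_mono B z) simp
    also have "\<dots> = norm z * (B * norm y)"
      by (simp add: mult_ac)
    finally show ?thesis
      unfolding z_def[symmetric] using B(1) by (intro norm_le_of_square_le) auto
  qed
  then show ?thesis
    using B(1) by blast
qed

lemma has_derivative_quadratic_remainder:
  fixes f :: "'a::real_normed_vector \<Rightarrow> 'b::real_normed_vector"
  assumes D: "bounded_linear D" and d: "0 < d"
    and rem: "\<And>z. norm (z - w) < d \<Longrightarrow> norm (f z - f w - D (z - w)) \<le> K * (norm (z - w))\<^sup>2"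
  shows "(f has_derivative D) (at w)"
  unfolding has_derivative_iff_norm
proof (rule conjI[OF D], rule Lim_null_comparison)
  show "\<forall>\<^sub>F z in at w. norm (norm (f z - f w - D (z - w)) / norm (z - w)) \<le> K * norm (z - w)"
    unfolding eventually_at
  proof (intro exI[of _ d] conjI ballI impI)
    fix z assume z: "z \<noteq> w \<and> dist z w < d"
    then have "norm (f z - f w - D (z - w)) \<le> (K * norm (z - w)) * norm (z - w)"
      using rem[of z] by (simp add: dist_norm power2_eq_square)
    then show "norm (norm (f z - f w - D (z - w)) / norm (z - w)) \<le> K * norm (z - w)"
      using z by (simp add: pos_divide_le_eq)
  qed (rule d)
  have "((\<lambda>z. K * norm (z - w)) \<longlongrightarrow> K * norm (w - w)) (at w)"
    by (intro tendsto_intros)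
  then show "((\<lambda>z. K * norm (z - w)) \<longlongrightarrow> 0) (at w)"
    by simp
qed

definition adj_column where
  "adj_column H w h = (\<chi> i. shifted_adj H w i h)"

lemma adj_column_nth [simp]: "adj_column H w h $ i = shifted_adj H w i h"
  by (simp add: adj_column_def)

lemma adj_column_linear:
  fixes w :: "complex ^ 'n::finite"
  assumes H: "cvec.subspace (carrier H)" "closed (carrier H)"
    "\<And>i. bounded_op_on (carrier H) (carrier H) (mult H i)"
    and xy: "x \<in> carrier H" "y \<in> carrier H"
  shows "adj_column H w (x + y) = adj_column H w x + adj_column H w y"
    and "adj_column H w (c *\<^sub>C x) = c *\<^sub>C adj_column H w x"
    and "adj_column H w (x - y) = adj_column H w x - adj_column H w y"
proof -
  show add: "adj_column H w (x + y) = adj_column H w x + adj_column H w y"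
    by (simp add: vec_eq_iff shifted_adj_linear(1)[OF H xy])
  show scale: "adj_column H w (c *\<^sub>C x) = c *\<^sub>C adj_column H w x" for c
    by (simp add: vec_eq_iff shifted_adj_linear(2)[OF H xy])
  have neg: "(-1) *\<^sub>C y \<in> carrier H"
    using cvec.subspace_scale[OF H(1) xy(2)] .
  have "shifted_adj H w i (x + (-1) *\<^sub>C y) = shifted_adj H w i x + (-1) *\<^sub>C shifted_adj H w i y" for i
    by (simp only: shifted_adj_linear(1)[OF H xy(1) neg] shifted_adj_linear(2)[OF H xy(2) xy(2)])
  then show "adj_column H w (x - y) = adj_column H w x - adj_column H w y"
    by (simp add: vec_eq_iff)
qed

lemma adj_column_sum:
  fixes w :: "complex ^ 'n::finite"
  assumes H: "cvec.subspace (carrier H)" "closed (carrier H)"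
    "\<And>i. bounded_op_on (carrier H) (carrier H) (mult H i)"
    and f: "\<And>i. i \<in> I \<Longrightarrow> f i \<in> carrier H"
  shows "adj_column H w (\<Sum>i\<in>I. c i *\<^sub>C f i) = (\<Sum>i\<in>I. c i *\<^sub>C adj_column H w (f i))"
  using f
proof (induction I rule: infinite_finite_induct)
  case (insert j I)
  have "(\<Sum>i\<in>I. c i *\<^sub>C f i) \<in> carrier H" "c j *\<^sub>C f j \<in> carrier H" "f j \<in> carrier H"
    using insert.prems by (auto intro!: cvec.subspace_sum[OF H(1)] cvec.subspace_scale[OF H(1)])
  then show ?case
    using insert by (simp add: adj_column_linear[OF H])
qed (use adj_column_linear(2)[OF H cvec.subspace_0[OF H(1)] cvec.subspace_0[OF H(1)], of w 0] in simp_all)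

text \<open>On an eigenvector for \<open>z\<close> the column is an elementary tensor of norm
  \<open>norm h * norm (z - w)\<close>. This small value is played off against the lower bound away
  from the kernel.\<close>

lemma adj_column_eigenvector:
  fixes w z :: "complex ^ 'n::finite"
  assumes H: "cvec.subspace (carrier H)" "closed (carrier H)"
    "\<And>i. bounded_op_on (carrier H) (carrier H) (mult H i)"
    and h: "h \<in> eigen_fiber H z"
  shows "adj_column H w h = h \<otimes>\<^sub>e (\<chi> i. cnj (z $ i - w $ i))"
  by (simp add: vec_eq_iff shifted_adj_eigenvector[OF H h])

lemma adj_column_eq_0_iff:
  "h \<in> carrier H \<Longrightarrow> adj_column H w h = 0 \<longleftrightarrow> h \<in> eigen_fiber H w"
  by (simp add: vec_eq_iff eigen_fiber_def)

lemma norm_cnj_vec: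
  fixes v :: "complex ^ 'n::finite"
  shows "norm (\<chi> i. cnj (v $ i)) = norm v"
  by (simp add: norm_vec_def)

lemma norm_axis_eq: "norm (axis i (x :: 'a::real_inner)) = norm x"
  by (simp add: norm_eq_sqrt_inner inner_axis_axis)

text \<open>A bounded preimage \<open>x\<close> of the column of \<open>r\<close> differs from
  \<open>r\<close> by a multiple of \<open>g\<close>, and the map
  \<open>r \<mapsto> r - cinner r k *\<^sub>C g\<close> kills such multiples because
  \<open>cinner g k = 1\<close>. So it takes the same value at \<open>x\<close>, of norm at most
  \<open>(1 + norm k * norm g) * norm x\<close>. This oblique projection is chosen because
  \<open>k\<close> will stay fixed while \<open>g\<close> varies with \<open>w\<close>.\<close>

lemma eigen_fiber_gap:
  fixes H :: "('n::finite, 'h::chilbert_space) hmod"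
  assumes H: "H \<in> B_star 1 \<Omega>" and w: "w \<in> \<Omega>"
    and g: "g \<in> eigen_fiber H w" "cinner g k = 1"
  shows "\<exists>C\<ge>0. \<forall>r\<in>carrier H. norm (r - cinner r k *\<^sub>C g) \<le> C * norm (adj_column H w r)"
proof -
  note mod = hilbert_moduleD[OF B_starD(1)[OF H]]
  have g0: "g \<noteq> 0"
    using g by auto
  obtain B where B: "\<And>i y. norm (shifted_adj H w i y) \<le> B i * norm y"
    using shifted_adj_bound[OF mod, of w] by metis
  have bound: "norm (adj_column H w x) \<le> (\<Sum>i\<in>UNIV. B i) * norm x" for x
  proof -
    have "norm (adj_column H w x) \<le> (\<Sum>i\<in>UNIV. norm (adj_column H w x $ i))"
      by (rule norm_vec_le_sum)
    also have "\<dots> \<le> (\<Sum>i\<in>UNIV. B i * norm x)"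
      by (intro sum_mono) (simp add: B)
    finally show ?thesis
      by (simp add: sum_distrib_right)
  qed
  have "\<exists>C\<ge>0. \<forall>y\<in>adj_column H w ` carrier H. \<exists>x\<in>carrier H. adj_column H w x = y \<and> norm x \<le> C * norm y"
  proof (rule closed_range_bounded_preimage[where V = "carrier H" and T = "adj_column H w", OF real_subspace[OF mod(1)] mod(2) _ _ bound])
    show "adj_column H w (x + y) = adj_column H w x + adj_column H w y"
      if "x \<in> carrier H" "y \<in> carrier H" for x y
      by (rule adj_column_linear(1)[OF mod that])
    show "adj_column H w (r *\<^sub>R x) = r *\<^sub>R adj_column H w x" if "x \<in> carrier H" for r x
      unfolding scaleC_of_real[symmetric] by (rule adj_column_linear(2)[OF mod that that])
    show "closed (adj_column H w ` carrier H)"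
      using B_starD(2)[OF H w] unfolding adj_column_def[abs_def] .
  qed
  then obtain C where C: "0 \<le> C" "\<And>y. y \<in> adj_column H w ` carrier H \<Longrightarrow>
      \<exists>x\<in>carrier H. adj_column H w x = y \<and> norm x \<le> C * norm y"
    by blast
  have "norm (r - cinner r k *\<^sub>C g) \<le> ((1 + norm k * norm g) * C) * norm (adj_column H w r)"
    if r: "r \<in> carrier H" for r
  proof -
    obtain x where x: "x \<in> carrier H" "adj_column H w x = adj_column H w r"
      "norm x \<le> C * norm (adj_column H w r)"
      using C(2)[of "adj_column H w r"] r by auto
    have "adj_column H w (r - x) = 0"
      by (simp add: adj_column_linear(3)[OF mod r x(1)] x(2))
    then have rx: "r - x \<in> eigen_fiber H w"
      using adj_column_eq_0_iff[of "r - x" H w] cvec.subspace_diff[OF mod(1) r x(1)] by simp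
    obtain c where c: "r - x = c *\<^sub>C g"
      using one_dimensional_line[OF subspace_eigen_fiber[OF mod] B_starD(3)[OF H w]] g(1) g0 rx
      by metis
    have "cinner (r - x) k = c"
      using g(2) by (simp add: c cinner_scaleC_left)
    then have "r - cinner r k *\<^sub>C g = x - cinner x k *\<^sub>C g"
      using c by (simp add: cinner_diff_left algebra_simps cvec.scale_left_diff_distrib)
        (metis (no_types, lifting) c cinner_diff_left cvec.scale_left_diff_distrib diff_add_cancel diff_diff_eq2)
    then have "norm (r - cinner r k *\<^sub>C g) \<le> norm x + cmod (cinner x k) * norm g"
      using norm_triangle_ineq4[of x "cinner x k *\<^sub>C g"] by (simp add: norm_scaleC)
    also have "\<dots> \<le> norm x + (norm x * norm k) * norm g"
      by (intro add_left_mono mult_right_mono norm_cinner_le) simp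
    also have "\<dots> = (1 + norm k * norm g) * norm x"
      by (simp add: algebra_simps)
    also have "\<dots> \<le> (1 + norm k * norm g) * (C * norm (adj_column H w r))"
      by (intro mult_left_mono x(3)) simp
    finally show ?thesis
      by (simp add: mult.assoc)
  qed
  then show ?thesis
    using C(1) by (intro exI[of _ "(1 + norm k * norm g) * C"]) simp
qed

text \<open>With \<open>k\<close> fixed in the fibre over \<open>w0\<close>, each nearby fibre
  contains exactly one vector \<open>\<gamma> w\<close> with
  \<open>cinner (\<gamma> w) k = 1\<close>. The gap bound for \<open>\<gamma> z\<close> gives a
  Lipschitz estimate. For the remainder of the first-order expansion, whose column is
  \<open>\<gamma> z - \<gamma> w\<close> tensored with the conjugate of \<open>z - w\<close>, the
  same bound becomes quadratic.\<close>

lemma eigen_fiber_frame: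
  fixes H :: "('n::finite, 'h::chilbert_space) hmod"
  assumes H: "H \<in> B_star 1 \<Omega>" and \<Omega>: "open \<Omega>" and w0: "w0 \<in> \<Omega>"
  shows "\<exists>U \<gamma>. w0 \<in> U \<and> U \<subseteq> \<Omega> \<and> antihol_frame (eigen_fiber H) 1 U (\<lambda>_. \<gamma>)"
proof -
  note mod = hilbert_moduleD[OF B_starD(1)[OF H]]
  note line = one_dimensional_line[OF subspace_eigen_fiber[OF mod] B_starD(3)[OF H]]
  obtain k where k: "k \<in> eigen_fiber H w0" "k \<noteq> 0"
    using line[OF w0] by metis
  define U where "U = {w\<in>\<Omega>. \<exists>h\<in>eigen_fiber H w. cinner h k \<noteq> 0}"
  have U_sub: "U \<subseteq> \<Omega>" and w0U: "w0 \<in> U"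
    using w0 k cinner_self_eq_0_iff[of k] by (auto simp: U_def simp del: cinner_self_eq_0_iff)
  have "\<exists>h\<in>eigen_fiber H w. cinner h k = 1" if w: "w \<in> U" for w
  proof -
    obtain h where h: "h \<in> eigen_fiber H w" "cinner h k \<noteq> 0"
      using w by (auto simp: U_def)
    then show ?thesis
      using cvec.subspace_scale[OF subspace_eigen_fiber[OF mod] h(1)]
      by (intro bexI[of _ "(1 / cinner h k) *\<^sub>C h"]) (simp_all add: cinner_scaleC_left)
  qed
  then obtain \<gamma> where \<gamma>: "\<And>w. w \<in> U \<Longrightarrow> \<gamma> w \<in> eigen_fiber H w" "\<And>w. w \<in> U \<Longrightarrow> cinner (\<gamma> w) k = 1"
    by metis
  have carr: "h \<in> carrier H" if "h \<in> eigen_fiber H w" for h w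
    using that by (simp add: eigen_fiber_def)
  have col: "norm (h \<otimes>\<^sub>e (\<chi> i. cnj (z $ i - w $ i))) = norm h * norm (z - w)"
    for h :: 'h and z w :: "complex ^ 'n"
    using norm_cnj_vec[of "z - w"] by (simp add: norm_etensor)
  obtain C where C0: "\<And>w. w \<in> U \<Longrightarrow> 0 \<le> C w"
    and C: "\<And>w r. w \<in> U \<Longrightarrow> r \<in> carrier H \<Longrightarrow>
      norm (r - cinner r k *\<^sub>C \<gamma> w) \<le> C w * norm (adj_column H w r)"
  proof -
    have "\<forall>w\<in>U. \<exists>C\<ge>0. \<forall>r\<in>carrier H. norm (r - cinner r k *\<^sub>C \<gamma> w) \<le> C * norm (adj_column H w r)"
      using eigen_fiber_gap[OF H] \<gamma> U_sub by blast
    then show ?thesis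
      using that by metis
  qed
  have gap: "norm (h - cinner h k *\<^sub>C \<gamma> w) \<le> C w * (norm h * norm (z - w))"
    if "w \<in> U" "h \<in> eigen_fiber H z" for w z h
    using C[OF that(1) carr[OF that(2)]]
    unfolding adj_column_eigenvector[OF mod that(2)] col .
  have openU: "open U"
    unfolding open_dist
  proof
    fix w assume w: "w \<in> U"
    then obtain e where e: "0 < e" "\<And>z. dist z w < e \<Longrightarrow> z \<in> \<Omega>"
      using \<Omega> U_sub unfolding open_dist by blast
    have "z \<in> U" if z: "dist z w < min e (1 / (C w + 1))" for z
    proof -
      have z\<Omega>: "z \<in> \<Omega>"
        using z e by simp
      obtain h where h: "h \<in> eigen_fiber H z" "h \<noteq> 0"
        using line[OF z\<Omega>] by metis
      \<comment> \<open>A vector of the fibre over \<open>z\<close> orthogonal to \<open>k\<close>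
        would satisfy \<open>norm h \<le> C w * norm h * norm (z - w)\<close>, which is impossible
        for \<open>z\<close> this close to \<open>w\<close>.\<close>
      have "cinner h k \<noteq> 0"
      proof
        assume "cinner h k = 0"
        then have "norm h * 1 \<le> norm h * (C w * norm (z - w))"
          using gap[OF w h(1)] by (simp add: mult_ac)
        then have "1 \<le> C w * norm (z - w)"
          using h(2) by simp
        moreover have "norm (z - w) * (C w + 1) < 1"
          using z C0[OF w] by (simp add: dist_norm pos_less_divide_eq)
        ultimately show False
          using norm_ge_zero[of "z - w"] by (simp add: algebra_simps)
      qed
      then show ?thesis
        using z\<Omega> h(1) by (auto simp: U_def)
    qed
    then show "\<exists>e>0. \<forall>z. dist z w < e \<longrightarrow> z \<in> U"
      using e(1) C0[OF w] by (intro exI[of _ "min e (1 / (C w + 1))"]) auto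
  qed
  \<comment> \<open>The gap bound contains \<open>norm (\<gamma> z)\<close>. Splitting it as
    \<open>norm (\<gamma> z - \<gamma> w) + norm (\<gamma> w)\<close> and absorbing half of the
    left-hand side leaves a bound in terms of \<open>\<gamma> w\<close>.\<close>
  have lip: "norm (\<gamma> z - \<gamma> w) \<le> 2 * C w * norm (\<gamma> w) * norm (z - w)"
    if w: "w \<in> U" and z: "z \<in> U" and small: "2 * C w * norm (z - w) \<le> 1" for w z
  proof -
    have "norm (\<gamma> z - \<gamma> w) \<le> C w * (norm (\<gamma> z) * norm (z - w))"
      using gap[OF w \<gamma>(1)[OF z]] \<gamma>(2)[OF z] by simp
    also have "\<dots> \<le> C w * ((norm (\<gamma> z - \<gamma> w) + norm (\<gamma> w)) * norm (z - w))"
      using norm_triangle_ineq[of "\<gamma> z - \<gamma> w" "\<gamma> w"]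
      by (intro mult_left_mono[OF _ C0[OF w]] mult_right_mono) auto
    also have "\<dots> = norm (\<gamma> z - \<gamma> w) * (C w * norm (z - w)) + C w * norm (\<gamma> w) * norm (z - w)"
      by (simp add: algebra_simps)
    also have "\<dots> \<le> norm (\<gamma> z - \<gamma> w) * (1 / 2) + C w * norm (\<gamma> w) * norm (z - w)"
      using small by (intro add_right_mono mult_left_mono) auto
    finally show ?thesis
      by simp
  qed
  have deriv: "\<exists>D. (\<gamma> has_derivative D) (at w) \<and> (\<forall>c v. D (c *\<^sub>C v) = cnj c *\<^sub>C D v)"
    if w: "w \<in> U" for w
  proof -
    obtain e where e: "0 < e" "\<And>z. dist z w < e \<Longrightarrow> z \<in> U"
      using openU w unfolding open_dist by blast
    \<comment> \<open>The second entry of the minimum provides the smallness condition of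
      \<open>lip\<close>.\<close>
    define d where "d = min e (1 / (2 * C w + 1))"
    have d: "0 < d"
      using e C0[OF w] by (simp add: d_def)
    have near: "z \<in> U" "2 * C w * norm (z - w) \<le> 1" if "norm (z - w) < d" for z
    proof -
      show "z \<in> U"
        using that e by (simp add: d_def dist_norm)
      have "norm (z - w) * (2 * C w + 1) < 1"
        using that C0[OF w] by (simp add: d_def pos_less_divide_eq)
      then have "norm (z - w) + 2 * C w * norm (z - w) < 1"
        by (simp add: algebra_simps)
      then show "2 * C w * norm (z - w) \<le> 1"
        using norm_ge_zero[of "z - w"] by linarith
    qed
    \<comment> \<open>The derivative in direction \<open>i\<close> must have the column
      \<open>\<gamma> w \<otimes>\<^sub>e axis i 1\<close>. The tensors with
      \<open>\<gamma> (z n)\<close> in place of \<open>\<gamma> w\<close> are columns of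
      \<open>\<gamma> (z n)\<close> divided by the step \<open>t n\<close>. These preimages are
      unbounded, but closedness of the range still yields one for the limit.\<close>
    have "\<exists>v\<in>carrier H. adj_column H w v = \<gamma> w \<otimes>\<^sub>e axis i 1 \<and> cinner v k = 0" for i
    proof -
      define t where "t n = d / 2 * inverse (real (Suc n))" for n
      define z where "z n = w + axis i (of_real (t n))" for n
      have t: "0 < t n" "t n < d" for n
      proof -
        show "0 < t n"
          using d by (simp add: t_def)
        have "d / 2 * inverse (real (Suc n)) \<le> d / 2 * 1"
          using d by (intro mult_left_mono) (auto simp: inverse_le_1_iff)
        then show "t n < d"
          using d by (simp add: t_def)
      qed
      have tlim: "t \<longlonglongrightarrow> 0"
        using tendsto_mult_left[OF LIMSEQ_inverse_real_of_nat, of "d / 2"] by (simp add: t_def[abs_def])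
      have zw: "norm (z n - w) = t n" for n
        using t(1)[of n] by (simp add: z_def norm_axis_eq)
      have zU: "z n \<in> U" "2 * C w * norm (z n - w) \<le> 1" for n
        using near[of "z n"] t(2)[of n] by (simp_all add: zw)
      have "(\<lambda>n. 2 * C w * norm (\<gamma> w) * t n) \<longlonglongrightarrow> 0"
        using tendsto_mult_left[OF tlim, of "2 * C w * norm (\<gamma> w)"] by simp
      then have "(\<lambda>n. \<gamma> (z n) - \<gamma> w) \<longlonglongrightarrow> 0"
        by (rule Lim_null_comparison[rotated])
          (use lip[OF w zU] in \<open>intro always_eventually allI, simp add: zw\<close>)
      then have glim: "(\<lambda>n. \<gamma> (z n)) \<longlonglongrightarrow> \<gamma> w"
        by (simp add: LIM_zero_iff)
      have lim: "(\<lambda>n. \<gamma> (z n) \<otimes>\<^sub>e (axis i 1 :: complex ^ 'n)) \<longlonglongrightarrow> \<gamma> w \<otimes>\<^sub>e axis i 1"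
        by (rule bounded_bilinear.tendsto[OF bounded_bilinear_etensor glim tendsto_const])
      have mem: "\<gamma> (z n) \<otimes>\<^sub>e axis i 1 \<in> adj_column H w ` carrier H" for n
      proof
        have gc: "\<gamma> (z n) \<in> carrier H"
          by (rule carr[OF \<gamma>(1)[OF zU(1)]])
        show "of_real (inverse (t n)) *\<^sub>C \<gamma> (z n) \<in> carrier H"
          by (rule cvec.subspace_scale[OF mod(1) gc])
        have "(\<chi> j. cnj (z n $ j - w $ j)) = of_real (t n) *\<^sub>C (axis i 1 :: complex ^ 'n)"
          by (simp add: vec_eq_iff z_def axis_def)
        then show "\<gamma> (z n) \<otimes>\<^sub>e axis i 1 = adj_column H w (of_real (inverse (t n)) *\<^sub>C \<gamma> (z n))"
          using t(1)[of n]
          by (simp add: adj_column_linear(2)[OF mod gc gc] adj_column_eigenvector[OF mod \<gamma>(1)[OF zU(1)]]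
              etensor_scaleC_right scaleC_scaleC del: of_real_inverse flip: of_real_mult)
      qed
      have closed: "closed (adj_column H w ` carrier H)"
        using B_starD(2)[OF H] w U_sub unfolding adj_column_def[abs_def] by blast
      obtain v where v: "v \<in> carrier H" "adj_column H w v = \<gamma> w \<otimes>\<^sub>e axis i 1"
        using closed_sequentially[OF closed mem lim] by (elim imageE) simp
      \<comment> \<open>Subtracting this element of the kernel leaves the column unchanged and
        arranges orthogonality to \<open>k\<close>.\<close>
      have gw: "cinner v k *\<^sub>C \<gamma> w \<in> eigen_fiber H w"
        by (rule cvec.subspace_scale[OF subspace_eigen_fiber[OF mod] \<gamma>(1)[OF w]])
      have "adj_column H w (v - cinner v k *\<^sub>C \<gamma> w) = \<gamma> w \<otimes>\<^sub>e axis i 1"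
        using adj_column_eq_0_iff[OF carr[OF gw], of w] gw
        by (simp add: adj_column_linear(3)[OF mod v(1) carr[OF gw]] v(2))
      moreover have "cinner (v - cinner v k *\<^sub>C \<gamma> w) k = 0"
        by (simp add: cinner_diff_left cinner_scaleC_left \<gamma>(2)[OF w])
      ultimately show ?thesis
        using cvec.subspace_diff[OF mod(1) v(1) carr[OF gw]] by blast
    qed
    then obtain v where v: "\<And>i. v i \<in> carrier H"
      "\<And>i. adj_column H w (v i) = \<gamma> w \<otimes>\<^sub>e axis i 1" "\<And>i. cinner (v i) k = 0"
      by metis
    \<comment> \<open>The conjugated coordinates make \<open>D\<close> conjugate linear, as the
      derivative of an anti-holomorphic map has to be.\<close>
    define D where "D x = (\<Sum>i\<in>UNIV. cnj (x $ i) *\<^sub>C v i)" for x :: "complex ^ 'n"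
    have bl: "bounded_linear D"
      unfolding D_def
      by (intro bounded_linear_sum bounded_bilinear.bounded_linear_left[OF bounded_bilinear_scaleC,
            THEN bounded_linear_compose] bounded_linear_compose[OF bounded_linear_cnj] bounded_linear_vec_nth)
    have Dc: "D x \<in> carrier H" for x
      unfolding D_def by (intro cvec.subspace_sum[OF mod(1)] cvec.subspace_scale[OF mod(1)] v)
    have colD: "adj_column H w (D x) = \<gamma> w \<otimes>\<^sub>e (\<chi> i. cnj (x $ i))" for x
    proof -
      have "(\<chi> i. cnj (x $ i)) = (\<Sum>i\<in>UNIV. cnj (x $ i) *\<^sub>C (axis i 1 :: complex ^ 'n))"
        by (simp add: vec_eq_iff axis_def if_distrib[of "\<lambda>t. _ * t"] cong: if_cong)
      then show ?thesis
        unfolding D_def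
        by (simp add: adj_column_sum[OF mod v(1)] v(2) etensor_sum_right etensor_scaleC_right)
    qed
    have "(\<gamma> has_derivative D) (at w)"
    proof (rule has_derivative_quadratic_remainder[OF bl d])
      fix z assume z: "norm (z - w) < d"
      note zU = near[OF z]
      \<comment> \<open>The normalisation of \<open>\<gamma>\<close> and the orthogonality of the
        \<open>v i\<close> to \<open>k\<close> give \<open>cinner r k = 0\<close>, so the gap bound
        applies to \<open>r\<close> itself.\<close>
      define r where "r = \<gamma> z - \<gamma> w - D (z - w)"
      have gc: "\<gamma> z \<in> carrier H" "\<gamma> w \<in> carrier H" "\<gamma> z - \<gamma> w \<in> carrier H"
        using carr[OF \<gamma>(1)[OF zU(1)]] carr[OF \<gamma>(1)[OF w]] cvec.subspace_diff[OF mod(1)] by auto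
      have rc: "r \<in> carrier H"
        unfolding r_def by (rule cvec.subspace_diff[OF mod(1) gc(3) Dc])
      have "cinner r k = 0"
        by (simp add: r_def D_def cinner_diff_left \<gamma>(2)[OF w] \<gamma>(2)[OF zU(1)] cinner_sum_left
            cinner_scaleC_left v(3))
      then have "norm r \<le> C w * norm (adj_column H w r)"
        using C[OF w rc] by simp
      also have "adj_column H w r = (\<gamma> z - \<gamma> w) \<otimes>\<^sub>e (\<chi> i. cnj (z $ i - w $ i))"
        using adj_column_eq_0_iff[OF gc(2), of w] \<gamma>(1)[OF w]
        by (simp add: r_def adj_column_linear(3)[OF mod gc(3) Dc] adj_column_linear(3)[OF mod gc(1,2)]
            adj_column_eigenvector[OF mod \<gamma>(1)[OF zU(1)]] colD etensor_diff_left)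
      also have "norm \<dots> = norm (\<gamma> z - \<gamma> w) * norm (z - w)"
        by (rule col)
      also have "C w * \<dots> \<le> C w * (2 * C w * norm (\<gamma> w) * norm (z - w) * norm (z - w))"
        by (intro mult_left_mono[OF _ C0[OF w]] mult_right_mono lip[OF w zU]) simp
      also have "\<dots> = C w * (2 * C w * norm (\<gamma> w)) * (norm (z - w))\<^sup>2"
        by (simp add: power2_eq_square mult_ac)
      finally show "norm (\<gamma> z - \<gamma> w - D (z - w)) \<le> C w * (2 * C w * norm (\<gamma> w)) * (norm (z - w))\<^sup>2"
        by (simp add: r_def)
    qed
    moreover have "D (c *\<^sub>C x) = cnj c *\<^sub>C D x" for c x
      by (simp add: D_def cvec.scale_sum_right scaleC_scaleC)
    ultimately show ?thesis
      by blast
  qed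
  have "antihol_frame (eigen_fiber H) 1 U (\<lambda>_. \<gamma>)"
    unfolding antihol_frame_iff
  proof (intro conjI allI impI ballI openU)
    show "antiholomorphic_vec \<gamma> U"
      unfolding antiholomorphic_vec_def using deriv by blast
  next
    fix z c b assume z: "z \<in> U" and c: "(\<Sum>b<1::nat. c b *\<^sub>C \<gamma> z) = 0" and b: "b < (1::nat)"
    then show "c b = 0"
      using \<gamma>(2)[OF z] by auto
  next
    fix z assume z: "z \<in> U"
    have g0: "\<gamma> z \<noteq> 0"
      using \<gamma>(2)[OF z] by auto
    have "cvec.span {\<gamma> z} = eigen_fiber H z"
    proof
      show "cvec.span {\<gamma> z} \<subseteq> eigen_fiber H z"
        using \<gamma>(1)[OF z] by (intro cvec.span_minimal subspace_eigen_fiber[OF mod]) simp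
      show "eigen_fiber H z \<subseteq> cvec.span {\<gamma> z}"
      proof
        fix x assume "x \<in> eigen_fiber H z"
        then obtain c where "x = c *\<^sub>C \<gamma> z"
          using line[of z] \<gamma>(1)[OF z] g0 z U_sub by (metis subsetD)
        then show "x \<in> cvec.span {\<gamma> z}"
          by (auto simp: cvec.span_singleton)
      qed
    qed
    then show "cvec.span ((\<lambda>_. \<gamma> z) ` {..<1::nat}) = eigen_fiber H z"
      by (simp add: lessThan_Suc)
  qed
  then show ?thesis
    using w0U U_sub by blast
qed

theorem theorem2p2:
  fixes \<Omega> :: "(complex ^ 'n::finite) set"
    and H :: "('n, 'h::chilbert_space) hmod"
    and \<Theta> :: "complex ^ 'n \<Rightarrow> complex ^ 'p::finite ^ 'q::finite"
  assumes "open \<Omega>" and "connected \<Omega>" and "\<Omega> \<noteq> {}" and "bounded \<Omega>"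
    and "CARD('p) < CARD('q)"
    and "H \<in> B_star 1 \<Omega>"
    and "\<Theta> \<in> multipliers \<Omega> H"
    and "left_invertible_mult \<Omega> H \<Theta>"
  shows "\<forall>w\<in>\<Omega>.
    eigen_fiber (canonical_model \<Omega> H \<Theta>) w =
      cvec.span {k \<otimes>\<^sub>e \<eta> | k \<eta>. k \<in> eigen_fiber H w \<and> \<eta> \<in> ker_fiber \<Theta> w} \<and>
    (\<forall>i j. \<forall>k\<in>eigen_fiber H w. \<forall>\<eta>\<in>ker_fiber \<Theta> w.
      curvature (eigen_fiber (canonical_model \<Omega> H \<Theta>)) w i j (k \<otimes>\<^sub>e \<eta>)
        - curvature (eigen_fiber H) w i j k \<otimes>\<^sub>e \<eta>
      = k \<otimes>\<^sub>e curvature (ker_fiber \<Theta>) w i j \<eta>)"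
proof (intro ballI conjI allI)
  note fiber = eigen_fiber_canonical_model[OF assms(6,7)]
  fix w assume w: "w \<in> \<Omega>"
  show "eigen_fiber (canonical_model \<Omega> H \<Theta>) w =
      cvec.span {k \<otimes>\<^sub>e \<eta> | k \<eta>. k \<in> eigen_fiber H w \<and> \<eta> \<in> ker_fiber \<Theta> w}"
    by (rule fiber[OF w])
  fix i j k \<eta> assume k: "k \<in> eigen_fiber H w" and \<eta>: "\<eta> \<in> ker_fiber \<Theta> w"
  obtain \<Psi> where \<Psi>: "\<Psi> \<in> multipliers \<Omega> H" "\<And>z. z \<in> \<Omega> \<Longrightarrow> \<Psi> z ** \<Theta> z = mat 1"
    using assms(8) unfolding left_invertible_mult_def by blast
  have hol: "holomorphic_vec \<Theta> \<Omega>" "holomorphic_vec \<Psi> \<Omega>"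
    using assms(7) \<Psi>(1) by (simp_all add: multipliers_def)
  obtain U \<gamma> where U: "w \<in> U" "U \<subseteq> \<Omega>" and g: "antihol_frame (eigen_fiber H) 1 U (\<lambda>_. \<gamma>)"
    using eigen_fiber_frame[OF assms(6,1) w] by blast
  obtain m V e where V: "w \<in> V" "V \<subseteq> \<Omega>" and e: "antihol_frame (ker_fiber \<Theta>) m V e"
    using ker_fiber_frame[OF assms(1) w hol \<Psi>(2)] by blast
  \<comment> \<open>The fibre identity enters on the whole neighbourhood
    \<open>U \<inter> V\<close>, since the curvature at \<open>w\<close> depends on nearby
    fibres.\<close>
  have "curvature (eigen_fiber (canonical_model \<Omega> H \<Theta>)) w i j (k \<otimes>\<^sub>e \<eta>)
      = curvature (eigen_fiber H) w i j k \<otimes>\<^sub>e \<eta> + k \<otimes>\<^sub>e curvature (ker_fiber \<Theta>) w i j \<eta>"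
    using U V by (intro curvature_etensor[OF g e _ fiber k \<eta>]) auto
  then show "curvature (eigen_fiber (canonical_model \<Omega> H \<Theta>)) w i j (k \<otimes>\<^sub>e \<eta>)
        - curvature (eigen_fiber H) w i j k \<otimes>\<^sub>e \<eta>
      = k \<otimes>\<^sub>e curvature (ker_fiber \<Theta>) w i j \<eta>"
    by simp
qed

end
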